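(* Let $\Omega$, $\gamma$, $\Psi$ be as in the context, let $\gamma<r_{\mathrm i}<r_{\mathrm e}$, put $r=r_{\mathrm i}/r_{\mathrm e}$, and let $A=\{\Psi(w): r_{\mathrm i}<|w|<r_{\mathrm e}\}$. Then the Hausdorff distance between the spectrum of the (adjoint) Neumann–Poincaré operator $\mathbb{K}^*_{\partial A}$ of $A$ and the interval $[-1/2,1/2]$ converges to zero as $r_{\mathrm e}$ approaches $r_{\mathrm i}$, that is, $$\lim_{r\to 1} d_H\big(\sigma(\mathbb{K}^*_{\partial A}),[-1/2,1/2]\big)=0 .$$
   Context: Identify $\mathbb{R}^2$ with $\mathbb{C}$. Let $\Omega\subset\mathbb{C}$ be a simply connected bounded domain of conformal radius $\gamma>0$, and let $z=\Psi(w)=w+a_0+\frac{a_1}{w}+\frac{a_2}{w^2}+\cdots$ be the conformal bijection from $\{|w|>\gamma\}$ onto the exterior $\mathbb{C}\setminus\overline{\Omega}$. The inner radius $r_{\mathrm i}>\gamma$ is fixed and $r_{\mathrm e}\downarrow r_{\mathrm i}$, i.e. $r=r_{\mathrm i}/r_{\mathrm e}\nearrow 1$. The boundary of $A$ is $\partial A=\Gamma_{\mathrm i}\cup\Gamma_{\mathrm e}$ with $\Gamma_\alpha=\{\Psi(w):|w|=r_\alpha\}$, $\alpha\in\{\mathrm i,\mathrm e\}$. The (adjoint) Neumann–Poincaré operator of $A$ is $$\mathbb{K}^*_{\partial A}[\phi](x)=\frac1{2\pi}\int_{\partial A}\frac{\langle x-y,\nu_x\rangle}{|x-y|^2}\,\phi(y)\,d\sigma(y),\qquad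 x\in\partial A,$$ where $\nu_x$ is the unit normal to $\partial A$ pointing out of $A$. It acts on $K^{-1/2}(\Gamma_{\mathrm i})\oplus K^{-1/2}(\Gamma_{\mathrm e})$, where, with $\phi^\alpha_n(\Psi(r_\alpha e^{i\theta}))=\dfrac{e^{in\theta}}{r_\alpha|\Psi'(r_\alpha e^{i\theta})|}$ for $n\in\mathbb{Z}$, $$K^{-1/2}(\Gamma_\alpha)=\Big\{\sum_{n\in\mathbb{Z}}a_n\phi_n^\alpha:\sum_{n\in\mathbb{Z}}|a_n|^2<\infty\Big\},$$ a Hilbert space isometric to $\ell^2(\mathbb{Z})$ via $(a_n)\mapsto\sum a_n\phi_n^\alpha$. $\sigma(\cdot)$ denotes the spectrum and $d_H$ the Hausdorff distance between subsets of $\mathbb{R}$. *)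

theory Defs
  imports "HOL-Complex_Analysis.Complex_Analysis"
begin

(* Hausdorff distance. It takes values in ennreal, so that the suprema need no boundedness side
   condition and the distance from the empty set to a nonempty one is infinity. *)
definition hausdorff_distance :: "'a::metric_space set \<Rightarrow> 'a set \<Rightarrow> ennreal" where
  "hausdorff_distance S T =
     max (SUP s\<in>S. INF t\<in>T. ennreal (dist s t)) (SUP t\<in>T. INF s\<in>S. ennreal (dist s t))"

(* Bounded linear operators and their spectrum on the quotient of the complex function space V by
   the null space of its norm p: functions f, g with p (f - g) = 0 (for example, functions that
   agree almost everywhere) represent the same element. *)
definition bounded_operator_on ::
  "('a \<Rightarrow> complex) set \<Rightarrow> (('a \<Rightarrow> complex) \<Rightarrow> real) \<Rightarrow> (('a \<Rightarrow> complex) \<Rightarrow> 'a \<Rightarrow> complex) \<Rightarrow> bool" where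
  "bounded_operator_on V p T \<longleftrightarrow>
     (\<forall>f\<in>V. T f \<in> V) \<and>
     (\<forall>f\<in>V. \<forall>g\<in>V. p (\<lambda>x. T (\<lambda>y. f y + g y) x - (T f x + T g x)) = 0) \<and>
     (\<forall>f\<in>V. \<forall>c. p (\<lambda>x. T (\<lambda>y. c * f y) x - c * T f x) = 0) \<and>
     (\<exists>C. \<forall>f\<in>V. p (T f) \<le> C * p f)"

definition operator_spectrum ::
  "('a \<Rightarrow> complex) set \<Rightarrow> (('a \<Rightarrow> complex) \<Rightarrow> real) \<Rightarrow> (('a \<Rightarrow> complex) \<Rightarrow> 'a \<Rightarrow> complex) \<Rightarrow> complex set" where
  "operator_spectrum V p T =
     {l. \<not> (\<exists>S. bounded_operator_on V p S \<and>
            (\<forall>f\<in>V. p (\<lambda>x. S (\<lambda>y. l * f y - T f y) x - f x) = 0 \<and>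
                   p (\<lambda>x. (l * S f x - T (S f) x) - f x) = 0))}"

definition arc_length_measure :: "(real \<Rightarrow> complex) \<Rightarrow> real \<Rightarrow> real \<Rightarrow> complex measure" where
  "arc_length_measure g a b =
     distr (density (restrict_space lborel {a..b}) (\<lambda>t. ennreal (norm (vector_derivative g (at t)))))
       borel g"

definition level_curve_measure :: "(complex \<Rightarrow> complex) \<Rightarrow> real \<Rightarrow> complex measure" where
  "level_curve_measure \<Psi> \<rho> = arc_length_measure (\<lambda>\<theta>. \<Psi> (of_real \<rho> * cis \<theta>)) 0 (2 * pi)"

(* The density phi_n on the level curve {Psi w | norm w = rho}. *)
definition density_basis :: "(complex \<Rightarrow> complex) \<Rightarrow> real \<Rightarrow> int \<Rightarrow> complex \<Rightarrow> complex" where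
  "density_basis \<Psi> \<rho> n y =
     (let w = inv_into (sphere 0 \<rho>) \<Psi> y
      in cis (of_int n * Arg w) / of_real (\<rho> * norm (deriv \<Psi> w)))"

(* phi is the sum of a_n phi_n on the level curve, with square-summable a. The series is summed in
   L^2 of arc length; since rho * norm (Psi') lies between two positive constants on the circle of
   radius rho, it converges there for every square-summable a. *)
definition density_series ::
  "(complex \<Rightarrow> complex) \<Rightarrow> real \<Rightarrow> (complex \<Rightarrow> complex) \<Rightarrow> (int \<Rightarrow> complex) \<Rightarrow> bool" where
  "density_series \<Psi> \<rho> \<phi> a \<longleftrightarrow>
     (\<lambda>n. (norm (a n))\<^sup>2) summable_on UNIV \<and>
     (\<lambda>N. \<integral>\<^sup>+ y. ennreal ((norm (\<phi> y - (\<Sum>n = - int N..int N. a n * density_basis \<Psi> \<rho> n y)))\<^sup>2)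
            \<partial>level_curve_measure \<Psi> \<rho>) \<longlonglongrightarrow> 0"

(* K^{-1/2}(Gamma_i) + K^{-1/2}(Gamma_e) as functions on the union of the two curves; the values
   off the curves are irrelevant. *)
definition density_space :: "(complex \<Rightarrow> complex) \<Rightarrow> real \<Rightarrow> real \<Rightarrow> (complex \<Rightarrow> complex) set" where
  "density_space \<Psi> r\<^sub>i r\<^sub>e =
     {\<phi> \<in> borel_measurable borel.
        (\<exists>a. density_series \<Psi> r\<^sub>i \<phi> a) \<and> (\<exists>b. density_series \<Psi> r\<^sub>e \<phi> b)}"

(* The norm for which (a, b) |-> sum of a_n phi_n^i + b_n phi_n^e is isometric on l^2 + l^2. *)
definition density_norm ::
  "(complex \<Rightarrow> complex) \<Rightarrow> real \<Rightarrow> real \<Rightarrow> (complex \<Rightarrow> complex) \<Rightarrow> real" where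
  "density_norm \<Psi> r\<^sub>i r\<^sub>e \<phi> =
     sqrt ((\<Sum>\<^sub>\<infinity>n. (norm ((THE a. density_series \<Psi> r\<^sub>i \<phi> a) n))\<^sup>2) +
           (\<Sum>\<^sub>\<infinity>n. (norm ((THE b. density_series \<Psi> r\<^sub>e \<phi> b) n))\<^sup>2))"

(* The unit vector that is orthogonal to the tangent line of the boundary at x and points out of A. *)
definition outward_normal :: "complex set \<Rightarrow> complex \<Rightarrow> complex" where
  "outward_normal A x =
     (THE \<nu>. norm \<nu> = 1 \<and>
        ((\<lambda>y. inner (y - x) \<nu> / norm (y - x)) \<longlongrightarrow> 0) (at x within frontier A) \<and>
        (\<forall>\<^sub>F t in at_right 0. x + t *\<^sub>R \<nu> \<notin> A))"

definition conformal_annulus :: "(complex \<Rightarrow> complex) \<Rightarrow> real \<Rightarrow> real \<Rightarrow> complex set" where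
  "conformal_annulus \<Psi> r\<^sub>i r\<^sub>e = \<Psi> ` {w. r\<^sub>i < norm w \<and> norm w < r\<^sub>e}"

(* The value off the boundary of A is set to 0. On the diagonal, a null set, division by zero makes
   the integrand 0. *)
definition NP_adjoint ::
  "(complex \<Rightarrow> complex) \<Rightarrow> real \<Rightarrow> real \<Rightarrow> (complex \<Rightarrow> complex) \<Rightarrow> complex \<Rightarrow> complex" where
  "NP_adjoint \<Psi> r\<^sub>i r\<^sub>e \<phi> x =
     (let A = conformal_annulus \<Psi> r\<^sub>i r\<^sub>e;
          F = (\<lambda>y. of_real (inner (x - y) (outward_normal A x) / (norm (x - y))\<^sup>2) * \<phi> y)
      in if x \<in> frontier A
         then 1 / of_real (2 * pi) *
           ((\<integral>y. F y \<partial>level_curve_measure \<Psi> r\<^sub>i) + (\<integral>y. F y \<partial>level_curve_measure \<Psi> r\<^sub>e))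
         else 0)"

definition NP_spectrum :: "(complex \<Rightarrow> complex) \<Rightarrow> real \<Rightarrow> real \<Rightarrow> complex set" where
  "NP_spectrum \<Psi> r\<^sub>i r\<^sub>e =
     operator_spectrum (density_space \<Psi> r\<^sub>i r\<^sub>e) (density_norm \<Psi> r\<^sub>i r\<^sub>e) (NP_adjoint \<Psi> r\<^sub>i r\<^sub>e)"

end

theory Submission
  imports Defs
begin

text \<open>
  Pulled back to the two circles by \<open>\<Psi>\<close>, the kernel of the operator is the real part of
  \<open>\<plusminus> w \<Psi>'(w) / (\<Psi> w - \<Psi> \<zeta>)\<close>. Its singular part \<open>w / (w - \<zeta>)\<close> gives, up to constants, the Fourier
  multiplier \<open>r ^ \<bar>n\<bar> / 2\<close> that exchanges the two circles; the regular part has a double expansion in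
  \<open>1 / w\<close> and \<open>1 / \<zeta>\<close> with coefficients that do not depend on \<open>r\<^sub>e\<close> and decay exponentially. As
  \<open>r\<^sub>e\<close> tends to \<open>r\<^sub>i\<close>, the regular part tends to a nonzero but nilpotent block matrix. In the coordinates
  \<open>f\<^sub>i + f\<^sub>e\<close> and \<open>\<delta> (f\<^sub>i - f\<^sub>e)\<close> with \<open>\<delta> = sqrt (1 - r)\<close> the operator is therefore the diagonal operator
  with entries \<open>\<plusminus> r ^ \<bar>n\<bar> / 2\<close> plus a perturbation whose entries are bounded by
  \<open>O(\<delta>) w\<^sub>m w\<^sub>n\<close> with exponentially decaying weights \<open>w\<close>.

  A Neumann series bounds the resolvent away from \<open>[-1/2, 1/2]\<close>. Conversely, on a circle around
  \<open>\<plusminus> r ^ n / 2\<close> whose radius is a fraction of the gap to the neighbouring entries, the same estimate still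
  holds, since the entries close to the circle have high frequency and hence tiny weights. If the disc
  contained no spectrum, then \<open>(l \<minusplus> r ^ n / 2)\<close> times a diagonal entry of the resolvent at \<open>l\<close> would be
  holomorphic in the disc, vanish at the centre and be close to 1 on the circle, contradicting the
  maximum principle. As \<open>r\<close> tends to 1, the numbers \<open>\<plusminus> r ^ n / 2\<close> become dense.
\<close>

text \<open>The obstacle is a mismatch of scales. Consecutive numbers \<open>r ^ n / 2\<close>
  differ by O(1 - r), while the perturbation is bounded only by a multiple of sqrt (1 - r). A plain
  norm estimate therefore keeps the spectrum near the interval but cannot put a spectral point near
  each \<open>r ^ n / 2\<close>; this is why the estimates carry weights by frequency. Moreover the
  entries with indices n and -n coincide, so no simple eigenvalue is at hand, and no
  self-adjointness is used. A single diagonal entry of the resolvent copes with both.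

  The rescaling works for the following reason. The regular part reads a density almost only through
  the sum of its two components, and, the normals being opposite, it answers with almost opposite
  values on the two curves. So its large block maps sums to differences and is multiplied by
  \<delta>. The block from differences to sums has a factor 1 - r from the input and another from
  the output, and so survives division by \<delta>.\<close>

section \<open>Small perturbations of diagonal operators in a weighted space\<close>

text \<open>The bound is that of a matrix with entries at most \<open>\<eta> * w j * w k\<close>:
  the size of \<open>y\<close> enters through one number only. The natural domain is thus a weighted
  l1 space, larger than l2; solutions are found there and their square summability is checked
  afterwards.\<close>

locale weighted_perturbation =
  fixes w :: "'j \<Rightarrow> real" and P :: "('j \<Rightarrow> complex) \<Rightarrow> 'j \<Rightarrow> complex"
    and \<eta> :: real
  assumes w_pos: "w j > 0"
    and w_square_summable: "(\<lambda>j. (w j)\<^sup>2) summable_on UNIV"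
    and eta_nonneg: "\<eta> \<ge> 0"
    and P_diff: "\<lbrakk>(\<lambda>j. w j * cmod (y j)) summable_on UNIV; (\<lambda>j. w j * cmod (y' j)) summable_on UNIV\<rbrakk>
        \<Longrightarrow> P (\<lambda>j. y j - y' j) = (\<lambda>j. P y j - P y' j)"
    and P_bound: "(\<lambda>j. w j * cmod (y j)) summable_on UNIV
        \<Longrightarrow> cmod (P y j) \<le> \<eta> * w j * (\<Sum>\<^sub>\<infinity>k. w k * cmod (y k))"
begin

definition wsum :: "('j \<Rightarrow> complex) \<Rightarrow> real" where
  "wsum y = (\<Sum>\<^sub>\<infinity>j. w j * cmod (y j))"

definition wsummable :: "('j \<Rightarrow> complex) \<Rightarrow> bool" where
  "wsummable y \<longleftrightarrow> (\<lambda>j. w j * cmod (y j)) summable_on UNIV"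

lemma w_nonneg [simp]: "w j \<ge> 0"
  using w_pos[of j] by simp

lemma wsum_nonneg: "wsum y \<ge> 0"
  unfolding wsum_def by (intro infsum_nonneg) simp

lemma P_wbound: "wsummable y \<Longrightarrow> cmod (P y j) \<le> \<eta> * w j * wsum y"
  unfolding wsum_def wsummable_def by (rule P_bound)

lemma wsummable_diff:
  assumes "wsummable y" "wsummable y'"
  shows "wsummable (\<lambda>j. y j - y' j)"
proof -
  have "(\<lambda>j. w j * cmod (y j) + w j * cmod (y' j)) summable_on UNIV"
    using assms unfolding wsummable_def by (rule summable_on_add)
  then show ?thesis
    unfolding wsummable_def
  proof (rule summable_on_comparison_test)
    fix j
    have "w j * cmod (y j - y' j) \<le> w j * (cmod (y j) + cmod (y' j))"
      using w_pos[of j] by (intro mult_left_mono norm_triangle_ineq4) simp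
    then show "w j * cmod (y j - y' j) \<le> w j * cmod (y j) + w j * cmod (y' j)"
      by (simp add: algebra_simps)
  qed auto
qed

lemma wsummable_le:
  assumes "f summable_on UNIV" "\<And>j. w j * cmod (y j) \<le> f j"
  shows "wsummable y" "wsum y \<le> infsum f UNIV"
proof -
  show *: "wsummable y"
    unfolding wsummable_def
    by (rule summable_on_comparison_test[OF assms(1)]) (use assms(2) in auto)
  show "wsum y \<le> infsum f UNIV"
    unfolding wsum_def by (rule infsum_mono) (use * assms in \<open>auto simp: wsummable_def\<close>)
qed

text \<open>Cauchy-Schwarz on finite subsets; the passage from l2 data to the weighted l1
  space.\<close>

lemma wsum_l2:
  assumes "(\<lambda>j. (cmod (x j))\<^sup>2) summable_on UNIV"
  shows "wsummable x" "wsum x \<le> sqrt (\<Sum>\<^sub>\<infinity>j. (w j)\<^sup>2) * sqrt (\<Sum>\<^sub>\<infinity>j. (cmod (x j))\<^sup>2)"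
proof -
  define a where "a = sqrt (\<Sum>\<^sub>\<infinity>j. (w j)\<^sup>2)"
  define b where "b = sqrt (\<Sum>\<^sub>\<infinity>j. (cmod (x j))\<^sup>2)"
  have fin: "(\<Sum>j\<in>F. w j * cmod (x j)) \<le> a * b" if "finite F" for F
  proof -
    have "(\<Sum>j\<in>F. \<bar>w j * cmod (x j)\<bar>) \<le> L2_set w F * L2_set (\<lambda>j. cmod (x j)) F"
      using L2_set_mult_ineq[of w "\<lambda>j. cmod (x j)" F] by (simp add: abs_mult)
    also have "L2_set w F \<le> a"
      unfolding L2_set_def a_def
      by (intro real_sqrt_le_mono finite_sum_le_infsum[OF w_square_summable that]) auto
    also have "L2_set (\<lambda>j. cmod (x j)) F \<le> b"
      unfolding L2_set_def b_def
      by (intro real_sqrt_le_mono finite_sum_le_infsum[OF assms that]) auto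
    finally show ?thesis
      using w_pos by (simp add: abs_mult less_imp_le a_def b_def infsum_nonneg mult_left_mono
          mult_right_mono)
  qed
  show s: "wsummable x" unfolding wsummable_def
  proof (rule nonneg_bdd_above_summable_on)
    show "bdd_above (sum (\<lambda>j. w j * cmod (x j)) ` {F. F \<subseteq> UNIV \<and> finite F})"
      using fin by (intro bdd_aboveI[where M="a*b"]) auto
  qed auto
  show "wsum x \<le> sqrt (\<Sum>\<^sub>\<infinity>j. (w j)\<^sup>2) * sqrt (\<Sum>\<^sub>\<infinity>j. (cmod (x j))\<^sup>2)"
    unfolding wsum_def a_def[symmetric] b_def[symmetric]
    by (rule infsum_le_finite_sums) (use s fin in \<open>auto simp: wsummable_def\<close>)
qed

end

locale perturbed_resolvent = weighted_perturbation w P \<eta> for w :: "'j \<Rightarrow> real" and P \<eta> +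
  fixes D :: "'j \<Rightarrow> complex" and \<mu> :: complex and s :: real
  assumes s_pos: "s > 0"
    and gap: "s \<le> cmod (\<mu> - D j)"
begin

lemma gap_pos: "cmod (\<mu> - D j) > 0" "\<mu> - D j \<noteq> 0"
  using s_pos gap[of j] by auto

text \<open>A bound for the norm of \<open>P\<close> followed by division by
  \<open>\<mu> - D\<close> in the weighted l1 space. An entry \<open>D j\<close> close to
  \<open>\<mu>\<close> costs little as long as \<open>w j\<close> is small, which a bound through
  the minimal gap would not show.\<close>

definition loss :: real where
  "loss = \<eta> * (\<Sum>\<^sub>\<infinity>j. (w j)\<^sup>2 / cmod (\<mu> - D j))"

lemma loss_summable: "(\<lambda>j. (w j)\<^sup>2 / cmod (\<mu> - D j)) summable_on UNIV"
proof (rule summable_on_comparison_test[OF summable_on_cmult_left[OF w_square_summable, of "1/s"]])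
  fix j
  show "(w j)\<^sup>2 / cmod (\<mu> - D j) \<le> (w j)\<^sup>2 * (1 / s)"
    using gap[of j] s_pos gap_pos[of j] by (simp add: divide_left_mono)
qed auto

lemma loss_le: "loss \<le> \<eta> * (\<Sum>\<^sub>\<infinity>j. (w j)\<^sup>2) / s"
proof -
  have "(\<Sum>\<^sub>\<infinity>j. (w j)\<^sup>2 / cmod (\<mu> - D j)) \<le> (\<Sum>\<^sub>\<infinity>j. (w j)\<^sup>2 * (1 / s))"
  proof (rule infsum_mono[OF loss_summable summable_on_cmult_left[OF w_square_summable]])
    fix j
    show "(w j)\<^sup>2 / cmod (\<mu> - D j) \<le> (w j)\<^sup>2 * (1 / s)"
      using gap[of j] s_pos gap_pos[of j] by (simp add: divide_left_mono)
  qed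
  also have "\<dots> = (\<Sum>\<^sub>\<infinity>j. (w j)\<^sup>2) * (1/s)" by (rule infsum_cmult_left) (use w_square_summable in auto)
  finally show ?thesis unfolding loss_def
    using eta_nonneg mult_left_mono by fastforce
qed

lemma wsummable_divide:
  assumes "wsummable x"
  shows "wsummable (\<lambda>j. x j / (\<mu> - D j))" "wsum (\<lambda>j. x j / (\<mu> - D j)) \<le> wsum x / s"
proof -
  have *: "w j * cmod (x j / (\<mu> - D j)) \<le> w j * cmod (x j) * (1/s)" for j
    using gap[of j] s_pos gap_pos[of j] w_pos[of j]
    by (simp add: norm_divide divide_left_mono mult_left_mono)
  have sm: "(\<lambda>j. w j * cmod (x j) * (1/s)) summable_on UNIV"
    using assms unfolding wsummable_def by (rule summable_on_cmult_left)
  show "wsummable (\<lambda>j. x j / (\<mu> - D j))" by (rule wsummable_le(1)[OF sm *])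
  have "infsum (\<lambda>j. w j * cmod (x j) * (1/s)) UNIV = wsum x * (1/s)"
    unfolding wsum_def by (rule infsum_cmult_left) (use assms in \<open>auto simp: wsummable_def\<close>)
  then show "wsum (\<lambda>j. x j / (\<mu> - D j)) \<le> wsum x / s"
    using wsummable_le(2)[OF sm *] by simp
qed

lemma weighted_divide:
  assumes "\<And>j. cmod (z j) \<le> C * w j" "C \<ge> 0"
  shows "wsummable (\<lambda>j. z j / (\<mu> - D j))"
    "\<eta> * wsum (\<lambda>j. z j / (\<mu> - D j)) \<le> C * loss"
proof -
  have *: "w j * cmod (z j / (\<mu> - D j)) \<le> C * ((w j)\<^sup>2 / cmod (\<mu> - D j))" for j
  proof -
    have "w j * cmod (z j / (\<mu> - D j)) \<le> w j * ((C * w j) / cmod (\<mu> - D j))"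
      using w_pos[of j] assms(1)[of j] gap_pos[of j] by (simp add: norm_divide divide_right_mono)
    then show ?thesis by (simp add: power2_eq_square algebra_simps)
  qed
  have sm: "(\<lambda>j. C * ((w j)\<^sup>2 / cmod (\<mu> - D j))) summable_on UNIV"
    using loss_summable by (rule summable_on_cmult_right)
  show "wsummable (\<lambda>j. z j / (\<mu> - D j))" by (rule wsummable_le(1)[OF sm *])
  have "wsum (\<lambda>j. z j / (\<mu> - D j)) \<le> C * (\<Sum>\<^sub>\<infinity>j. (w j)\<^sup>2 / cmod (\<mu> - D j))"
    using wsummable_le(2)[OF sm *] infsum_cmult_right[of C "\<lambda>j. (w j)\<^sup>2 / cmod (\<mu> - D j)" UNIV]
      loss_summable by simp
  then have "\<eta> * wsum (\<lambda>j. z j / (\<mu> - D j)) \<le> \<eta> * (C * (\<Sum>\<^sub>\<infinity>j. (w j)\<^sup>2 / cmod (\<mu> - D j)))"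
    using eta_nonneg by (rule mult_left_mono)
  then show "\<eta> * wsum (\<lambda>j. z j / (\<mu> - D j)) \<le> C * loss"
    unfolding loss_def by (simp add: algebra_simps)
qed

text \<open>Division of the equation by \<open>\<mu> - D j\<close> and weighted summation. Once
  \<open>loss\<close> is below 1 the last term is absorbed on the left; this gives the a priori
  bound, uniqueness and the estimate at a pole.\<close>

lemma resolvent_wsum_le:
  assumes eq: "\<And>j. (\<mu> - D j) * y j = x j + P y j" and "wsummable y" "wsummable x"
  shows "wsum y \<le> wsum (\<lambda>j. x j / (\<mu> - D j)) + loss * wsum y"
proof -
  have y: "y j = x j / (\<mu> - D j) + P y j / (\<mu> - D j)" for j
    using eq[of j] gap_pos[of j] by (metis add_divide_distrib nonzero_mult_div_cancel_left)
  have *: "w j * cmod (y j) \<le> w j * cmod (x j / (\<mu> - D j)) + wsum y * (\<eta> * ((w j)\<^sup>2 / cmod (\<mu> - D j)))" for j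
  proof -
    have "cmod (y j) \<le> cmod (x j / (\<mu> - D j)) + cmod (P y j / (\<mu> - D j))"
      by (subst y) (rule norm_triangle_ineq)
    also have "cmod (P y j / (\<mu> - D j)) \<le> (\<eta> * w j * wsum y) / cmod (\<mu> - D j)"
      using P_wbound[OF assms(2), of j] gap_pos[of j] by (simp add: norm_divide divide_right_mono)
    finally have "w j * cmod (y j) \<le> w j * (cmod (x j / (\<mu> - D j)) + (\<eta> * w j * wsum y) / cmod (\<mu> - D j))"
      using w_pos[of j] by simp
    then show ?thesis by (simp add: power2_eq_square algebra_simps)
  qed
  have s1: "(\<lambda>j. w j * cmod (x j / (\<mu> - D j))) summable_on UNIV"
    using wsummable_divide(1)[OF assms(3)] by (simp add: wsummable_def)
  have s2: "(\<lambda>j. wsum y * (\<eta> * ((w j)\<^sup>2 / cmod (\<mu> - D j)))) summable_on UNIV"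
    by (intro summable_on_cmult_right loss_summable)
  have "wsum y \<le> (\<Sum>\<^sub>\<infinity>j. w j * cmod (x j / (\<mu> - D j)) + wsum y * (\<eta> * ((w j)\<^sup>2 / cmod (\<mu> - D j))))"
    by (rule wsummable_le(2)[OF summable_on_add[OF s1 s2] *])
  also have "\<dots> = wsum (\<lambda>j. x j / (\<mu> - D j)) + (\<Sum>\<^sub>\<infinity>j. wsum y * (\<eta> * ((w j)\<^sup>2 / cmod (\<mu> - D j))))"
    unfolding wsum_def[of "\<lambda>j. x j / (\<mu> - D j)"] by (rule infsum_add[OF s1 s2])
  also have "(\<Sum>\<^sub>\<infinity>j. wsum y * (\<eta> * ((w j)\<^sup>2 / cmod (\<mu> - D j)))) = wsum y * loss"
    using infsum_cmult_right[OF summable_on_cmult_right[OF loss_summable], of "wsum y" \<eta>]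
      infsum_cmult_right[OF loss_summable, of \<eta>] by (simp only: loss_def)
  finally show ?thesis by (simp add: algebra_simps)
qed

lemma resolvent_bound:
  assumes eq: "\<And>j. (\<mu> - D j) * y j = x j + P y j" and "wsummable y" "wsummable x"
    and "loss \<le> 1/2"
  shows "wsum y \<le> 2 * wsum x / s"
proof -
  have "wsum y \<le> wsum x / s + 1/2 * wsum y"
    using resolvent_wsum_le[OF assms(1-3)] wsummable_divide(2)[OF assms(3)]
      mult_right_mono[OF assms(4) wsum_nonneg[of y]] by linarith
  then show ?thesis by simp
qed

lemma resolvent_unique:
  assumes eq: "\<And>j. (\<mu> - D j) * y j = x j + P y j" "\<And>j. (\<mu> - D j) * y' j = x j + P y' j"
    and y: "wsummable y" "wsummable y'" and l: "loss \<le> 1/2"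
  shows "y = y'"
proof -
  define z where "z = (\<lambda>j. y j - y' j)"
  have z: "wsummable z" unfolding z_def by (rule wsummable_diff[OF y])
  have Pz: "P z = (\<lambda>j. P y j - P y' j)"
    unfolding z_def by (rule P_diff) (use y in \<open>auto simp: wsummable_def\<close>)
  have "(\<mu> - D j) * z j = 0 + P z j" for j
    using eq[of j] unfolding Pz by (simp add: z_def right_diff_distrib)
  then have "wsum z \<le> 2 * wsum (\<lambda>_. 0) / s"
    by (rule resolvent_bound[where x="\<lambda>_. 0"]) (use z l in \<open>auto simp: wsummable_def\<close>)
  then have "wsum z = 0" using wsum_nonneg[of z] by (simp add: wsum_def)
  then have "w j * cmod (z j) = 0" for j
    using z unfolding wsum_def wsummable_def
    by (intro nonneg_infsum_le_0D[where A=UNIV and f="\<lambda>j. w j * cmod (z j)"]) auto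
  then show ?thesis
    using w_pos unfolding z_def by (metis eq_iff_diff_eq_0 ext mult_eq_0_iff less_irrefl norm_eq_zero)
qed

text \<open>The iteration runs on the unknown \<open>z = P y\<close> instead of \<open>y\<close>:
  every iterate is dominated by a multiple of \<open>w\<close>, one step halves that multiple for
  differences, and convergence is just entrywise convergence of complex numbers.\<close>

lemma resolvent_exists:
  assumes x: "wsummable x" and l: "loss \<le> 1/2"
  obtains y where "\<And>j. (\<mu> - D j) * y j = x j + P y j" "wsummable y"
proof -
  define Q where "Q z = P (\<lambda>j. x j / (\<mu> - D j) + z j / (\<mu> - D j))" for z :: "'j \<Rightarrow> complex"
  have wd: "wsummable (\<lambda>j. x j / (\<mu> - D j) + z j / (\<mu> - D j))"
    if "\<And>j. cmod (z j) \<le> C * w j" "C \<ge> 0" for z C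
  proof -
    have "wsummable (\<lambda>j. x j / (\<mu> - D j) - (- z j) / (\<mu> - D j))"
      using wsummable_diff[OF wsummable_divide(1)[OF x] weighted_divide(1)[of "\<lambda>j. - z j" C]] that
      by simp
    then show ?thesis by simp
  qed
  have contr: "cmod (Q z j - Q z' j) \<le> C/2 * w j"
    if z: "\<And>j. cmod (z j) \<le> B * w j" "\<And>j. cmod (z' j) \<le> B' * w j" "B \<ge> 0" "B' \<ge> 0"
      and d: "\<And>j. cmod (z j - z' j) \<le> C * w j" "C \<ge> 0" for z z' B B' C j
  proof -
    have "Q z j - Q z' j = P (\<lambda>j. (x j / (\<mu> - D j) + z j / (\<mu> - D j)) - (x j / (\<mu> - D j) + z' j / (\<mu> - D j))) j"
      unfolding Q_def
      by (subst P_diff) (use wd[OF z(1,3)] wd[OF z(2,4)] in \<open>auto simp: wsummable_def\<close>)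
    also have "(\<lambda>j. (x j / (\<mu> - D j) + z j / (\<mu> - D j)) - (x j / (\<mu> - D j) + z' j / (\<mu> - D j)))
        = (\<lambda>j. (z j - z' j) / (\<mu> - D j))"
      by (auto simp: diff_divide_distrib)
    also have "cmod (P \<dots> j) \<le> w j * (\<eta> * wsum (\<lambda>j. (z j - z' j) / (\<mu> - D j)))"
      using P_wbound[OF weighted_divide(1)[OF d], of j] by (simp add: algebra_simps)
    also have "\<dots> \<le> w j * (C * loss)"
      using weighted_divide(2)[OF d] w_pos[of j] by simp
    also have "\<dots> \<le> w j * (C * (1/2))"
      using w_pos[of j] l d(2) by (intro mult_left_mono) auto
    finally show ?thesis by (simp add: algebra_simps)
  qed
  define Z where "Z n = (Q ^^ n) (\<lambda>_. 0)" for n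
  define A where "A = \<eta> * wsum (\<lambda>j. x j / (\<mu> - D j))"
  have A: "A \<ge> 0" unfolding A_def using eta_nonneg wsum_nonneg by simp
  have Z0: "Z 0 = (\<lambda>_. 0)" by (simp add: Z_def)
  have ZS: "Z (Suc n) = Q (Z n)" for n by (simp add: Z_def)
  \<comment> \<open>The third clause carries the induction: summed geometrically it gives the
    uniform bound of the first clause at the next index, and \<open>contr\<close> needs such a bound
    for both of its arguments.\<close>
  have step: "(\<forall>j. cmod (Z n j) \<le> 2 * A * w j) \<and> (\<forall>j. cmod (Z (Suc n) j - Z n j) \<le> A * (1/2)^n * w j)
      \<and> (\<forall>j. cmod (Z n j) \<le> A * (\<Sum>i<n. (1/2)^i) * w j)" for n
  proof (induction n)
    case 0
    have "cmod (Q (\<lambda>_. 0) j) \<le> A * w j" for j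
      using P_wbound[OF wsummable_divide(1)[OF x], of j] unfolding Q_def A_def by (simp add: algebra_simps)
    then show ?case using A w_pos by (auto simp: Z0 ZS)
  next
    case (Suc n)
    have 1: "cmod (Z (Suc n) j) \<le> A * (\<Sum>i<Suc n. (1/2)^i) * w j" for j
    proof -
      have "cmod (Z (Suc n) j) \<le> cmod (Z n j) + cmod (Z (Suc n) j - Z n j)"
        using norm_triangle_ineq[of "Z n j" "Z (Suc n) j - Z n j"] by simp
      also have "\<dots> \<le> A * (\<Sum>i<n. (1/2)^i) * w j + A * (1/2)^n * w j"
        using Suc by (intro add_mono) blast+
      finally show ?thesis by (simp add: algebra_simps)
    qed
    have geo: "(\<Sum>i<m. (1/2::real)^i) \<le> 2" for m
      by (simp add: sum_gp_strict)
    have 2: "cmod (Z (Suc n) j) \<le> 2 * A * w j" for j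
    proof -
      have "A * (\<Sum>i<Suc n. (1/2)^i) * w j \<le> A * 2 * w j"
        using geo[of "Suc n"] A w_pos[of j] by (intro mult_right_mono mult_left_mono) auto
      then show ?thesis using 1[of j] by (simp add: mult.commute)
    qed
    have 3: "cmod (Z (Suc (Suc n)) j - Z (Suc n) j) \<le> A * (1/2)^Suc n * w j" for j
      using contr[of "Z (Suc n)" "2*A" "Z n" "2*A" "A * (1/2)^n" j] Suc 2 A
      by (simp add: ZS)
    show ?case using 1 2 3 by blast
  qed
  have Zb: "cmod (Z n j) \<le> 2 * A * w j" for n j using step[of n] by blast
  have Zd: "cmod (Z (Suc n) j - Z n j) \<le> A * (1/2)^n * w j" for n j using step[of n] by blast
  have sm: "summable (\<lambda>n. Z (Suc n) j - Z n j)" for j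
    by (rule summable_comparison_test'[where g="\<lambda>n. A * w j * (1/2)^n" and N=0])
       (use Zd[of _ j] in \<open>auto intro!: summable_mult simp: algebra_simps\<close>)
  have conv: "convergent (\<lambda>n. Z n j)" for j
    using sm[of j] sum_lessThan_telescope[of "\<lambda>n. Z n j"] by (simp add: summable_iff_convergent Z0)
  define z where "z j = lim (\<lambda>n. Z n j)" for j
  have lim: "(\<lambda>n. Z n j) \<longlonglongrightarrow> z j" for j
    using conv[of j] unfolding z_def by (simp add: convergent_LIMSEQ_iff)
  have zb: "cmod (z j) \<le> 2 * A * w j" for j
    by (rule Lim_bounded[OF tendsto_norm[OF lim[of j]], of 0]) (use Zb in auto)
  have near: "cmod (Z m j - Z n j) \<le> 2 * A * (1/2)^n * w j" if "m \<ge> n" for m n j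
  proof -
    have "cmod (Z m j - Z n j) \<le> A * w j * (2 * (1/2)^n - 2 * (1/2)^m)"
      using that
    proof (induction m rule: dec_induct)
      case (step m)
      have "cmod (Z (Suc m) j - Z n j) \<le> cmod (Z (Suc m) j - Z m j) + cmod (Z m j - Z n j)"
        using norm_triangle_ineq[of "Z (Suc m) j - Z m j" "Z m j - Z n j"] by simp
      then show ?case using step Zd[of m j] by (simp add: algebra_simps)
    qed auto
    also have "\<dots> \<le> A * w j * (2 * (1/2)^n)"
      using A w_pos[of j] by (intro mult_left_mono) auto
    finally show ?thesis by (simp add: algebra_simps)
  qed
  have nearz: "cmod (z j - Z n j) \<le> 2 * A * (1/2)^n * w j" for n j
    by (rule Lim_bounded[OF tendsto_norm[OF tendsto_diff[OF lim[of j] tendsto_const]], of n])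
       (use near in auto)
  have fixpt: "Q z j = z j" for j
  proof -
    have "(\<lambda>n. Q z j - Z (Suc n) j) \<longlonglongrightarrow> 0"
    proof (rule Lim_null_comparison)
      show "\<forall>\<^sub>F n in sequentially. cmod (Q z j - Z (Suc n) j) \<le> (A * w j) * (1/2)^n"
      proof (rule always_eventually, rule allI)
        fix n
        show "cmod (Q z j - Z (Suc n) j) \<le> (A * w j) * (1/2)^n"
          using contr[of z "2*A" "Z n" "2*A" "2 * A * (1/2)^n" j] zb Zb A nearz[of _ n]
          by (simp add: ZS algebra_simps)
      qed
      show "(\<lambda>n. A * w j * (1 / 2) ^ n) \<longlonglongrightarrow> 0"
        by (intro tendsto_mult_right_zero LIMSEQ_power_zero) auto
    qed
    moreover have "(\<lambda>n. Q z j - Z (Suc n) j) \<longlonglongrightarrow> Q z j - z j"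
      by (intro tendsto_intros LIMSEQ_Suc lim)
    ultimately show ?thesis using LIMSEQ_unique by fastforce
  qed
  show ?thesis
  proof
    show "wsummable (\<lambda>j. x j / (\<mu> - D j) + z j / (\<mu> - D j))"
      by (rule wd[OF zb]) (use A in auto)
    show "(\<mu> - D j) * (x j / (\<mu> - D j) + z j / (\<mu> - D j)) =
        x j + P (\<lambda>j. x j / (\<mu> - D j) + z j / (\<mu> - D j)) j" for j
      using fixpt[of j] gap_pos[of j] unfolding Q_def by (simp add: distrib_left)
  qed
qed

text \<open>The error is \<open>P y k\<close>, at most \<open>\<eta> * w k * wsum y\<close>, and
  \<open>wsum y\<close> is at most \<open>2 * w k / d\<close>. The product is twice a single summand
  of \<open>loss\<close>, so it is small however close \<open>\<mu>\<close> is to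
  \<open>D k\<close>.\<close>

lemma resolvent_pole:
  assumes eq: "\<And>j. (\<mu> - D j) * y j = (if j = k then 1 else 0) + P y j" and "wsummable y"
    and "loss \<le> 1/4"
  shows "cmod ((\<mu> - D k) * y k - 1) \<le> 1/2"
proof -
  define d where "d = cmod (\<mu> - D k)"
  have d: "d > 0" unfolding d_def by (rule gap_pos)
  have hs: "((\<lambda>j. if j = k then c else 0) has_sum c) UNIV" for c :: real
    using has_sum_finite_neutralI[of "{k}" UNIV "\<lambda>j. if j = k then c else 0" c] by simp
  have e: "wsum (\<lambda>j. (if j = k then 1 else 0) / (\<mu> - D j)) = w k / d"
    unfolding wsum_def using infsumI[OF hs[of "w k / d"]]
    by (subst infsum_cong[where g="\<lambda>j. if j = k then w k / d else 0"]) (auto simp: norm_divide d_def)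
  have ws: "wsummable (\<lambda>j. if j = k then 1 else 0)"
    unfolding wsummable_def using has_sum_imp_summable[OF hs[of "w k"]]
    by (rule summable_on_cong[THEN iffD1, rotated]) auto
  have "wsum y \<le> w k / d + 1/4 * wsum y"
    using resolvent_wsum_le[OF eq assms(2) ws] e mult_right_mono[OF assms(3) wsum_nonneg[of y]]
    by linarith
  then have q: "wsum y \<le> 2 * (w k / d)" 
    using d w_pos[of k] by (simp add: field_simps)
  have one: "\<eta> * ((w k)\<^sup>2 / d) \<le> loss"
    unfolding loss_def d_def
    using finite_sum_le_infsum[OF loss_summable, of "{k}"] gap_pos eta_nonneg
    by (intro mult_left_mono) auto
  have "cmod ((\<mu> - D k) * y k - 1) = cmod (P y k)" using eq[of k] by simp
  also have "\<dots> \<le> \<eta> * w k * wsum y" by (rule P_wbound[OF assms(2)])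
  also have "\<dots> \<le> \<eta> * w k * (2 * (w k / d))"
    using q eta_nonneg w_pos[of k] by (intro mult_left_mono) auto
  also have "\<dots> = 2 * (\<eta> * ((w k)\<^sup>2 / d))" by (simp add: power2_eq_square)
  finally show ?thesis using one assms(3) by simp
qed

end

section \<open>Double expansion of the regular part of the kernel\<close>

lemma has_sum_norm_le:
  fixes f :: "'i \<Rightarrow> 'b::real_normed_vector"
  assumes "(f has_sum S) A" "(g has_sum T) A" "\<And>i. i \<in> A \<Longrightarrow> norm (f i) \<le> g i"
  shows "norm S \<le> T"
proof (rule tendsto_le[OF _ assms(2)[unfolded has_sum_def] tendsto_norm[OF assms(1)[unfolded has_sum_def]]])
  show "\<forall>\<^sub>F F in finite_subsets_at_top A. norm (sum f F) \<le> sum g F"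
    using assms(3) by (intro eventually_finite_subsets_at_top_weakI sum_norm_le) auto
qed auto

text \<open>Two nested power series become one unordered double sum: the geometric domination makes
  the family absolutely summable, so the iterated value is the value of the double sum.\<close>

lemma double_geometric_has_sum:
  fixes c :: "nat \<Rightarrow> nat \<Rightarrow> complex" and s t :: complex
  assumes c: "\<And>m n. cmod (c m n) \<le> B * p ^ m * q ^ n"
    and pq: "p \<ge> 0" "q \<ge> 0" "p * cmod s < 1" "q * cmod t < 1"
    and A: "\<And>m. (\<lambda>n. c m n * t ^ n) sums A m" and S: "(\<lambda>m. A m * s ^ m) sums S"
  shows "((\<lambda>(m, n). c m n * s ^ m * t ^ n) has_sum S) UNIV"
proof -
  have B: "B \<ge> 0" using order_trans[OF norm_ge_zero c[of 0 0]] by simp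
  define x y where "x = p * cmod s" and "y = q * cmod t"
  have xy: "0 \<le> x" "x < 1" "0 \<le> y" "y < 1" unfolding x_def y_def using pq by auto
  have bnd: "cmod (c m n * s ^ m * t ^ n) \<le> B * x ^ m * y ^ n" for m n
  proof -
    have "cmod (c m n * s ^ m * t ^ n) = cmod (c m n) * (cmod s ^ m * cmod t ^ n)"
      by (simp add: norm_mult norm_power)
    also have "\<dots> \<le> B * p ^ m * q ^ n * (cmod s ^ m * cmod t ^ n)"
      by (rule mult_right_mono[OF c]) simp
    finally show ?thesis by (simp add: x_def y_def power_mult_distrib algebra_simps)
  qed
  have gs: "((\<lambda>n. C * z ^ n) has_sum (C * (1 / (1 - z)))) UNIV" if "0 \<le> z" "z < 1" for C z :: real
    using that
    by (intro has_sum_cmult_right norm_summable_imp_has_sum geometric_sums) (auto simp: norm_power)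
  note geo = gs[OF xy(3,4)] gs[OF xy(1,2)]
  have "(\<lambda>(m, n). B * x ^ m * y ^ n) summable_on UNIV \<times> UNIV"
  proof (rule summable_on_SigmaI)
    show "((\<lambda>n. case (m, n) of (m, n) \<Rightarrow> B * x ^ m * y ^ n) has_sum (B * x ^ m * (1 / (1 - y)))) UNIV" for m
      using geo(1)[of "B * x ^ m"] by simp
    show "(\<lambda>m. B * x ^ m * (1 / (1 - y))) summable_on UNIV"
      using geo(2)[of "B * (1 / (1 - y))"] by (auto simp: summable_on_def algebra_simps)
  qed (use B xy in auto)
  then have sm: "(\<lambda>(m, n). c m n * s ^ m * t ^ n) summable_on UNIV \<times> UNIV"
    by (rule abs_summable_summable[OF summable_on_comparison_test]) (use bnd in auto)
  have inner: "((\<lambda>n. c m n * s ^ m * t ^ n) has_sum (A m * s ^ m)) UNIV" for m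
  proof (rule norm_summable_imp_has_sum)
    show "summable (\<lambda>n. cmod (c m n * s ^ m * t ^ n))"
      by (rule summable_comparison_test'[where g="\<lambda>n. B * x ^ m * y ^ n" and N=0])
         (use bnd xy in \<open>auto intro!: summable_mult summable_geometric\<close>)
    show "(\<lambda>n. c m n * s ^ m * t ^ n) sums (A m * s ^ m)"
      using sums_mult[OF A[of m], of "s ^ m"] by (simp add: algebra_simps)
  qed
  have Abnd: "cmod (A m * s ^ m) \<le> B * (1 / (1 - y)) * x ^ m" for m
  proof -
    have "cmod (A m * s ^ m) \<le> B * x ^ m * (1 / (1 - y))"
      by (rule has_sum_norm_le[OF inner[of m] geo(1)[of "B * x ^ m"]]) (rule bnd)
    then show ?thesis by (simp add: algebra_simps)
  qed
  have "((\<lambda>m. A m * s ^ m) has_sum S) UNIV"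
  proof (rule norm_summable_imp_has_sum[OF _ S])
    show "summable (\<lambda>m. cmod (A m * s ^ m))"
      by (rule summable_comparison_test'[where g="\<lambda>m. B * (1 / (1 - y)) * x ^ m" and N=0])
         (use Abnd xy in \<open>auto intro!: summable_mult summable_geometric\<close>)
  qed
  then have "((\<lambda>(m, n). c m n * s ^ m * t ^ n) has_sum S) (UNIV \<times> UNIV)"
    using inner by (intro has_sum_SigmaI[OF _ _ sm]) auto
  then show ?thesis by simp
qed

section \<open>The exterior map in the variable 1 / w\<close>

locale exterior_map =
  fixes \<Psi> :: "complex \<Rightarrow> complex" and \<alpha> :: "nat \<Rightarrow> complex" and \<gamma> :: real
  assumes gamma_pos: "\<gamma> > 0"
    and holo: "\<Psi> holomorphic_on {w. \<gamma> < norm w}"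
    and inj: "inj_on \<Psi> {w. \<gamma> < norm w}"
    and expansion: "\<And>w. \<gamma> < norm w \<Longrightarrow> (\<lambda>n. \<alpha> n / w ^ n) sums (\<Psi> w - w)"
begin

text \<open>The bounded part \<open>\<Psi> w - w\<close> in the variable \<open>s = 1 / w\<close>;
  infinity becomes the interior point 0 of a disc, where \<open>h\<close> is an ordinary power
  series.\<close>

definition h :: "complex \<Rightarrow> complex" where "h s = (\<Sum>n. \<alpha> n * s ^ n)"

lemma open_exterior: "open {w::complex. \<gamma> < norm w}"
  by (intro open_Collect_less continuous_intros)

lemma inverse_exterior: "s \<noteq> 0 \<Longrightarrow> s \<in> ball 0 (1 / \<gamma>) \<Longrightarrow> \<gamma> < cmod (1 / s)"
  using gamma_pos by (simp add: norm_divide field_simps)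

lemma h_eq:
  assumes "s \<noteq> 0" "s \<in> ball 0 (1 / \<gamma>)"
  shows "h s = \<Psi> (1 / s) - 1 / s" "(\<lambda>n. \<alpha> n * s ^ n) sums h s"
proof -
  have "(\<lambda>n. \<alpha> n * s ^ n) sums (\<Psi> (1 / s) - 1 / s)"
    using expansion[OF inverse_exterior[OF assms]] by (simp add: power_one_over)
  then show "h s = \<Psi> (1 / s) - 1 / s" "(\<lambda>n. \<alpha> n * s ^ n) sums h s"
    unfolding h_def by (auto simp: sums_iff)
qed

lemma h_holo: "h holomorphic_on ball 0 (1 / \<gamma>)"
proof (rule power_series_holomorphic)
  fix s :: complex assume s: "s \<in> ball 0 (1 / \<gamma>)"
  show "(\<lambda>n. \<alpha> n * (s - 0) ^ n) sums h s"
  proof (cases "s = 0")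
    case True
    then show ?thesis unfolding h_def using powser_sums_zero[of \<alpha>] by (simp add: sums_iff)
  qed (use h_eq(2) s in auto)
qed

lemma h_deriv: "s \<in> ball 0 (1 / \<gamma>) \<Longrightarrow> (h has_field_derivative deriv h s) (at s)"
  using h_holo holomorphic_derivI by blast

lemma Psi_deriv: "\<gamma> < norm w \<Longrightarrow> (\<Psi> has_field_derivative deriv \<Psi> w) (at w)"
  using holo holomorphic_derivI open_exterior by blast

lemma Psi_deriv_nz: "\<gamma> < norm w \<Longrightarrow> deriv \<Psi> w \<noteq> 0"
  using holomorphic_injective_imp_regular[OF holo open_exterior inj] by auto

lemma deriv_Psi_eq:
  assumes "s \<noteq> 0" "s \<in> ball 0 (1 / \<gamma>)"
  shows "deriv \<Psi> (1 / s) = 1 - s\<^sup>2 * deriv h s"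
proof -
  have ev: "\<forall>\<^sub>F u in nhds s. h u = \<Psi> (1 / u) - 1 / u"
    using assms by (intro eventually_nhds_in_open[of "ball 0 (1/\<gamma>) - {0}", THEN eventually_mono])
      (auto intro!: h_eq)
  have "((\<lambda>u. \<Psi> (1 / u) - 1 / u) has_field_derivative (deriv \<Psi> (1 / s) * (- 1 / s\<^sup>2) - (- 1 / s\<^sup>2))) (at s)"
    using assms(1)
    by (auto intro!: derivative_eq_intros DERIV_chain2[where f=\<Psi> and g="\<lambda>u. 1 / u", OF Psi_deriv[OF inverse_exterior[OF assms]]]
        simp: power2_eq_square)
  then have "(h has_field_derivative (deriv \<Psi> (1 / s) * (- 1 / s\<^sup>2) - (- 1 / s\<^sup>2))) (at s)"
    using DERIV_cong_ev[OF refl ev refl] by simp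
  then have "deriv h s = deriv \<Psi> (1 / s) * (- 1 / s\<^sup>2) - (- 1 / s\<^sup>2)"
    by (rule DERIV_imp_deriv)
  then show ?thesis using assms(1) by (simp add: field_simps)
qed

text \<open>The difference \<open>\<Psi> (1 / s) - \<Psi> (1 / t)\<close> multiplied by
  \<open>s * t\<close>, which removes the poles at 0 and makes sense when one of the points is
  infinity.\<close>

definition E :: "complex \<Rightarrow> complex \<Rightarrow> complex" where
  "E s t = t - s + s * t * (h s - h t)"

lemma E_eq:
  assumes "s \<noteq> 0" "t \<noteq> 0" "s \<in> ball 0 (1 / \<gamma>)" "t \<in> ball 0 (1 / \<gamma>)"
  shows "E s t = s * t * (\<Psi> (1 / s) - \<Psi> (1 / t))"
proof -
  have "t - s + s * t * ((p - 1 / s) - (q - 1 / t)) = s * t * (p - q)" for p q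
    using assms(1,2) by (simp add: field_simps)
  then show ?thesis
    unfolding E_def h_eq(1)[OF assms(1,3)] h_eq(1)[OF assms(2,4)] by blast
qed

lemma E_nz:
  assumes "s \<noteq> t" "s \<in> ball 0 (1 / \<gamma>)" "t \<in> ball 0 (1 / \<gamma>)"
  shows "E s t \<noteq> 0"
proof (cases "s = 0 \<or> t = 0")
  case True
  then show ?thesis using assms by (auto simp: E_def)
next
  case False
  then have "\<Psi> (1 / s) \<noteq> \<Psi> (1 / t)"
    using assms inverse_exterior inj by (auto dest!: inj_onD)
  then show ?thesis using False assms by (simp add: E_eq)
qed

text \<open>
  In the variables \<open>s = 1 / w\<close> and \<open>t = 1 / \<zeta>\<close>, \<open>kap s t\<close> is the regular part of the kernel; it is
  explicit but meaningless for \<open>s = t\<close>. Its holomorphic extension across the diagonal is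
  \<open>K t s = - s F'(s) / F(s)\<close> with \<open>F = (\<Psi> w - \<Psi> \<zeta>) / (w - \<zeta>)\<close>.
\<close>

definition kap :: "complex \<Rightarrow> complex \<Rightarrow> complex" where
  "kap s t = t * (1 - s\<^sup>2 * deriv h s) / E s t - t / (t - s)"

lemma kap_eq:
  assumes "\<gamma> < norm w" "\<gamma> < norm \<zeta>" "w \<noteq> \<zeta>"
  shows "kap (1 / w) (1 / \<zeta>) = w * deriv \<Psi> w / (\<Psi> w - \<Psi> \<zeta>) - w / (w - \<zeta>)"
proof -
  have nz: "w \<noteq> 0" "\<zeta> \<noteq> 0" using assms gamma_pos by auto
  have in_ball: "1 / w \<in> ball 0 (1 / \<gamma>)" "1 / \<zeta> \<in> ball 0 (1 / \<gamma>)"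
    using assms gamma_pos nz by (auto simp: norm_divide intro!: divide_strict_left_mono)
  have d: "1 - (1 / w)\<^sup>2 * deriv h (1 / w) = deriv \<Psi> w"
    using deriv_Psi_eq[OF _ in_ball(1)] nz by simp
  have e: "E (1 / w) (1 / \<zeta>) = (1 / w) * (1 / \<zeta>) * (\<Psi> w - \<Psi> \<zeta>)"
    using E_eq[OF _ _ in_ball] nz by simp
  have "(1 / \<zeta>) / (1 / \<zeta> - 1 / w) = w / (w - \<zeta>)"
    using nz assms(3) by (simp add: field_simps)
  then show ?thesis unfolding kap_def d e using nz by simp
qed

definition F :: "complex \<Rightarrow> complex \<Rightarrow> complex" where
  "F t s = 1 - s * t * (if s = t then deriv h t else (h s - h t) / (s - t))"

lemma F_holo: "F t holomorphic_on ball 0 (1 / \<gamma>)"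
  unfolding F_def by (intro holomorphic_intros pole_lemma_open h_holo) auto

lemma F_eq: "s \<noteq> t \<Longrightarrow> F t s = E s t / (t - s)"
  unfolding F_def E_def by (simp add: field_simps)

text \<open>Off the diagonal this is injectivity of \<open>\<Psi>\<close>; on it
  \<open>F t t\<close> is \<open>deriv \<Psi> (1 / t)\<close>, which does not vanish because an
  injective holomorphic map has no critical points. At \<open>t = 0\<close> the value is 1.\<close>

lemma F_nz:
  assumes "s \<in> ball 0 (1 / \<gamma>)" "t \<in> ball 0 (1 / \<gamma>)"
  shows "F t s \<noteq> 0"
proof (cases "s = t")
  case True
  show ?thesis
  proof (cases "t = 0")
    case False
    have "F t s = deriv \<Psi> (1 / t)"
      using deriv_Psi_eq[OF False assms(2)] True by (simp add: F_def power2_eq_square)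
    then show ?thesis using Psi_deriv_nz[OF inverse_exterior[OF False assms(2)]] by simp
  qed (use True in \<open>auto simp: F_def\<close>)
qed (use E_nz assms in \<open>auto simp: F_eq\<close>)

definition K :: "complex \<Rightarrow> complex \<Rightarrow> complex" where
  "K t s = - s * deriv (F t) s / F t s"

lemma K_holo: "t \<in> ball 0 (1 / \<gamma>) \<Longrightarrow> K t holomorphic_on ball 0 (1 / \<gamma>)"
  unfolding K_def by (intro holomorphic_intros F_holo holomorphic_deriv) (use F_nz in auto)

text \<open>Logarithmic derivative of \<open>E u t / (t - u)\<close>: the numerator yields the
  kernel minus 1, and this 1 turns \<open>s / (t - s)\<close> from the denominator into
  \<open>t / (t - s)\<close>.\<close>

lemma K_eq:
  assumes "s \<noteq> t" "s \<in> ball 0 (1 / \<gamma>)" "t \<in> ball 0 (1 / \<gamma>)"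
  shows "K t s = kap s t"
proof -
  define X where "X = E s t"
  have X: "X \<noteq> 0" "t - s \<noteq> 0" using E_nz assms unfolding X_def by auto
  have ev: "\<forall>\<^sub>F u in nhds s. F t u = E u t / (t - u)"
    using assms by (intro eventually_nhds_in_open[of "- {t}", THEN eventually_mono])
      (auto intro!: F_eq)
  have "((\<lambda>u. E u t / (t - u)) has_field_derivative
     (((- 1 + (t * (h s - h t) + s * t * deriv h s)) * (t - s) - X * (- 1)) / (t - s)\<^sup>2)) (at s)"
    unfolding E_def X_def using X
    by (auto intro!: derivative_eq_intros h_deriv assms(2) simp: power2_eq_square E_def algebra_simps)
  then have "(F t has_field_derivative
     (((- 1 + (t * (h s - h t) + s * t * deriv h s)) * (t - s) + X) / (t - s)\<^sup>2)) (at s)"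
    using DERIV_cong_ev[OF refl ev refl] by simp
  then have d: "deriv (F t) s = ((- 1 + (t * (h s - h t) + s * t * deriv h s)) * (t - s) + X) / (t - s)\<^sup>2"
    by (rule DERIV_imp_deriv)
  have f: "F t s = X / (t - s)" using F_eq[OF assms(1)] by (simp add: X_def)
  have quot: "- s * ((N * q + X) / q\<^sup>2) / (X / q) = - s * N / X - s / q" if "q \<noteq> 0" for N q
    using that X by (simp add: field_simps power2_eq_square)
  have "K t s = - s * (- 1 + (t * (h s - h t) + s * t * deriv h s)) / X - s / (t - s)"
    unfolding K_def d f by (rule quot[OF X(2)])
  also have "\<dots> = ((s - s * t * (h s - h t)) - s\<^sup>2 * t * deriv h s) / X - s / (t - s)"
    by (simp add: algebra_simps power2_eq_square)
  also have "s - s * t * (h s - h t) = t - X" by (simp add: X_def E_def)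
  also have "(t - X - s\<^sup>2 * t * deriv h s) / X - s / (t - s) = t * (1 - s\<^sup>2 * deriv h s) / X - t / (t - s)"
    using X by (simp add: field_simps)
  finally show ?thesis unfolding kap_def X_def .
qed

definition coeff :: "nat \<Rightarrow> complex \<Rightarrow> complex" where
  "coeff m t = (deriv ^^ m) (K t) 0 / fact m"

lemma coeff_sums:
  assumes "s \<in> ball 0 (1 / \<gamma>)" "t \<in> ball 0 (1 / \<gamma>)"
  shows "(\<lambda>m. coeff m t * s ^ m) sums K t s"
  using holomorphic_power_series[OF K_holo[OF assms(2)] assms(1)] by (simp add: coeff_def)

lemma continuous_on_h: "continuous_on (ball 0 (1 / \<gamma>)) h"
  "continuous_on (ball 0 (1 / \<gamma>)) (deriv h)"
  by (intro holomorphic_on_imp_continuous_on h_holo holomorphic_deriv open_ball)+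

text \<open>
  On the circle of radius \<open>\<tau> > \<bar>t\<bar>\<close> the Cauchy integral for the coefficient stays off the diagonal, where
  \<open>kap\<close> can be differentiated in \<open>t\<close>.
\<close>

lemma coeff_holo:
  assumes \<tau>: "0 < \<tau>" "\<tau> < 1 / \<gamma>"
  shows "coeff m holomorphic_on ball 0 \<tau>"
proof -
  define g where "g = circlepath 0 \<tau>"
  have ng: "cmod (g x) = \<tau>" for x
    unfolding g_def circlepath using \<tau> by (simp add: norm_mult)
  have g_in: "g x \<in> ball 0 (1 / \<gamma>)" for x using ng \<tau> by simp
  have gnz: "g x \<noteq> 0" for x using ng[of x] \<tau> by auto
  have contg: "continuous_on S g" for S
    unfolding g_def circlepath by (intro continuous_intros)
  define v where "v x = vector_derivative g (at x) / g x ^ Suc m" for x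
  have contv: "continuous_on S v" for S
    unfolding v_def unfolding g_def vector_derivative_circlepath
    using gnz contg unfolding g_def by (intro continuous_intros) auto
  \<comment> \<open>\<open>E'\<close> and \<open>kap'\<close> are the partial derivatives in
    \<open>t\<close>, needed to differentiate under the integral sign.\<close>
  define E' where "E' s t = 1 + s * (h s - h t) - s * t * deriv h t" for s t
  define kap' where "kap' s t = (1 - s\<^sup>2 * deriv h s) * (E s t - t * E' s t) / (E s t)\<^sup>2 + s / (t - s)\<^sup>2" for s t
  have sub: "t \<in> ball 0 \<tau> \<Longrightarrow> t \<in> ball 0 (1 / \<gamma>)" for t :: complex using \<tau> by auto
  have ne: "t \<in> ball 0 \<tau> \<Longrightarrow> g x \<noteq> t" for t x using ng[of x] by auto
  have "(\<lambda>t. integral (cbox 0 1) (\<lambda>x. kap (g x) t * v x)) holomorphic_on ball 0 \<tau>"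
  proof (rule leibniz_rule_holomorphic[where fx="\<lambda>t x. kap' (g x) t * v x"])
    fix t :: complex and x :: real assume t: "t \<in> ball 0 \<tau>"
    have X: "E (g x) t \<noteq> 0" "t - g x \<noteq> 0" using E_nz[OF ne g_in sub] ne t by auto
    have dE: "((\<lambda>t. E (g x) t) has_field_derivative E' (g x) t) (at t)"
      unfolding E_def E'_def
      by (auto intro!: derivative_eq_intros h_deriv sub t simp: algebra_simps)
    have "((\<lambda>t. kap (g x) t) has_field_derivative kap' (g x) t) (at t)"
      unfolding kap_def kap'_def
      by (rule derivative_eq_intros dE refl X)+ (use X in \<open>simp add: field_simps power2_eq_square\<close>)
    then show "((\<lambda>t. kap (g x) t * v x) has_field_derivative kap' (g x) t * v x) (at t within ball 0 \<tau>)"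
      by (intro DERIV_cmult_right) (rule has_field_derivative_at_within)
  next
    fix t :: complex assume t: "t \<in> ball 0 \<tau>"
    have "continuous_on (cbox 0 1) (\<lambda>x. kap (g x) t * v x)"
      unfolding kap_def E_def
      by (intro continuous_intros contg contv continuous_on_compose2[OF continuous_on_h(1) contg]
            continuous_on_compose2[OF continuous_on_h(2) contg])
         (use g_in ne[OF t] E_nz[OF ne[OF t] g_in sub[OF t]] in \<open>auto simp: E_def\<close>)
    then show "(\<lambda>x. kap (g x) t * v x) integrable_on cbox 0 1"
      by (rule integrable_continuous)
  next
    have c1: "continuous_on (ball 0 \<tau> \<times> cbox 0 1) (\<lambda>z. h (fst z))" 
             "continuous_on (ball 0 \<tau> \<times> cbox 0 1) (\<lambda>z. deriv h (fst z))"
      by (rule continuous_on_compose2[OF continuous_on_h(1)] continuous_on_compose2[OF continuous_on_h(2)],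
          intro continuous_intros, use sub in auto)+
    have c0: "continuous_on (ball 0 \<tau> \<times> cbox 0 1) (\<lambda>z::complex \<times> real. g (snd z))"
      by (rule continuous_on_compose2[OF contg[of UNIV]]) (auto intro: continuous_intros)
    have cv: "continuous_on (ball 0 \<tau> \<times> cbox 0 1) (\<lambda>z::complex \<times> real. v (snd z))"
      by (rule continuous_on_compose2[OF contv[of UNIV]]) (auto intro: continuous_intros)
    have c2: "continuous_on (ball 0 \<tau> \<times> cbox 0 1) (\<lambda>z::complex \<times> real. h (g (snd z)))" 
             "continuous_on (ball 0 \<tau> \<times> cbox 0 1) (\<lambda>z::complex \<times> real. deriv h (g (snd z)))"
      using g_in by (blast intro: continuous_on_compose2[OF continuous_on_h(1) c0]
            continuous_on_compose2[OF continuous_on_h(2) c0])+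
    have cE: "continuous_on (ball 0 \<tau> \<times> cbox 0 1) (\<lambda>z. E (g (snd z)) (fst z))"
             "continuous_on (ball 0 \<tau> \<times> cbox 0 1) (\<lambda>z. E' (g (snd z)) (fst z))"
      unfolding E_def E'_def by (intro continuous_intros c0 c1 c2)+
    have "continuous_on (ball 0 \<tau> \<times> cbox 0 1) (\<lambda>z. kap' (g (snd z)) (fst z) * v (snd z))"
      unfolding kap'_def by (intro continuous_intros c0 c1 c2 cE cv)
        (use ne sub g_in E_nz in \<open>auto, fastforce+\<close>)
    then show "continuous_on (ball 0 \<tau> \<times> cbox 0 1) (\<lambda>(t, x). kap' (g x) t * v x)"
      by (simp add: case_prod_unfold)
  qed auto
  then have "(\<lambda>t. integral (cbox 0 1) (\<lambda>x. kap (g x) t * v x) / (2 * pi * \<i>)) holomorphic_on ball 0 \<tau>"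
    by (intro holomorphic_intros) auto
  then show ?thesis
  proof (rule holomorphic_transform)
    fix t :: complex assume t: "t \<in> ball 0 \<tau>"
    have "((\<lambda>u. K t u / (u - 0) ^ Suc m) has_contour_integral
        (2 * pi * \<i>) / fact m * (deriv ^^ m) (K t) 0) (circlepath 0 \<tau>)"
      using \<tau> K_holo[OF sub[OF t]]
      by (intro Cauchy_has_contour_integral_higher_derivative_circlepath holomorphic_on_imp_continuous_on)
         (auto elim!: holomorphic_on_subset)
    then have "(2 * pi * \<i>) * coeff m t = contour_integral g (\<lambda>u. K t u / u ^ Suc m)"
      using contour_integral_unique unfolding g_def coeff_def by fastforce
    also have "\<dots> = integral {0..1} (\<lambda>x. kap (g x) t * v x)"
      unfolding contour_integral_integral v_def
      using K_eq[OF ne[OF t] g_in sub[OF t]] by simp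
    finally show "integral (cbox 0 1) (\<lambda>x. kap (g x) t * v x) / (2 * pi * \<i>) = coeff m t"
      by (simp add: field_simps)
  qed
qed

text \<open>Cauchy estimates, first in \<open>s\<close> and then in \<open>t\<close>. Only
  \<open>r0\<close> enters the choice of \<open>b\<close>, so with \<open>r0\<close> the inner
  radius one family of coefficients serves all outer radii.\<close>

theorem kernel_double_series:
  assumes "\<gamma> < r0"
  obtains c :: "nat \<Rightarrow> nat \<Rightarrow> complex" and B b where "\<gamma> < b" "b < r0" "B \<ge> 0"
    "\<And>m n. cmod (c m n) \<le> B * b ^ m * b ^ n"
    "\<And>w \<zeta>. \<lbrakk>r0 \<le> norm w; r0 \<le> norm \<zeta>; w \<noteq> \<zeta>\<rbrakk> \<Longrightarrow>
       ((\<lambda>(m, n). c m n * (1 / w) ^ m * (1 / \<zeta>) ^ n) has_sum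
         (w * deriv \<Psi> w / (\<Psi> w - \<Psi> \<zeta>) - w / (w - \<zeta>))) UNIV"
proof -
  \<comment> \<open>Two different radii, so that the torus \<open>T\<close> is a compact set
    disjoint from the diagonal and the explicit \<open>kap\<close> is continuous, hence bounded, on
    it. The resulting rates \<open>b1\<close> and \<open>b\<close> are merged into the larger one at
    the end.\<close>
  obtain b1 where b1: "\<gamma> < b1" "b1 < r0" using dense assms by blast
  obtain b where b: "b1 < b" "b < r0" using dense b1(2) by blast
  define \<tau>1 \<tau>2 where "\<tau>1 = 1 / b1" and "\<tau>2 = 1 / b"
  have \<tau>: "0 < \<tau>2" "\<tau>2 < \<tau>1" "\<tau>1 < 1 / \<gamma>" "1 / r0 < \<tau>2"
    unfolding \<tau>1_def \<tau>2_def using b1 b gamma_pos by (auto simp: field_simps)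
  define T where "T = sphere (0::complex) \<tau>1 \<times> sphere (0::complex) \<tau>2"
  have T_in: "s \<in> ball 0 (1 / \<gamma>)" "t \<in> ball 0 (1 / \<gamma>)" "s \<noteq> t" if "(s, t) \<in> T" for s t
    using that \<tau> by (auto simp: T_def)
  have "compact T" unfolding T_def by (intro compact_Times compact_sphere)
  moreover have "continuous_on T (\<lambda>z. kap (fst z) (snd z))"
  proof -
    have "continuous_on T (\<lambda>z. h (fst z))" "continuous_on T (\<lambda>z. h (snd z))"
      "continuous_on T (\<lambda>z. deriv h (fst z))"
      by (rule continuous_on_compose2[OF continuous_on_h(1)] continuous_on_compose2[OF continuous_on_h(2)],
          intro continuous_intros, use T_in in force)+
    then show ?thesis
      unfolding kap_def E_def
      by (intro continuous_intros) (use T_in E_nz in \<open>auto simp: E_def, fastforce+\<close>)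
  qed
  ultimately have "bounded ((\<lambda>z. kap (fst z) (snd z)) ` T)"
    by (intro compact_imp_bounded compact_continuous_image)
  then obtain B where B: "\<And>z. z \<in> T \<Longrightarrow> cmod (kap (fst z) (snd z)) \<le> B"
    by (auto simp: bounded_iff)
  have B0: "B \<ge> 0"
    using B[of "(of_real \<tau>1, of_real \<tau>2)"] \<tau> by (auto simp: T_def intro: order_trans[OF norm_ge_zero])
  have A_bound: "cmod (coeff m t) \<le> B / \<tau>1 ^ m" if t: "t \<in> sphere 0 \<tau>2" for m t
  proof -
    have t': "t \<in> ball 0 (1 / \<gamma>)" using t \<tau> by auto
    have "cmod ((deriv ^^ m) (K t) 0) \<le> fact m * B / \<tau>1 ^ m"
    proof (rule Cauchy_inequality)
      show "K t holomorphic_on ball 0 \<tau>1" "continuous_on (cball 0 \<tau>1) (K t)"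
        using K_holo[OF t'] \<tau> 
        by (auto intro!: holomorphic_on_imp_continuous_on elim!: holomorphic_on_subset)
      show "cmod (K t x) \<le> B" if "cmod (0 - x) = \<tau>1" for x
      proof -
        have "(x, t) \<in> T" using that t by (auto simp: T_def)
        then show ?thesis using K_eq T_in B[of "(x, t)"] by auto
      qed
    qed (use \<tau> in auto)
    then show ?thesis by (simp add: coeff_def norm_divide field_simps)
  qed
  define c where "c m n = (deriv ^^ n) (coeff m) 0 / fact n" for m n
  have hol: "coeff m holomorphic_on ball 0 \<tau>1" for m
    using coeff_holo \<tau> by auto
  have c_bound: "cmod (c m n) \<le> B * b1 ^ m * b ^ n" for m n
  proof -
    have "cmod ((deriv ^^ n) (coeff m) 0) \<le> fact n * (B / \<tau>1 ^ m) / \<tau>2 ^ n"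
    proof (rule Cauchy_inequality)
      have "coeff m holomorphic_on cball 0 \<tau>2"
        by (rule holomorphic_on_subset[OF hol]) (use \<tau> in auto)
      then show "coeff m holomorphic_on ball 0 \<tau>2" "continuous_on (cball 0 \<tau>2) (coeff m)"
        using holomorphic_on_subset ball_subset_cball holomorphic_on_imp_continuous_on by blast+
    qed (use A_bound \<tau> in auto)
    then show ?thesis
      by (simp add: c_def norm_divide \<tau>1_def \<tau>2_def field_simps power_one_over)
  qed
  have pos: "b1 > 0" "b > 0" "r0 > 0" using b1 b gamma_pos by auto
  show ?thesis
  proof
    show "\<gamma> < b" "b < r0" "B \<ge> 0" using b1 b B0 by auto
    show "cmod (c m n) \<le> B * b ^ m * b ^ n" for m n
      using c_bound[of m n] B0 b pos
      by (intro order_trans[OF c_bound] mult_right_mono mult_left_mono power_mono) auto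
    fix w \<zeta> :: complex assume wz: "r0 \<le> norm w" "r0 \<le> norm \<zeta>" "w \<noteq> \<zeta>"
    have nz: "w \<noteq> 0" "\<zeta> \<noteq> 0" using wz pos by auto
    have n: "cmod (1 / w) \<le> 1 / r0" "cmod (1 / \<zeta>) \<le> 1 / r0"
      using wz pos nz by (auto simp: norm_divide intro!: divide_left_mono)
    have i: "1 / w \<in> ball 0 (1 / \<gamma>)" "1 / \<zeta> \<in> ball 0 \<tau>1" "1 / \<zeta> \<in> ball 0 (1 / \<gamma>)"
      using n \<tau> by auto
    have "((\<lambda>(m, n). c m n * (1 / w) ^ m * (1 / \<zeta>) ^ n) has_sum K (1 / \<zeta>) (1 / w)) UNIV"
    proof (rule double_geometric_has_sum[OF c_bound])
      have "b1 * cmod (1 / w) \<le> b1 * (1 / r0)" "b * cmod (1 / \<zeta>) \<le> b * (1 / r0)"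
        using n pos by (intro mult_left_mono; simp)+
      moreover have "b1 * (1 / r0) < 1" "b * (1 / r0) < 1" using b b1 pos by (simp_all add: field_simps)
      ultimately show "b1 * cmod (1 / w) < 1" "b * cmod (1 / \<zeta>) < 1" by linarith+
      show "(\<lambda>n. c m n * (1 / \<zeta>) ^ n) sums coeff m (1 / \<zeta>)" for m
        using holomorphic_power_series[OF hol i(2)] by (simp add: c_def)
      show "(\<lambda>m. coeff m (1 / \<zeta>) * (1 / w) ^ m) sums K (1 / \<zeta>) (1 / w)"
        by (rule coeff_sums[OF i(1,3)])
    qed (use pos in auto)
    also have "K (1 / \<zeta>) (1 / w) = kap (1 / w) (1 / \<zeta>)"
      using wz nz by (intro K_eq i) auto
    also have "\<dots> = w * deriv \<Psi> w / (\<Psi> w - \<Psi> \<zeta>) - w / (w - \<zeta>)"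
      using wz assms by (intro kap_eq) auto
    finally show "((\<lambda>(m, n). c m n * (1 / w) ^ m * (1 / \<zeta>) ^ n) has_sum
         (w * deriv \<Psi> w / (\<Psi> w - \<Psi> \<zeta>) - w / (w - \<zeta>))) UNIV" .
  qed
qed

end

section \<open>Fourier series on the circle\<close>

abbreviation circle_measure :: "real measure" where
  "circle_measure \<equiv> restrict_space lborel {0..2 * pi}"

lemma finite_circle_measure: "finite_measure circle_measure"
  by (rule finite_measureI) (simp add: emeasure_restrict_space space_restrict_space)

interpretation circle: finite_measure circle_measure
  by (rule finite_circle_measure)

lemma space_circle [simp]: "space circle_measure = {0..2 * pi}"
  by (simp add: space_restrict_space)

lemma measurable_circleI: "f \<in> borel_measurable borel \<Longrightarrow> f \<in> borel_measurable circle_measure"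
  by (simp add: measurable_restrict_space1)

lemma integral_cis_circle:
  "(\<integral>\<theta>. cis (of_int k * \<theta>) \<partial>circle_measure) = (if k = 0 then complex_of_real (2 * pi) else 0)"
proof -
  have *: "(\<integral>\<theta>. cis (of_int k * \<theta>) \<partial>circle_measure)
      = (\<integral>\<theta>. indicator {0..2 * pi} \<theta> *\<^sub>R cis (of_int k * \<theta>) \<partial>lborel)"
    by (rule integral_restrict_space) simp
  show ?thesis
  proof (cases "k = 0")
    case True
    have "(\<integral>\<theta>. indicator {0..2 * pi} \<theta> *\<^sub>R cis (of_int k * \<theta>) \<partial>lborel)
        = complex_of_real (2 * pi) - complex_of_real 0"
      by (rule integral_FTC_Icc) (auto simp: True intro!: derivative_eq_intros)
    then show ?thesis using * True by simp
  next
    case False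
    define c where "c = \<i> * complex_of_int k"
    have c: "c \<noteq> 0" using False by (simp add: c_def)
    have cis_eq: "cis (of_int k * \<theta>) = exp (c * of_real \<theta>)" for \<theta>
      by (simp add: cis_conv_exp c_def mult.assoc)
    have "((\<lambda>\<theta>. cis (of_int k * \<theta>) / c) has_vector_derivative cis (of_int k * \<theta>))
        (at \<theta> within {0..2 * pi})" for \<theta>
      unfolding cis_eq
      by (rule has_vector_derivative_real_field[where f="\<lambda>z. exp (c * z) / c"])
         (use c in \<open>auto intro!: derivative_eq_intros\<close>)
    then have "(\<integral>\<theta>. indicator {0..2 * pi} \<theta> *\<^sub>R cis (of_int k * \<theta>) \<partial>lborel)
        = cis (of_int k * (2 * pi)) / c - cis (of_int k * 0) / c"
      by (intro integral_FTC_Icc) (auto intro!: continuous_intros)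
    also have "cis (of_int k * (2 * pi)) = 1"
      by (metis cis_multiple_2pi Ints_of_int mult.commute)
    finally show ?thesis using * False by simp
  qed
qed

text \<open>The intervals from -N to N eventually contain every finite set of integers. This links
  unordered sums to the symmetric partial sums in \<open>density_series\<close>.\<close>

lemma symmetric_sums:
  fixes f :: "int \<Rightarrow> 'a::{comm_monoid_add, topological_space}"
  assumes "(f has_sum S) UNIV"
  shows "(\<lambda>N. \<Sum>n = - int N..int N. f n) \<longlonglongrightarrow> S"
proof -
  have "filterlim (\<lambda>N. {- int N..int N}) (finite_subsets_at_top UNIV) sequentially"
    unfolding filterlim_finite_subsets_at_top
  proof safe
    fix X :: "int set" assume X: "finite X"
    define M where "M = Max (insert 0 ((\<lambda>x. nat \<bar>x\<bar>) ` X))"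
    have "nat \<bar>x\<bar> \<le> M" if "x \<in> X" for x
      unfolding M_def using X that by (intro Max_ge) auto
    then have "X \<subseteq> {- int N..int N}" if "N \<ge> M" for N using that by fastforce
    then show "\<forall>\<^sub>F N in sequentially. finite {- int N..int N} \<and> X \<subseteq> {- int N..int N} \<and> {- int N..int N} \<subseteq> UNIV"
      by (auto intro!: eventually_sequentiallyI[of M])
  qed
  then show ?thesis using assms unfolding has_sum_def by (rule filterlim_compose[rotated])
qed

definition trig :: "(int \<Rightarrow> complex) \<Rightarrow> nat \<Rightarrow> real \<Rightarrow> complex" where
  "trig a N \<theta> = (\<Sum>n = - int N..int N. a n * cis (of_int n * \<theta>))"

lemma trig_measurable [measurable]: "trig a N \<in> borel_measurable circle_measure"
  unfolding trig_def
  by (intro measurable_circleI borel_measurable_continuous_onI continuous_intros)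

lemma trig_bounded: "cmod (trig a N \<theta>) \<le> (\<Sum>n = - int N..int N. cmod (a n))"
  unfolding trig_def by (rule sum_norm_le) (simp add: norm_mult)

lemma trig_integrable: "integrable circle_measure (trig a N)"
  by (rule circle.integrable_const_bound[where B="\<Sum>n = - int N..int N. cmod (a n)"])
     (auto simp: trig_bounded)

text \<open>The expansion is asked for almost everywhere only, because that of the Neumann-Poincare
  kernel is available only away from the evaluation point. The sum of the moduli is a constant
  dominating function.\<close>

lemma integral_absolutely_convergent:
  assumes k: "(\<lambda>n. cmod (k n)) summable_on UNIV"
    and \<kappa>: "AE \<theta> in circle_measure. ((\<lambda>n. k n * cis (- of_int n * \<theta>)) has_sum \<kappa> \<theta>) UNIV"
    and m: "\<kappa> \<in> borel_measurable circle_measure"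
  shows "(\<integral>\<theta>. \<kappa> \<theta> * cis (of_int j * \<theta>) \<partial>circle_measure) = of_real (2 * pi) * k j"
    "AE \<theta> in circle_measure. cmod (\<kappa> \<theta>) \<le> (\<Sum>\<^sub>\<infinity>n. cmod (k n))"
proof -
  define s where "s N \<theta> = (\<Sum>n = - int N..int N. k n * cis (- of_int n * \<theta>)) * cis (of_int j * \<theta>)" for N \<theta>
  have sb: "cmod (s N \<theta>) \<le> (\<Sum>\<^sub>\<infinity>n. cmod (k n))" for N \<theta>
  proof -
    have "cmod (s N \<theta>) \<le> (\<Sum>n = - int N..int N. cmod (k n))"
      unfolding s_def norm_mult norm_cis mult_1_right by (rule sum_norm_le) (simp add: norm_mult)
    also have "\<dots> \<le> (\<Sum>\<^sub>\<infinity>n. cmod (k n))" by (rule finite_sum_le_infsum[OF k]) auto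
    finally show ?thesis .
  qed
  have sm [measurable]: "s N \<in> borel_measurable circle_measure" for N
    unfolding s_def by (intro measurable_circleI borel_measurable_continuous_onI continuous_intros)
  have "(\<lambda>N. \<integral>\<theta>. s N \<theta> \<partial>circle_measure) \<longlonglongrightarrow> (\<integral>\<theta>. \<kappa> \<theta> * cis (of_int j * \<theta>) \<partial>circle_measure)"
  proof (rule integral_dominated_convergence[where w="\<lambda>_. \<Sum>\<^sub>\<infinity>n. cmod (k n)"])
    show "(\<lambda>\<theta>. \<kappa> \<theta> * cis (of_int j * \<theta>)) \<in> borel_measurable circle_measure"
      by (intro borel_measurable_times m measurable_circleI borel_measurable_continuous_onI continuous_intros)
    show "AE \<theta> in circle_measure. (\<lambda>N. s N \<theta>) \<longlonglongrightarrow> \<kappa> \<theta> * cis (of_int j * \<theta>)"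
      using \<kappa>
    proof eventually_elim
      case (elim \<theta>)
      show ?case unfolding s_def by (intro tendsto_mult tendsto_const symmetric_sums elim)
    qed
  qed (use sb in auto)
  moreover have "(\<integral>\<theta>. s N \<theta> \<partial>circle_measure) = of_real (2 * pi) * k j" if "N \<ge> nat \<bar>j\<bar>" for N
  proof -
    have i: "integrable circle_measure (\<lambda>\<theta>. cis (of_int i * \<theta>))" for i
      by (rule circle.integrable_const_bound[where B=1])
         (auto intro!: measurable_circleI borel_measurable_continuous_onI continuous_intros)
    have "s N = (\<lambda>\<theta>. \<Sum>n = - int N..int N. k n * cis (of_int (j - n) * \<theta>))"
    proof
      fix \<theta>
      have "k n * cis (- of_int n * \<theta>) * cis (of_int j * \<theta>) = k n * cis (of_int (j - n) * \<theta>)" for n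
        by (simp add: mult.assoc cis_mult algebra_simps)
      then show "s N \<theta> = (\<Sum>n = - int N..int N. k n * cis (of_int (j - n) * \<theta>))"
        unfolding s_def sum_distrib_right by (intro sum.cong refl)
    qed
    then have "(\<integral>\<theta>. s N \<theta> \<partial>circle_measure) =
        (\<Sum>n = - int N..int N. k n * (\<integral>\<theta>. cis (of_int (j - n) * \<theta>) \<partial>circle_measure))"
      using i by (simp add: Bochner_Integration.integral_sum del: of_int_diff)
    also have "\<dots> = (\<Sum>n = - int N..int N. if n = j then k n * of_real (2 * pi) else 0)"
      unfolding integral_cis_circle by (intro sum.cong) auto
    also have "\<dots> = of_real (2 * pi) * k j"
    proof -
      have "j \<in> {- int N..int N}" using that by auto
      then show ?thesis by (simp add: sum.delta mult.commute)
    qed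
    finally show ?thesis .
  qed
  then have "(\<lambda>N. \<integral>\<theta>. s N \<theta> \<partial>circle_measure) \<longlonglongrightarrow> of_real (2 * pi) * k j"
    by (intro tendsto_eventually eventually_sequentiallyI[of "nat \<bar>j\<bar>"])
  ultimately show "(\<integral>\<theta>. \<kappa> \<theta> * cis (of_int j * \<theta>) \<partial>circle_measure) = of_real (2 * pi) * k j"
    by (rule LIMSEQ_unique)
  show "AE \<theta> in circle_measure. cmod (\<kappa> \<theta>) \<le> (\<Sum>\<^sub>\<infinity>n. cmod (k n))"
    using \<kappa>
  proof eventually_elim
    case (elim \<theta>)
    show ?case
      by (rule has_sum_norm_le[OF elim has_sum_infsum[OF k]]) (simp add: norm_mult)
  qed
qed

definition L2_series :: "(real \<Rightarrow> complex) \<Rightarrow> (int \<Rightarrow> complex) \<Rightarrow> bool" where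
  "L2_series f a \<longleftrightarrow> (\<lambda>N. \<integral>\<^sup>+ \<theta>. ennreal ((cmod (f \<theta> - trig a N \<theta>))\<^sup>2) \<partial>circle_measure) \<longlonglongrightarrow> 0"

lemma ennreal_pos_real:
  assumes "0 < e"
  obtains r :: real where "r > 0" "ennreal r < e"
proof (cases e)
  case (real q)
  then have "q > 0" using assms by simp
  then show ?thesis using real that[of "q / 2"] by (simp add: ennreal_lessI)
next
  case top
  then show ?thesis using that[of 1] by simp
qed

lemma L2_series_L1:
  assumes f: "f \<in> borel_measurable circle_measure" and "L2_series f a"
  shows "(\<lambda>N. \<integral>\<^sup>+ \<theta>. ennreal (cmod (f \<theta> - trig a N \<theta>)) \<partial>circle_measure) \<longlonglongrightarrow> 0"
proof (rule order_tendstoI)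
  fix e :: ennreal assume "0 < e"
  then obtain r where r: "r > 0" "ennreal r < e" by (rule ennreal_pos_real)
  \<comment> \<open>The bound \<open>x \<le> d + x\<^sup>2 / d\<close> replaces Cauchy-Schwarz. This
    \<open>d\<close> makes the constant integrate to \<open>r / 2\<close> over length
    \<open>2 * pi\<close>, which leaves \<open>r / 2\<close> for the quadratic term.\<close>
  define d where "d = r / (4 * pi)"
  have d: "d > 0" unfolding d_def using r by simp
  have "\<forall>\<^sub>F N in sequentially. (\<integral>\<^sup>+ \<theta>. ennreal ((cmod (f \<theta> - trig a N \<theta>))\<^sup>2) \<partial>circle_measure) < ennreal (d * r / 2)"
    by (rule order_tendstoD(2)[OF assms(2)[unfolded L2_series_def]]) (use d r in simp)
  then show "\<forall>\<^sub>F N in sequentially. (\<integral>\<^sup>+ \<theta>. ennreal (cmod (f \<theta> - trig a N \<theta>)) \<partial>circle_measure) < e"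
  proof eventually_elim
    case (elim N)
    have mm: "(\<lambda>\<theta>. cmod (f \<theta> - trig a N \<theta>)) \<in> borel_measurable circle_measure"
      using f by measurable
    have pt: "x \<le> d + (1 / d) * x\<^sup>2" if "x \<ge> 0" for x :: real
    proof (cases "x \<le> d")
      case False
      then have "x * d \<le> x * x" using that by (intro mult_left_mono) auto
      then have "x \<le> (1 / d) * x\<^sup>2" using d by (simp add: field_simps power2_eq_square)
      then show ?thesis using d by linarith
    qed (use d in \<open>auto intro: order_trans[of _ d] add_increasing2\<close>)
    have "(\<integral>\<^sup>+ \<theta>. ennreal (cmod (f \<theta> - trig a N \<theta>)) \<partial>circle_measure)
      \<le> (\<integral>\<^sup>+ \<theta>. ennreal d + ennreal (1 / d) * ennreal ((cmod (f \<theta> - trig a N \<theta>))\<^sup>2) \<partial>circle_measure)"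
      using pt d by (intro nn_integral_mono) (simp flip: ennreal_plus ennreal_mult)
    also have "\<dots> = (\<integral>\<^sup>+ \<theta>. ennreal d \<partial>circle_measure)
        + ennreal (1 / d) * (\<integral>\<^sup>+ \<theta>. ennreal ((cmod (f \<theta> - trig a N \<theta>))\<^sup>2) \<partial>circle_measure)"
      using mm by (subst nn_integral_add) (auto simp: nn_integral_cmult)
    also have "\<dots> \<le> ennreal d * ennreal (2 * pi) + ennreal (1 / d) * ennreal (d * r / 2)"
      using elim by (intro add_mono mult_left_mono) (auto simp: emeasure_restrict_space)
    also have "\<dots> = ennreal (d * (2 * pi) + (1 / d) * (d * r / 2))"
      using d r by (simp flip: ennreal_plus ennreal_mult)
    also have "d * (2 * pi) + (1 / d) * (d * r / 2) = r"
      using d by (simp add: d_def field_simps)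
    finally show ?case using r(2) by (rule le_less_trans)
  qed
qed auto

lemma L2_series_integrable:
  assumes f: "f \<in> borel_measurable circle_measure" and "L2_series f a"
  shows "integrable circle_measure f"
proof -
  have "\<forall>\<^sub>F N in sequentially. (\<integral>\<^sup>+ \<theta>. ennreal (cmod (f \<theta> - trig a N \<theta>)) \<partial>circle_measure) < 1"
    by (rule order_tendstoD(2)[OF L2_series_L1[OF assms]]) simp
  then obtain N where N: "(\<integral>\<^sup>+ \<theta>. ennreal (cmod (f \<theta> - trig a N \<theta>)) \<partial>circle_measure) < 1"
    using eventually_happens'[OF sequentially_bot] by blast
  then have "(\<integral>\<^sup>+ \<theta>. ennreal (cmod (f \<theta> - trig a N \<theta>)) \<partial>circle_measure) < \<infinity>"
    by (rule less_trans) simp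
  then have "integrable circle_measure (\<lambda>\<theta>. f \<theta> - trig a N \<theta>)"
    by (intro integrableI_bounded borel_measurable_diff f trig_measurable)
  then have "integrable circle_measure (\<lambda>\<theta>. (f \<theta> - trig a N \<theta>) + trig a N \<theta>)"
    by (intro Bochner_Integration.integrable_add trig_integrable)
  then show ?thesis by simp
qed

lemma L2_series_bounded_coeff:
  assumes "(\<lambda>n. (cmod (a n))\<^sup>2) summable_on (UNIV :: int set)"
  obtains C where "\<And>n. cmod (a n) \<le> C"
proof
  fix n
  have "(cmod (a n))\<^sup>2 \<le> (\<Sum>\<^sub>\<infinity>n. (cmod (a n))\<^sup>2)"
    using finite_sum_le_infsum[OF assms, of "{n}"] by simp
  then show "cmod (a n) \<le> sqrt (\<Sum>\<^sub>\<infinity>n. (cmod (a n))\<^sup>2)" by (rule real_le_rsqrt)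
qed

text \<open>A kernel with absolutely summable coefficients is essentially bounded, so L1 convergence
  of the partial sums of \<open>f\<close> suffices to integrate term by term; of \<open>a\<close>
  the formula needs only boundedness.\<close>

lemma kernel_against_series:
  assumes k: "(\<lambda>n. cmod (k n)) summable_on UNIV"
    and \<kappa>: "AE \<theta> in circle_measure. ((\<lambda>n. k n * cis (- of_int n * \<theta>)) has_sum \<kappa> \<theta>) UNIV"
    and m [measurable]: "\<kappa> \<in> borel_measurable circle_measure"
    and f [measurable]: "f \<in> borel_measurable circle_measure" and "L2_series f a"
    and a: "\<And>n. cmod (a n) \<le> C"
  shows "(\<integral>\<theta>. \<kappa> \<theta> * f \<theta> \<partial>circle_measure) = of_real (2 * pi) * (\<Sum>\<^sub>\<infinity>n. k n * a n)"
    "(\<lambda>n. cmod (k n * a n)) summable_on UNIV"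
    "integrable circle_measure (\<lambda>\<theta>. \<kappa> \<theta> * f \<theta>)"
proof -
  define B where "B = (\<Sum>\<^sub>\<infinity>n. cmod (k n))"
  have B: "AE \<theta> in circle_measure. cmod (\<kappa> \<theta>) \<le> B" "B \<ge> 0"
    using integral_absolutely_convergent(2)[OF k \<kappa> m] by (auto simp: B_def infsum_nonneg)
  have fi: "integrable circle_measure f" by (rule L2_series_integrable) fact+
  have bi: "integrable circle_measure (\<lambda>\<theta>. \<kappa> \<theta> * g \<theta>)" if g: "integrable circle_measure g" for g
  proof (rule Bochner_Integration.integrable_bound[of _ "\<lambda>\<theta>. B * cmod (g \<theta>)"])
    show "AE \<theta> in circle_measure. cmod (\<kappa> \<theta> * g \<theta>) \<le> norm (B * cmod (g \<theta>))"
      using B(1) by eventually_elim (use B(2) in \<open>auto simp: norm_mult intro!: mult_right_mono\<close>)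
  qed (use g in auto)
  then show i: "integrable circle_measure (\<lambda>\<theta>. \<kappa> \<theta> * f \<theta>)" using fi by blast
  show ab: "(\<lambda>n. cmod (k n * a n)) summable_on UNIV"
    by (rule summable_on_comparison_test[OF summable_on_cmult_left[OF k, of C]])
       (auto simp: norm_mult intro!: mult_left_mono a)
  have "(\<lambda>N. of_real (2 * pi) * (\<Sum>n = - int N..int N. k n * a n)) \<longlonglongrightarrow> of_real (2 * pi) * (\<Sum>\<^sub>\<infinity>n. k n * a n)"
    using symmetric_sums[OF has_sum_infsum[OF abs_summable_summable[OF ab]]] by (intro tendsto_intros)
  moreover have "of_real (2 * pi) * (\<Sum>n = - int N..int N. k n * a n) = (\<integral>\<theta>. \<kappa> \<theta> * trig a N \<theta> \<partial>circle_measure)" for N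
  proof -
    have ii: "integrable circle_measure (\<lambda>\<theta>. cis (of_int i * \<theta>))" for i
      by (rule circle.integrable_const_bound[where B=1])
         (auto intro!: measurable_circleI borel_measurable_continuous_onI continuous_intros)
    have "(\<integral>\<theta>. \<kappa> \<theta> * trig a N \<theta> \<partial>circle_measure) =
        (\<integral>\<theta>. (\<Sum>n = - int N..int N. a n * (\<kappa> \<theta> * cis (of_int n * \<theta>))) \<partial>circle_measure)"
      unfolding trig_def by (intro Bochner_Integration.integral_cong) (auto simp: sum_distrib_left algebra_simps)
    also have "\<dots> = (\<Sum>n = - int N..int N. a n * (\<integral>\<theta>. \<kappa> \<theta> * cis (of_int n * \<theta>) \<partial>circle_measure))"
      using bi[OF ii] by (simp add: Bochner_Integration.integral_sum)
    also have "\<dots> = of_real (2 * pi) * (\<Sum>n = - int N..int N. k n * a n)"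
      unfolding integral_absolutely_convergent(1)[OF k \<kappa> m] by (simp add: sum_distrib_left algebra_simps)
    finally show ?thesis by simp
  qed
  ultimately have l1: "(\<lambda>N. \<integral>\<theta>. \<kappa> \<theta> * trig a N \<theta> \<partial>circle_measure) \<longlonglongrightarrow> of_real (2 * pi) * (\<Sum>\<^sub>\<infinity>n. k n * a n)"
    by (simp only:)
  define I J W where "I = (\<integral>\<theta>. \<kappa> \<theta> * f \<theta> \<partial>circle_measure)"
    and "J = (\<lambda>N. \<integral>\<theta>. \<kappa> \<theta> * trig a N \<theta> \<partial>circle_measure)"
    and "W = (\<lambda>N. ennreal B * (\<integral>\<^sup>+ \<theta>. ennreal (cmod (f \<theta> - trig a N \<theta>)) \<partial>circle_measure))"
  have "(\<lambda>N. ennreal B * (\<integral>\<^sup>+ \<theta>. ennreal (cmod (f \<theta> - trig a N \<theta>)) \<partial>circle_measure)) \<longlonglongrightarrow> ennreal B * 0"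
    by (intro ennreal_tendsto_cmult L2_series_L1 assms) auto
  moreover have "ennreal (cmod ((\<integral>\<theta>. \<kappa> \<theta> * f \<theta> \<partial>circle_measure) - (\<integral>\<theta>. \<kappa> \<theta> * trig a N \<theta> \<partial>circle_measure)))
      \<le> ennreal B * (\<integral>\<^sup>+ \<theta>. ennreal (cmod (f \<theta> - trig a N \<theta>)) \<partial>circle_measure)" for N
  proof -
    have "(\<integral>\<theta>. \<kappa> \<theta> * f \<theta> \<partial>circle_measure) - (\<integral>\<theta>. \<kappa> \<theta> * trig a N \<theta> \<partial>circle_measure)
       = (\<integral>\<theta>. \<kappa> \<theta> * (f \<theta> - trig a N \<theta>) \<partial>circle_measure)"
      using i bi[OF trig_integrable] by (simp add: right_diff_distrib)
    also have "ennreal (cmod \<dots>) \<le> (\<integral>\<^sup>+ \<theta>. ennreal (cmod (\<kappa> \<theta> * (f \<theta> - trig a N \<theta>))) \<partial>circle_measure)"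
      by (intro integral_norm_bound_ennreal bi Bochner_Integration.integrable_diff fi trig_integrable)
    also have "\<dots> \<le> (\<integral>\<^sup>+ \<theta>. ennreal B * ennreal (cmod (f \<theta> - trig a N \<theta>)) \<partial>circle_measure)"
      using B(1) by (intro nn_integral_mono_AE, eventually_elim)
        (use B(2) in \<open>auto simp: norm_mult simp flip: ennreal_mult intro!: mult_right_mono\<close>)
    also have "\<dots> = ennreal B * (\<integral>\<^sup>+ \<theta>. ennreal (cmod (f \<theta> - trig a N \<theta>)) \<partial>circle_measure)"
      by (intro nn_integral_cmult) measurable
    finally show ?thesis .
  qed
  ultimately have le: "\<And>N. ennreal (cmod (I - J N)) \<le> W N" and W: "W \<longlonglongrightarrow> 0"
    unfolding I_def J_def W_def by simp_all
  have "(\<lambda>N. ennreal (cmod (I - J N))) \<longlonglongrightarrow> 0"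
    by (rule tendsto_sandwich[OF _ _ tendsto_const W]) (use le in auto)
  then have "(\<lambda>N. cmod (I - J N)) \<longlonglongrightarrow> 0"
    by (rule ennreal_tendsto_0_iff[THEN iffD1, rotated]) (rule norm_ge_zero)
  then have "(\<lambda>N. I - J N) \<longlonglongrightarrow> 0"
    by (rule tendsto_norm_zero_cancel)
  then have "(\<lambda>N. I - (I - J N)) \<longlonglongrightarrow> I - 0"
    by (intro tendsto_diff tendsto_const)
  then have "J \<longlonglongrightarrow> I" by simp
  then have "(\<lambda>N. \<integral>\<theta>. \<kappa> \<theta> * trig a N \<theta> \<partial>circle_measure) \<longlonglongrightarrow> (\<integral>\<theta>. \<kappa> \<theta> * f \<theta> \<partial>circle_measure)"
    by (simp only: I_def J_def)
  from LIMSEQ_unique[OF this l1]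
  show "(\<integral>\<theta>. \<kappa> \<theta> * f \<theta> \<partial>circle_measure) = of_real (2 * pi) * (\<Sum>\<^sub>\<infinity>n. k n * a n)" .
qed

text \<open>The kernel with the single coefficient 1 at \<open>j\<close> extracts the coefficient
  \<open>a j\<close> by an integral that depends on \<open>f\<close> alone.\<close>

lemma L2_series_unique:
  assumes "f \<in> borel_measurable circle_measure" "L2_series f a" "L2_series f b"
    "(\<lambda>n. (cmod (a n))\<^sup>2) summable_on UNIV" "(\<lambda>n. (cmod (b n))\<^sup>2) summable_on UNIV"
  shows "a = b"
proof
  fix j
  define k :: "int \<Rightarrow> complex" where "k n = (if n = j then 1 else 0)" for n
  have hs: "((\<lambda>n. if n = j then c n else 0) has_sum c j) UNIV" for c :: "int \<Rightarrow> 'b::real_normed_vector"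
    using has_sum_finite_neutralI[of "{j}" UNIV "\<lambda>n. if n = j then c n else 0" "c j"] by simp
  have k: "(\<lambda>n. cmod (k n)) summable_on UNIV"
    using has_sum_imp_summable[OF hs[of "\<lambda>_. 1::real"]]
    by (rule summable_on_cong[THEN iffD1, rotated]) (auto simp: k_def)
  have \<kappa>: "((\<lambda>n. k n * cis (- of_int n * \<theta>)) has_sum cis (- of_int j * \<theta>)) UNIV" for \<theta>
    using hs[of "\<lambda>n. cis (- of_int n * \<theta>)"]
    by (rule has_sum_cong[THEN iffD1, rotated]) (auto simp: k_def)
  have m: "(\<lambda>\<theta>. cis (- of_int j * \<theta>)) \<in> borel_measurable circle_measure"
    by (intro measurable_circleI borel_measurable_continuous_onI continuous_intros)
  have val: "(\<Sum>\<^sub>\<infinity>n. k n * c n) = c j" for c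
    using infsumI[OF hs[of c]] by (rule trans[rotated]) (auto simp: k_def intro!: infsum_cong)
  obtain C where C: "\<And>n. cmod (a n) \<le> C" using L2_series_bounded_coeff[OF assms(4)] by blast
  obtain C' where C': "\<And>n. cmod (b n) \<le> C'" using L2_series_bounded_coeff[OF assms(5)] by blast
  have "of_real (2 * pi) * a j = of_real (2 * pi) * b j"
    using kernel_against_series(1)[OF k always_eventually m assms(1,2) C]
      kernel_against_series(1)[OF k always_eventually m assms(1,3) C'] \<kappa> unfolding val by simp
  then show "a j = b j" by simp
qed

lemma norm_linear_square_le:
  "(cmod (c * u + d * v))\<^sup>2 \<le> 2 * (cmod c)\<^sup>2 * (cmod u)\<^sup>2 + 2 * (cmod d)\<^sup>2 * (cmod v)\<^sup>2"
proof -
  have "(cmod (c * u + d * v))\<^sup>2 \<le> (cmod (c * u) + cmod (d * v))\<^sup>2"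
    by (intro power_mono norm_triangle_ineq) simp
  also have "\<dots> \<le> 2 * (cmod (c * u))\<^sup>2 + 2 * (cmod (d * v))\<^sup>2"
    using sum_squares_ge_zero[of "cmod (c * u) - cmod (d * v)" 0]
    by (simp add: power2_eq_square algebra_simps)
  finally show ?thesis by (simp add: norm_mult power_mult_distrib)
qed

lemma L2_series_linear:
  assumes [measurable]: "f \<in> borel_measurable circle_measure" "g \<in> borel_measurable circle_measure"
    and "L2_series f a" "L2_series g b"
  shows "L2_series (\<lambda>\<theta>. c * f \<theta> + d * g \<theta>) (\<lambda>n. c * a n + d * b n)"
proof -
  define X Y where "X = (\<lambda>N. \<integral>\<^sup>+ \<theta>. ennreal ((cmod (f \<theta> - trig a N \<theta>))\<^sup>2) \<partial>circle_measure)"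
    and "Y = (\<lambda>N. \<integral>\<^sup>+ \<theta>. ennreal ((cmod (g \<theta> - trig b N \<theta>))\<^sup>2) \<partial>circle_measure)"
  have XY: "X \<longlonglongrightarrow> 0" "Y \<longlonglongrightarrow> 0" using assms(3,4) by (auto simp: L2_series_def X_def Y_def)
  have pt: "(cmod ((c * p + d * q) - (c * p' + d * q')))\<^sup>2
      \<le> 2 * (cmod c)\<^sup>2 * (cmod (p - p'))\<^sup>2 + 2 * (cmod d)\<^sup>2 * (cmod (q - q'))\<^sup>2" for p q p' q'
    using norm_linear_square_le[of c "p - p'" d "q - q'"] by (simp add: algebra_simps)
  have tr: "trig (\<lambda>n. c * a n + d * b n) N \<theta> = c * trig a N \<theta> + d * trig b N \<theta>" for N \<theta>
    unfolding trig_def by (simp add: sum_distrib_left sum.distrib algebra_simps)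
  have le: "(\<integral>\<^sup>+ \<theta>. ennreal ((cmod (c * f \<theta> + d * g \<theta> - trig (\<lambda>n. c * a n + d * b n) N \<theta>))\<^sup>2) \<partial>circle_measure)
     \<le> ennreal (2 * (cmod c)\<^sup>2) * X N + ennreal (2 * (cmod d)\<^sup>2) * Y N" for N
  proof -
    have "(\<integral>\<^sup>+ \<theta>. ennreal ((cmod (c * f \<theta> + d * g \<theta> - trig (\<lambda>n. c * a n + d * b n) N \<theta>))\<^sup>2) \<partial>circle_measure)
      \<le> (\<integral>\<^sup>+ \<theta>. ennreal (2 * (cmod c)\<^sup>2) * ennreal ((cmod (f \<theta> - trig a N \<theta>))\<^sup>2)
            + ennreal (2 * (cmod d)\<^sup>2) * ennreal ((cmod (g \<theta> - trig b N \<theta>))\<^sup>2) \<partial>circle_measure)"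
      unfolding tr
      by (intro nn_integral_mono) (use pt in \<open>simp flip: ennreal_mult ennreal_plus\<close>)
    also have "\<dots> = ennreal (2 * (cmod c)\<^sup>2) * X N + ennreal (2 * (cmod d)\<^sup>2) * Y N"
      unfolding X_def Y_def by (subst nn_integral_add) (auto simp: nn_integral_cmult)
    finally show ?thesis .
  qed
  have "(\<lambda>N. ennreal (2 * (cmod c)\<^sup>2) * X N + ennreal (2 * (cmod d)\<^sup>2) * Y N) \<longlonglongrightarrow>
      ennreal (2 * (cmod c)\<^sup>2) * 0 + ennreal (2 * (cmod d)\<^sup>2) * 0"
    by (intro tendsto_add ennreal_tendsto_cmult XY) auto
  then have l: "(\<lambda>N. ennreal (2 * (cmod c)\<^sup>2) * X N + ennreal (2 * (cmod d)\<^sup>2) * Y N) \<longlonglongrightarrow> 0"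
    by simp
  show ?thesis
    unfolding L2_series_def
    by (rule tendsto_sandwich[OF _ _ tendsto_const l]) (use le in auto)
qed

text \<open>The tail \<open>t N\<close> of the coefficients bounds the error uniformly in \<theta>,
  and the circle has finite measure.\<close>

lemma L2_series_absolutely_convergent:
  assumes b: "(\<lambda>n. cmod (b n)) summable_on UNIV"
    and f: "\<And>\<theta>. \<theta> \<in> {0..2 * pi} \<Longrightarrow> ((\<lambda>n. b n * cis (of_int n * \<theta>)) has_sum f \<theta>) UNIV"
  shows "L2_series f b"
proof -
  define t where "t N = (\<Sum>\<^sub>\<infinity>n\<in>- {- int N..int N}. cmod (b n))" for N
  have split: "t N = (\<Sum>\<^sub>\<infinity>n. cmod (b n)) - (\<Sum>n = - int N..int N. cmod (b n))" for N
  proof -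
    have "infsum (\<lambda>n. cmod (b n)) (UNIV - {- int N..int N}) =
        infsum (\<lambda>n. cmod (b n)) UNIV - infsum (\<lambda>n. cmod (b n)) {- int N..int N}"
      by (rule infsum_Diff[OF b]) auto
    then show ?thesis by (simp add: t_def Compl_eq_Diff_UNIV)
  qed
  have "t \<longlonglongrightarrow> (\<Sum>\<^sub>\<infinity>n. cmod (b n)) - (\<Sum>\<^sub>\<infinity>n. cmod (b n))"
    unfolding split by (intro tendsto_diff tendsto_const symmetric_sums has_sum_infsum b)
  then have t0: "t \<longlonglongrightarrow> 0" by simp
  have tn: "t N \<ge> 0" for N unfolding t_def by (intro infsum_nonneg) simp
  have bnd: "cmod (f \<theta> - trig b N \<theta>) \<le> t N" if "\<theta> \<in> {0..2 * pi}" for \<theta> N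
  proof -
    have "((\<lambda>n. b n * cis (of_int n * \<theta>)) has_sum (f \<theta> - trig b N \<theta>)) (UNIV - {- int N..int N})"
      unfolding trig_def by (rule has_sum_Diff[OF f[OF that] has_sum_finite]) auto
    moreover have "((\<lambda>n. cmod (b n)) has_sum t N) (UNIV - {- int N..int N})"
      unfolding t_def Compl_eq_Diff_UNIV[symmetric]
      by (intro has_sum_infsum summable_on_subset_banach[OF b]) auto
    ultimately show ?thesis by (rule has_sum_norm_le) (simp add: norm_mult)
  qed
  have le: "(\<integral>\<^sup>+ \<theta>. ennreal ((cmod (f \<theta> - trig b N \<theta>))\<^sup>2) \<partial>circle_measure) \<le> ennreal ((t N)\<^sup>2 * (2 * pi))" for N
  proof -
    have "(\<integral>\<^sup>+ \<theta>. ennreal ((cmod (f \<theta> - trig b N \<theta>))\<^sup>2) \<partial>circle_measure) \<le> (\<integral>\<^sup>+ \<theta>. ennreal ((t N)\<^sup>2) \<partial>circle_measure)"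
      by (intro nn_integral_mono ennreal_leI power_mono bnd) auto
    also have "\<dots> = ennreal ((t N)\<^sup>2 * (2 * pi))"
      by (simp add: emeasure_restrict_space ennreal_mult)
    finally show ?thesis .
  qed
  have "(\<lambda>N. (t N)\<^sup>2 * (2 * pi)) \<longlonglongrightarrow> 0\<^sup>2 * (2 * pi)" by (intro tendsto_intros t0)
  then have "(\<lambda>N. ennreal ((t N)\<^sup>2 * (2 * pi))) \<longlonglongrightarrow> ennreal (0\<^sup>2 * (2 * pi))" by (rule tendsto_ennrealI)
  then have l: "(\<lambda>N. ennreal ((t N)\<^sup>2 * (2 * pi))) \<longlonglongrightarrow> 0" by simp
  show ?thesis
    unfolding L2_series_def by (rule tendsto_sandwich[OF _ _ tendsto_const l]) (use le in auto)
qed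

section \<open>Densities on a level curve, pulled back to the circle\<close>

context exterior_map
begin

definition curve :: "real \<Rightarrow> real \<Rightarrow> complex" where
  "curve \<rho> \<theta> = \<Psi> (of_real \<rho> * cis \<theta>)"

definition speed :: "real \<Rightarrow> real \<Rightarrow> real" where
  "speed \<rho> \<theta> = \<rho> * cmod (deriv \<Psi> (of_real \<rho> * cis \<theta>))"

text \<open>The factor \<open>speed\<close> cancels the denominator of \<open>density_basis\<close>,
  so the coefficients of a density are exactly the Fourier coefficients of its pull-back.\<close>

definition pull :: "real \<Rightarrow> (complex \<Rightarrow> complex) \<Rightarrow> real \<Rightarrow> complex" where
  "pull \<rho> \<phi> \<theta> = of_real (speed \<rho> \<theta>) * \<phi> (curve \<rho> \<theta>)"

definition level_curve :: "real \<Rightarrow> complex set" where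
  "level_curve \<rho> = \<Psi> ` sphere 0 \<rho>"

text \<open>For absolutely summable \<open>b\<close> the series converges at every point of the
  curve; the value 0 elsewhere makes the result measurable on the plane and matches the value of
  \<open>NP_adjoint\<close> off the boundary.\<close>

definition synth :: "real \<Rightarrow> (int \<Rightarrow> complex) \<Rightarrow> complex \<Rightarrow> complex" where
  "synth \<rho> b y = (if y \<in> level_curve \<rho> then \<Sum>\<^sub>\<infinity>n. b n * density_basis \<Psi> \<rho> n y else 0)"

context
  fixes \<rho> :: real
  assumes \<rho>: "\<gamma> < \<rho>"
begin

lemma rho_pos: "\<rho> > 0" using gamma_pos \<rho> by linarith

lemma norm_rho_cis: "cmod (of_real \<rho> * cis \<theta>) = \<rho>"
  using rho_pos by (simp add: norm_mult)

lemma curve_deriv: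
  "(curve \<rho> has_vector_derivative (of_real \<rho> * (\<i> * cis \<theta>)) * deriv \<Psi> (of_real \<rho> * cis \<theta>)) (at \<theta>)"
proof -
  have "((\<lambda>\<theta>. of_real \<rho> * cis \<theta>) has_vector_derivative of_real \<rho> * (\<i> * cis \<theta>)) (at \<theta>)"
    unfolding cis_conv_exp
    by (rule has_vector_derivative_real_field[where f="\<lambda>z. of_real \<rho> * exp (\<i> * z)"])
       (auto intro!: derivative_eq_intros)
  from field_vector_diff_chain_at[OF this Psi_deriv] show ?thesis
    using \<rho> norm_rho_cis by (simp add: curve_def[abs_def] o_def)
qed

lemma norm_curve_deriv: "norm (vector_derivative (curve \<rho>) (at \<theta>)) = speed \<rho> \<theta>"
  using vector_derivative_at[OF curve_deriv, of \<theta>] rho_pos by (simp add: norm_mult speed_def)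

lemma continuous_curve: "continuous_on S (curve \<rho>)"
  using curve_deriv by (meson continuous_at_imp_continuous_on has_vector_derivative_continuous)

lemma continuous_speed: "continuous_on S (speed \<rho>)"
proof -
  have "continuous_on {w. \<gamma> < norm w} (deriv \<Psi>)"
    by (intro holomorphic_on_imp_continuous_on holomorphic_deriv holo open_exterior)
  then have "continuous_on S (\<lambda>\<theta>. deriv \<Psi> (of_real \<rho> * cis \<theta>))"
    by (rule continuous_on_compose2) (use norm_rho_cis \<rho> in \<open>auto intro!: continuous_intros\<close>)
  then show ?thesis unfolding speed_def by (intro continuous_intros)
qed

lemma speed_pos: "speed \<rho> \<theta> > 0"
  unfolding speed_def using rho_pos Psi_deriv_nz[of "of_real \<rho> * cis \<theta>"] norm_rho_cis \<rho> by simp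

lemma speed_bounds:
  obtains m M where "m > 0" "\<And>\<theta>. \<theta> \<in> {0..2 * pi} \<Longrightarrow> m \<le> speed \<rho> \<theta> \<and> speed \<rho> \<theta> \<le> M"
proof -
  have c: "compact {0..2 * pi}" "{0..2 * pi} \<noteq> {}" by auto
  obtain x where x: "\<forall>y\<in>{0..2 * pi}. speed \<rho> x \<le> speed \<rho> y"
    using continuous_attains_inf[OF c continuous_speed] by blast
  obtain y where y: "\<forall>z\<in>{0..2 * pi}. speed \<rho> z \<le> speed \<rho> y"
    using continuous_attains_sup[OF c continuous_speed] by blast
  show thesis using that[of "speed \<rho> x" "speed \<rho> y"] x y speed_pos by auto
qed

lemma curve_measurable [measurable]:
  "curve \<rho> \<in> borel_measurable circle_measure" "speed \<rho> \<in> borel_measurable circle_measure"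
  by (intro measurable_circleI borel_measurable_continuous_onI continuous_curve continuous_speed)+

lemma pull_measurable [measurable]:
  assumes "\<phi> \<in> borel_measurable borel"
  shows "pull \<rho> \<phi> \<in> borel_measurable circle_measure"
proof -
  have "(\<lambda>\<theta>. \<phi> (curve \<rho> \<theta>)) \<in> borel_measurable circle_measure"
    by (rule measurable_compose[OF curve_measurable(1) assms])
  then show ?thesis unfolding pull_def by measurable
qed

lemma level_curve_measure_eq:
  "level_curve_measure \<Psi> \<rho> = distr (density circle_measure (\<lambda>\<theta>. ennreal (speed \<rho> \<theta>))) borel (curve \<rho>)"
  unfolding level_curve_measure_def arc_length_measure_def norm_curve_deriv[symmetric]
  by (simp add: curve_def[abs_def])

lemma nn_integral_level:
  assumes [measurable]: "f \<in> borel_measurable borel"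
  shows "(\<integral>\<^sup>+ y. f y \<partial>level_curve_measure \<Psi> \<rho>)
    = (\<integral>\<^sup>+ \<theta>. ennreal (speed \<rho> \<theta>) * f (curve \<rho> \<theta>) \<partial>circle_measure)"
proof -
  have [measurable]: "(\<lambda>\<theta>. f (curve \<rho> \<theta>)) \<in> borel_measurable circle_measure"
    by (rule measurable_compose[OF curve_measurable(1) assms])
  show ?thesis
    unfolding level_curve_measure_eq
    by (subst nn_integral_distr) (auto simp: nn_integral_density)
qed

lemma integral_level:
  assumes [measurable]: "f \<in> borel_measurable borel"
  shows "(\<integral> y. f y \<partial>level_curve_measure \<Psi> \<rho>)
    = (\<integral> \<theta>. speed \<rho> \<theta> *\<^sub>R (f (curve \<rho> \<theta>) :: complex) \<partial>circle_measure)"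
proof -
  have [measurable]: "(\<lambda>\<theta>. f (curve \<rho> \<theta>)) \<in> borel_measurable circle_measure"
    by (rule measurable_compose[OF curve_measurable(1) assms])
  show ?thesis
    unfolding level_curve_measure_eq
    by (subst integral_distr) (auto simp: integral_density less_imp_le speed_pos)
qed

lemma inj_sphere: "inj_on \<Psi> (sphere 0 \<rho>)"
  using inj by (rule inj_on_subset) (use \<rho> in auto)

lemma continuous_sphere: "continuous_on (sphere 0 \<rho>) \<Psi>"
  using holomorphic_on_imp_continuous_on[OF holo] by (rule continuous_on_subset) (use \<rho> in auto)

lemma compact_level_curve: "compact (level_curve \<rho>)"
  unfolding level_curve_def by (intro compact_continuous_image continuous_sphere compact_sphere)

lemma level_curve_borel [measurable]: "level_curve \<rho> \<in> sets borel"
  using compact_level_curve by (intro borel_closed compact_imp_closed)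

lemma curve_in_level_curve: "curve \<rho> \<theta> \<in> level_curve \<rho>"
  unfolding curve_def level_curve_def using norm_rho_cis by auto

lemma level_curveE:
  assumes "y \<in> level_curve \<rho>"
  obtains \<theta> where "\<theta> \<in> {0..2 * pi}" "y = curve \<rho> \<theta>"
proof -
  obtain w where w: "y = \<Psi> w" "cmod w = \<rho>" using assms by (auto simp: level_curve_def)
  obtain \<theta> where "0 \<le> \<theta>" "\<theta> < 2 * pi" "w = of_real \<rho> * cis \<theta>"
    using Arg2pi[of w] w(2) unfolding is_Arg_def cis_conv_exp by metis
  then show thesis using w by (intro that[of \<theta>]) (auto simp: curve_def)
qed

lemma inv_into_curve: "inv_into (sphere 0 \<rho>) \<Psi> (curve \<rho> \<theta>) = of_real \<rho> * cis \<theta>"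
  unfolding curve_def using norm_rho_cis by (intro inv_into_f_f inj_sphere) auto

lemma cis_Arg_multiple: "w \<noteq> 0 \<Longrightarrow> cis (of_int n * Arg w) = sgn w powi n"
  by (simp add: cis_Arg flip: cis_power_int)

lemma density_basis_curve:
  "density_basis \<Psi> \<rho> n (curve \<rho> \<theta>) = cis (of_int n * \<theta>) / of_real (speed \<rho> \<theta>)"
proof -
  have nz: "of_real \<rho> * cis \<theta> \<noteq> 0" using rho_pos by simp
  have "sgn (complex_of_real \<rho> * cis \<theta>) = cis \<theta>"
    using rho_pos by (simp add: sgn_mult sgn_of_real)
  then show ?thesis
    unfolding density_basis_def inv_into_curve Let_def cis_Arg_multiple[OF nz] cis_power_int speed_def
    by (simp add: cis_power_int)
qed

lemma density_basis_measurable [measurable]: "density_basis \<Psi> \<rho> n \<in> borel_measurable borel"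
proof -
  define g where "g = inv_into (sphere 0 \<rho>) \<Psi>"
  \<comment> \<open>Off the curve \<open>y\<close> has no preimage on the circle, and
    \<open>inv_into\<close> then chooses from the empty predicate. It returns the same arbitrary
    point \<open>c\<close> for all such \<open>y\<close>, so the basis function is constant
    there.\<close>
  define c where "c = (SOME x::complex. False)"
  have cont_g: "continuous_on (level_curve \<rho>) g"
    unfolding level_curve_def g_def
    by (rule continuous_on_inv[OF continuous_sphere compact_sphere]) (use inj_sphere in auto)
  have g_in: "g y \<in> sphere 0 \<rho>" if "y \<in> level_curve \<rho>" for y
    using that unfolding g_def level_curve_def by (rule inv_into_into)
  have g_out: "g y = c" if "y \<notin> level_curve \<rho>" for y
  proof -
    have "(\<lambda>x. x \<in> sphere 0 \<rho> \<and> \<Psi> x = y) = (\<lambda>x. False)" using that by (auto simp: level_curve_def)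
    then show ?thesis unfolding g_def c_def inv_into_def by simp
  qed
  have "continuous_on {w. \<gamma> < norm w} (deriv \<Psi>)"
    by (intro holomorphic_on_imp_continuous_on holomorphic_deriv holo open_exterior)
  then have cd: "continuous_on (level_curve \<rho>) (\<lambda>y. deriv \<Psi> (g y))"
    by (rule continuous_on_compose2[OF _ cont_g]) (use g_in \<rho> in auto)
  have nz: "g y \<noteq> 0" "deriv \<Psi> (g y) \<noteq> 0" if "y \<in> level_curve \<rho>" for y
    using g_in[OF that] rho_pos \<rho> Psi_deriv_nz[of "g y"] by auto
  have "continuous_on (level_curve \<rho>) (\<lambda>y. sgn (g y) powi n / of_real (\<rho> * norm (deriv \<Psi> (g y))))"
    using nz rho_pos by (intro continuous_intros cd cont_g) (auto simp: sgn_zero_iff)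
  then have "(\<lambda>y. if y \<in> level_curve \<rho> then sgn (g y) powi n / of_real (\<rho> * norm (deriv \<Psi> (g y)))
      else cis (of_int n * Arg c) / of_real (\<rho> * norm (deriv \<Psi> c))) \<in> borel_measurable borel"
    by (intro borel_measurable_continuous_on_if level_curve_borel continuous_on_const)
  moreover have "density_basis \<Psi> \<rho> n = (\<lambda>y. if y \<in> level_curve \<rho> then sgn (g y) powi n / of_real (\<rho> * norm (deriv \<Psi> (g y)))
      else cis (of_int n * Arg c) / of_real (\<rho> * norm (deriv \<Psi> c)))"
    using nz g_out by (auto simp: density_basis_def cis_Arg_multiple Let_def fun_eq_iff simp flip: g_def)
  ultimately show ?thesis by simp
qed

text \<open>In the parameter, the arc length integral of the squared error is the integral of
  \<open>(cmod (pull \<rho> \<phi> \<theta> - trig a N \<theta>))\<^sup>2 / speed \<rho>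
  \<theta>\<close>; since \<open>speed\<close> lies between two positive constants, both notions of
  convergence agree.\<close>

lemma density_series_iff:
  assumes [measurable]: "\<phi> \<in> borel_measurable borel"
  shows "density_series \<Psi> \<rho> \<phi> a \<longleftrightarrow> (\<lambda>n. (cmod (a n))\<^sup>2) summable_on UNIV \<and> L2_series (pull \<rho> \<phi>) a"
proof -
  obtain m M where mM: "m > 0" "\<And>\<theta>. \<theta> \<in> {0..2 * pi} \<Longrightarrow> m \<le> speed \<rho> \<theta> \<and> speed \<rho> \<theta> \<le> M"
    using speed_bounds by blast
  have M: "M > 0" using mM(1) mM(2)[of 0] by auto
  note [measurable] = pull_measurable[OF assms]
  define Y where "Y N = (\<integral>\<^sup>+ y. ennreal ((norm (\<phi> y - (\<Sum>n = - int N..int N. a n * density_basis \<Psi> \<rho> n y)))\<^sup>2)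
            \<partial>level_curve_measure \<Psi> \<rho>)" for N
  define X where "X N = (\<integral>\<^sup>+ \<theta>. ennreal ((cmod (pull \<rho> \<phi> \<theta> - trig a N \<theta>))\<^sup>2) \<partial>circle_measure)" for N
  have Y: "Y N = (\<integral>\<^sup>+ \<theta>. ennreal ((cmod (pull \<rho> \<phi> \<theta> - trig a N \<theta>))\<^sup>2 / speed \<rho> \<theta>) \<partial>circle_measure)" for N
  proof -
    have *: "ennreal (speed \<rho> \<theta>) * ennreal ((cmod (\<phi> (curve \<rho> \<theta>) - (\<Sum>n = - int N..int N. a n * density_basis \<Psi> \<rho> n (curve \<rho> \<theta>))))\<^sup>2)
        = ennreal ((cmod (pull \<rho> \<phi> \<theta> - trig a N \<theta>))\<^sup>2 / speed \<rho> \<theta>)" for \<theta>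
    proof -
      define z where "z = \<phi> (curve \<rho> \<theta>) - (\<Sum>n = - int N..int N. a n * density_basis \<Psi> \<rho> n (curve \<rho> \<theta>))"
      have "pull \<rho> \<phi> \<theta> - trig a N \<theta> = of_real (speed \<rho> \<theta>) * z"
        unfolding z_def pull_def trig_def density_basis_curve using speed_pos[of \<theta>]
        by (simp add: right_diff_distrib sum_distrib_left)
      then have "(cmod (pull \<rho> \<phi> \<theta> - trig a N \<theta>))\<^sup>2 / speed \<rho> \<theta> = speed \<rho> \<theta> * (cmod z)\<^sup>2"
        using speed_pos[of \<theta>] by (simp add: norm_mult power_mult_distrib power2_eq_square)
      then show ?thesis unfolding z_def[symmetric] using speed_pos[of \<theta>] by (simp add: ennreal_mult)
    qed
    show ?thesis unfolding Y_def by (subst nn_integral_level) (simp_all add: *)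
  qed
  have YX: "Y N \<le> ennreal (1 / m) * X N" for N
  proof -
    have "Y N \<le> (\<integral>\<^sup>+ \<theta>. ennreal (1 / m) * ennreal ((cmod (pull \<rho> \<phi> \<theta> - trig a N \<theta>))\<^sup>2) \<partial>circle_measure)"
      unfolding Y using mM 
      by (intro nn_integral_mono) (auto simp flip: ennreal_mult intro!: ennreal_leI divide_left_mono mult_pos_pos speed_pos)
    also have "\<dots> = ennreal (1 / m) * X N" unfolding X_def by (intro nn_integral_cmult) measurable
    finally show ?thesis .
  qed
  have XY: "X N \<le> ennreal M * Y N" for N
  proof -
    have "X N \<le> (\<integral>\<^sup>+ \<theta>. ennreal M * ennreal ((cmod (pull \<rho> \<phi> \<theta> - trig a N \<theta>))\<^sup>2 / speed \<rho> \<theta>) \<partial>circle_measure)"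
      unfolding X_def
    proof (intro nn_integral_mono)
      fix \<theta> assume "\<theta> \<in> space circle_measure"
      then have s: "speed \<rho> \<theta> \<le> M" using mM by auto
      define q where "q = (cmod (pull \<rho> \<phi> \<theta> - trig a N \<theta>))\<^sup>2"
      have "q * speed \<rho> \<theta> \<le> q * M" by (rule mult_left_mono[OF s]) (simp add: q_def)
      then have "q \<le> M * (q / speed \<rho> \<theta>)" using speed_pos[of \<theta>] by (simp add: field_simps)
      then have "ennreal q \<le> ennreal (M * (q / speed \<rho> \<theta>))" by (rule ennreal_leI)
      also have "\<dots> = ennreal M * ennreal (q / speed \<rho> \<theta>)"
        using M speed_pos[of \<theta>] by (intro ennreal_mult) (auto simp: q_def)
      finally show "ennreal ((cmod (pull \<rho> \<phi> \<theta> - trig a N \<theta>))\<^sup>2) \<le> ennreal M * ennreal ((cmod (pull \<rho> \<phi> \<theta> - trig a N \<theta>))\<^sup>2 / speed \<rho> \<theta>)"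
        by (simp add: q_def)
    qed
    also have "\<dots> = ennreal M * Y N" unfolding Y by (intro nn_integral_cmult) measurable
    finally show ?thesis .
  qed
  have lim: "V \<longlonglongrightarrow> 0" if le: "\<And>N. V N \<le> ennreal C * U N" and U: "U \<longlonglongrightarrow> 0" for U V :: "nat \<Rightarrow> ennreal" and C
  proof -
    have "(\<lambda>N. ennreal C * U N) \<longlonglongrightarrow> ennreal C * 0" by (intro ennreal_tendsto_cmult U) auto
    then have l: "(\<lambda>N. ennreal C * U N) \<longlonglongrightarrow> 0" by simp
    show ?thesis by (rule tendsto_sandwich[OF _ _ tendsto_const l]) (use le in auto)
  qed
  have "Y \<longlonglongrightarrow> 0 \<longleftrightarrow> X \<longlonglongrightarrow> 0"
    using lim[of Y "1 / m" X] lim[of X M Y] YX XY by blast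
  moreover have "density_series \<Psi> \<rho> \<phi> a \<longleftrightarrow> (\<lambda>n. (norm (a n))\<^sup>2) summable_on UNIV \<and> Y \<longlonglongrightarrow> 0"
    unfolding density_series_def Y_def ..
  ultimately show ?thesis unfolding L2_series_def X_def by blast
qed

lemma the_density_series:
  assumes "\<phi> \<in> borel_measurable borel" "density_series \<Psi> \<rho> \<phi> a"
  shows "(THE a. density_series \<Psi> \<rho> \<phi> a) = a"
  using assms L2_series_unique[OF pull_measurable[OF assms(1)]]
  by (intro the_equality) (auto simp: density_series_iff)

lemma density_series_linear:
  assumes "\<phi> \<in> borel_measurable borel" "density_series \<Psi> \<rho> \<phi> a"
    "\<psi> \<in> borel_measurable borel" "density_series \<Psi> \<rho> \<psi> b"
  shows "density_series \<Psi> \<rho> (\<lambda>y. c * \<phi> y + d * \<psi> y) (\<lambda>n. c * a n + d * b n)"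
proof -
  note [measurable] = assms(1,3)
  have a: "(\<lambda>n. (cmod (a n))\<^sup>2) summable_on UNIV" "L2_series (pull \<rho> \<phi>) a"
    and b: "(\<lambda>n. (cmod (b n))\<^sup>2) summable_on UNIV" "L2_series (pull \<rho> \<psi>) b"
    using assms by (auto simp: density_series_iff)
  have sm: "(\<lambda>n. 2 * (cmod c)\<^sup>2 * (cmod (a n))\<^sup>2 + 2 * (cmod d)\<^sup>2 * (cmod (b n))\<^sup>2) summable_on UNIV"
    by (intro summable_on_add summable_on_cmult_right a b)
  have "(\<lambda>n. (cmod (c * a n + d * b n))\<^sup>2) summable_on UNIV"
    by (rule summable_on_comparison_test[OF sm]) (auto intro: norm_linear_square_le)
  moreover have "pull \<rho> (\<lambda>y. c * \<phi> y + d * \<psi> y) = (\<lambda>\<theta>. c * pull \<rho> \<phi> \<theta> + d * pull \<rho> \<psi> \<theta>)"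
    by (auto simp: pull_def algebra_simps)
  ultimately show ?thesis
    using L2_series_linear[OF pull_measurable pull_measurable a(2) b(2), OF assms(1,3)]
    by (simp add: density_series_iff)
qed

lemma synth_curve:
  assumes b: "(\<lambda>n. cmod (b n)) summable_on UNIV"
  shows "((\<lambda>n. b n * cis (of_int n * \<theta>)) has_sum pull \<rho> (synth \<rho> b) \<theta>) UNIV"
    "(\<lambda>n. b n * density_basis \<Psi> \<rho> n (curve \<rho> \<theta>)) summable_on UNIV"
proof -
  have "(\<lambda>n. cmod (b n * cis (of_int n * \<theta>))) summable_on UNIV"
    using b by (simp add: norm_mult)
  from abs_summable_summable[OF this]
  have s: "(\<lambda>n. b n * cis (of_int n * \<theta>)) summable_on UNIV" .
  have eq: "b n * density_basis \<Psi> \<rho> n (curve \<rho> \<theta>) = b n * cis (of_int n * \<theta>) * (1 / of_real (speed \<rho> \<theta>))" for n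
    by (simp add: density_basis_curve)
  show "(\<lambda>n. b n * density_basis \<Psi> \<rho> n (curve \<rho> \<theta>)) summable_on UNIV"
    unfolding eq by (rule summable_on_cmult_left[OF s])
  have "synth \<rho> b (curve \<rho> \<theta>) = (\<Sum>\<^sub>\<infinity>n. b n * cis (of_int n * \<theta>)) * (1 / of_real (speed \<rho> \<theta>))"
    unfolding synth_def eq using curve_in_level_curve s by (simp only: if_True infsum_cmult_left)
  then have "pull \<rho> (synth \<rho> b) \<theta> = (\<Sum>\<^sub>\<infinity>n. b n * cis (of_int n * \<theta>))"
    using speed_pos[of \<theta>] by (simp add: pull_def)
  then show "((\<lambda>n. b n * cis (of_int n * \<theta>)) has_sum pull \<rho> (synth \<rho> b) \<theta>) UNIV"
    using has_sum_infsum[OF s] by simp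
qed

lemma synth_measurable:
  assumes b: "(\<lambda>n. cmod (b n)) summable_on UNIV"
  shows "synth \<rho> b \<in> borel_measurable borel"
proof (rule borel_measurable_LIMSEQ_metric)
  define s where "s N y = (if y \<in> level_curve \<rho> then (\<Sum>n = - int N..int N. b n * density_basis \<Psi> \<rho> n y) else 0)" for N y
  show "s N \<in> borel_measurable borel" for N unfolding s_def by measurable
  show "(\<lambda>N. s N y) \<longlonglongrightarrow> synth \<rho> b y" for y
  proof (cases "y \<in> level_curve \<rho>")
    case True
    then obtain \<theta> where y: "y = curve \<rho> \<theta>" by (rule level_curveE)
    have "(\<lambda>n. b n * density_basis \<Psi> \<rho> n y) summable_on UNIV"
      unfolding y by (rule synth_curve(2)[OF b])
    from symmetric_sums[OF has_sum_infsum[OF this]] show ?thesis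
      using True by (simp add: s_def synth_def)
  qed (simp add: s_def synth_def)
qed

lemma density_series_absolutely_convergent:
  assumes b: "(\<lambda>n. cmod (b n)) summable_on UNIV" and \<phi>: "\<phi> \<in> borel_measurable borel"
    "\<And>y. y \<in> level_curve \<rho> \<Longrightarrow> \<phi> y = synth \<rho> b y"
  shows "density_series \<Psi> \<rho> \<phi> b"
proof -
  have "(\<lambda>n. (cmod (b n))\<^sup>2) summable_on UNIV"
  proof -
    obtain C where C: "\<And>n. cmod (b n) \<le> C"
    proof
      show "cmod (b n) \<le> (\<Sum>\<^sub>\<infinity>n. cmod (b n))" for n
        using finite_sum_le_infsum[OF b, of "{n}"] by simp
    qed
    show ?thesis
      by (rule summable_on_comparison_test[OF summable_on_cmult_left[OF b, of C]])
         (auto simp: power2_eq_square intro: mult_left_mono C)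
  qed
  moreover have "pull \<rho> \<phi> = pull \<rho> (synth \<rho> b)"
    using \<phi>(2) curve_in_level_curve by (auto simp: pull_def)
  ultimately show ?thesis
    using L2_series_absolutely_convergent[OF b synth_curve(1)[OF b]] \<phi>(1) by (simp add: density_series_iff)
qed

end

lemma level_curve_disjoint:
  assumes "\<gamma> < \<rho>" "\<gamma> < \<rho>'" "\<rho> \<noteq> \<rho>'" "y \<in> level_curve \<rho>"
  shows "y \<notin> level_curve \<rho>'"
  using assms inj by (auto simp: level_curve_def dest!: inj_onD)

end

section \<open>The boundary of the conformal annulus\<close>

context exterior_map
begin

context
  fixes r\<^sub>i r\<^sub>e :: real
  assumes radii: "\<gamma> < r\<^sub>i" "r\<^sub>i < r\<^sub>e"
begin

lemma annulus_open: "open (conformal_annulus \<Psi> r\<^sub>i r\<^sub>e)"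
  unfolding conformal_annulus_def
proof (rule open_mapping_thm3)
  show "\<Psi> holomorphic_on {w. r\<^sub>i < norm w \<and> norm w < r\<^sub>e}"
    using holo by (rule holomorphic_on_subset) (use radii in auto)
  show "open {w::complex. r\<^sub>i < norm w \<and> norm w < r\<^sub>e}"
    by (intro open_Collect_conj open_Collect_less continuous_intros)
  show "inj_on \<Psi> {w. r\<^sub>i < norm w \<and> norm w < r\<^sub>e}"
    using inj by (rule inj_on_subset) (use radii in auto)
qed

lemma curve_in_closure:
  assumes "\<rho> \<in> {r\<^sub>i..r\<^sub>e}"
  shows "curve \<rho> \<theta> \<in> closure (conformal_annulus \<Psi> r\<^sub>i r\<^sub>e)"
proof -
  define f where "f t = curve t \<theta>" for t
  have n: "cmod (of_real t * cis \<theta>) = t" if "t \<in> {r\<^sub>i..r\<^sub>e}" for t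
    using that radii gamma_pos by (simp add: norm_mult)
  have cl: "closure {r\<^sub>i<..<r\<^sub>e} = {r\<^sub>i..r\<^sub>e}" using radii by simp
  have "continuous_on {r\<^sub>i..r\<^sub>e} f"
    unfolding f_def curve_def
    by (rule continuous_on_compose2[OF holomorphic_on_imp_continuous_on[OF holo]])
       (use n radii in \<open>auto intro!: continuous_intros\<close>)
  then have "f ` closure {r\<^sub>i<..<r\<^sub>e} \<subseteq> closure (conformal_annulus \<Psi> r\<^sub>i r\<^sub>e)"
    unfolding cl[symmetric]
  proof (rule image_closure_subset)
    have "f ` {r\<^sub>i<..<r\<^sub>e} \<subseteq> conformal_annulus \<Psi> r\<^sub>i r\<^sub>e"
      using n by (force simp: f_def curve_def conformal_annulus_def)
    then show "f ` {r\<^sub>i<..<r\<^sub>e} \<subseteq> closure (conformal_annulus \<Psi> r\<^sub>i r\<^sub>e)"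
      using closure_subset by blast
  qed simp
  then show ?thesis using assms unfolding cl f_def by auto
qed

text \<open>The image of the closed annulus is compact, hence contains the closure; conversely
  radial paths reach every point of the two curves, and injectivity keeps these curves outside the
  open image.\<close>

lemma frontier_annulus:
  "frontier (conformal_annulus \<Psi> r\<^sub>i r\<^sub>e) = level_curve r\<^sub>i \<union> level_curve r\<^sub>e"
proof -
  define C where "C = \<Psi> ` {w. r\<^sub>i \<le> norm w \<and> norm w \<le> r\<^sub>e}"
  have "closed {w::complex. r\<^sub>i \<le> norm w \<and> norm w \<le> r\<^sub>e}"
    by (intro closed_Collect_conj closed_Collect_le continuous_intros)
  moreover have "bounded {w::complex. r\<^sub>i \<le> norm w \<and> norm w \<le> r\<^sub>e}"
    by (rule bounded_subset[OF bounded_cball[of 0 r\<^sub>e]]) auto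
  ultimately have "compact {w::complex. r\<^sub>i \<le> norm w \<and> norm w \<le> r\<^sub>e}"
    by (simp add: compact_eq_bounded_closed)
  moreover have "continuous_on {w. r\<^sub>i \<le> norm w \<and> norm w \<le> r\<^sub>e} \<Psi>"
    using holomorphic_on_imp_continuous_on[OF holo] by (rule continuous_on_subset) (use radii in auto)
  ultimately have "closed C" unfolding C_def
    by (intro compact_imp_closed compact_continuous_image)
  then have "closure (conformal_annulus \<Psi> r\<^sub>i r\<^sub>e) \<subseteq> C"
    by (intro closure_minimal) (auto simp: C_def conformal_annulus_def)
  then have "frontier (conformal_annulus \<Psi> r\<^sub>i r\<^sub>e) \<subseteq> C - conformal_annulus \<Psi> r\<^sub>i r\<^sub>e"
    unfolding frontier_def interior_open[OF annulus_open] by auto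
  also have "\<dots> \<subseteq> level_curve r\<^sub>i \<union> level_curve r\<^sub>e"
    unfolding C_def conformal_annulus_def level_curve_def by (auto simp: image_iff not_less) force
  finally have 1: "frontier (conformal_annulus \<Psi> r\<^sub>i r\<^sub>e) \<subseteq> level_curve r\<^sub>i \<union> level_curve r\<^sub>e" .
  have "y \<in> frontier (conformal_annulus \<Psi> r\<^sub>i r\<^sub>e)" if y: "y \<in> level_curve \<rho>" and \<rho>': "\<rho> = r\<^sub>i \<or> \<rho> = r\<^sub>e" for y \<rho>
  proof -
    have \<rho>: "\<gamma> < \<rho>" "\<rho> \<in> {r\<^sub>i..r\<^sub>e}" using \<rho>' radii by auto
    obtain \<theta> where "y = curve \<rho> \<theta>" using level_curveE[OF \<rho>(1) y] by blast
    then have "y \<in> closure (conformal_annulus \<Psi> r\<^sub>i r\<^sub>e)" using curve_in_closure[OF \<rho>(2)] by simp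
    moreover have "y \<notin> conformal_annulus \<Psi> r\<^sub>i r\<^sub>e"
    proof
      assume "y \<in> conformal_annulus \<Psi> r\<^sub>i r\<^sub>e"
      then obtain w where w: "y = \<Psi> w" "r\<^sub>i < norm w" "norm w < r\<^sub>e" by (auto simp: conformal_annulus_def)
      obtain w' where w': "y = \<Psi> w'" "norm w' = \<rho>" using y by (auto simp: level_curve_def)
      have "w = w'" by (rule inj_onD[OF inj]) (use w w' \<rho> radii in auto)
      then show False using w w' \<rho>' by auto
    qed
    ultimately show ?thesis unfolding frontier_def interior_open[OF annulus_open] by blast
  qed
  then show ?thesis using 1 by blast
qed

text \<open>
  Near the boundary the annulus is described by the function \<open>g = \<bar>\<Phi>\<bar>\<^sup>2\<close> with \<open>\<Phi>\<close> the inverse of \<open>\<Psi>\<close>, whose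
  differential is a positive multiple of the inner product with \<open>w \<Psi>'(w)\<close>.
\<close>

lemma outward_normal_curve:
  assumes \<rho>s: "(\<rho> = r\<^sub>i \<and> s = -1) \<or> (\<rho> = r\<^sub>e \<and> s = (1::real))"
  shows "outward_normal (conformal_annulus \<Psi> r\<^sub>i r\<^sub>e) (curve \<rho> \<theta>)
    = of_real s * sgn (of_real \<rho> * cis \<theta> * deriv \<Psi> (of_real \<rho> * cis \<theta>))"
proof -
  define w where "w = of_real \<rho> * cis \<theta>"
  define A where "A = conformal_annulus \<Psi> r\<^sub>i r\<^sub>e"
  define x where "x = curve \<rho> \<theta>"
  define d where "d = w * deriv \<Psi> w"
  define X where "X = {w::complex. \<gamma> < norm w}"
  have \<rho>: "\<gamma> < \<rho>" "\<rho> > 0" using \<rho>s radii gamma_pos by auto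
  have s: "s = 1 \<or> s = -1" using \<rho>s by auto
  have nw: "cmod w = \<rho>" unfolding w_def using norm_rho_cis \<rho> by simp
  have wX: "w \<in> X" using nw \<rho> by (simp add: X_def)
  have x: "x = \<Psi> w" by (simp add: x_def curve_def w_def)
  have p: "deriv \<Psi> w \<noteq> 0" using Psi_deriv_nz nw \<rho> by simp
  have d: "d \<noteq> 0" using p nw \<rho> by (auto simp: d_def)
  obtain \<Phi> where \<Phi>: "\<Phi> holomorphic_on \<Psi> ` X" "\<And>z. z \<in> X \<Longrightarrow> deriv \<Psi> z * deriv \<Phi> (\<Psi> z) = 1"
      "\<And>z. z \<in> X \<Longrightarrow> \<Phi> (\<Psi> z) = z"
    using holomorphic_has_inverse[of \<Psi> X] holo open_exterior inj unfolding X_def by blast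
  have oX: "open (\<Psi> ` X)"
    using open_mapping_thm3[of \<Psi> X] holo open_exterior inj unfolding X_def by blast
  have xX: "x \<in> \<Psi> ` X" using wX x by auto
  define g where "g y = (cmod (\<Phi> y))\<^sup>2" for y
  \<comment> \<open>The gradient of \<open>g\<close> at \<open>x\<close> is
    \<open>2 * w / cnj (deriv \<Psi> w)\<close>, that is
    \<open>2 * d / (cmod (deriv \<Psi> w))\<^sup>2\<close>; \<open>c\<close> is its length and
    \<open>sgn d\<close> its direction.\<close>
  define c where "c = 2 * cmod d / (cmod (deriv \<Psi> w))\<^sup>2"
  have c: "c > 0" using d p by (simp add: c_def)
  define L where "L v = c * inner v (sgn d)" for v
  have gx: "g x = \<rho>\<^sup>2" using \<Phi>(3)[OF wX] by (simp add: g_def x nw)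
  have gder: "(g has_derivative L) (at x)"
  proof -
    have "(\<Phi> has_field_derivative deriv \<Phi> x) (at x)"
      using \<Phi>(1) oX xX by (rule holomorphic_derivI)
    moreover have "deriv \<Phi> x = 1 / deriv \<Psi> w" using \<Phi>(2)[OF wX] p x by (simp add: field_simps)
    moreover have "(*) (1 / deriv \<Psi> w) = (\<lambda>v. v / deriv \<Psi> w)" by (simp add: fun_eq_iff)
    ultimately have "(\<Phi> has_derivative (\<lambda>v. v / deriv \<Psi> w)) (at x)"
      unfolding has_field_derivative_def by simp
    then have "((\<lambda>y. inner (\<Phi> y) (\<Phi> y)) has_derivative
        (\<lambda>v. inner (\<Phi> x) (v / deriv \<Psi> w) + inner (v / deriv \<Psi> w) (\<Phi> x))) (at x)"
      by (rule has_derivative_inner[rotated]) fact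
    moreover have "(\<lambda>v. inner (\<Phi> x) (v / deriv \<Psi> w) + inner (v / deriv \<Psi> w) (\<Phi> x)) = L"
    proof
      fix v
      have "inner w (v / q) = inner v (w * q) / (cmod q)\<^sup>2" if "q \<noteq> 0" for q
      proof -
        have "inner w (v / q) = Re (v * cnj w / q)" 
          by (simp add: inner_complex_def Re_divide Im_divide add_divide_distrib diff_divide_distrib algebra_simps)
        also have "v * cnj w / q = v * cnj (w * q) / of_real ((cmod q)\<^sup>2)"
          using that by (simp add: complex_norm_square[symmetric] field_simps del: of_real_power)
        also have "Re \<dots> = inner v (w * q) / (cmod q)\<^sup>2"
          by (simp only: Re_divide_of_real) (simp add: inner_complex_def algebra_simps)
        finally show ?thesis .
      qed
      from this[OF p] have "inner w (v / deriv \<Psi> w) = inner v d / (cmod (deriv \<Psi> w))\<^sup>2"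
        by (simp add: d_def)
      moreover have "inner v d = cmod d * inner v (sgn d)"
        using d by (simp add: sgn_div_norm)
      ultimately show "inner (\<Phi> x) (v / deriv \<Psi> w) + inner (v / deriv \<Psi> w) (\<Phi> x) = L v"
        using \<Phi>(3)[OF wX] x by (simp add: L_def c_def inner_commute)
    qed
    ultimately show ?thesis by (simp add: g_def[abs_def] power2_norm_eq_inner)
  qed
  have sq: "p < q \<longleftrightarrow> p\<^sup>2 < q\<^sup>2" if "0 \<le> p" "0 \<le> q" for p q :: real
    using that power2_less_imp_less[of p q] power_strict_mono[of p q 2] by auto
  have in_A: "y \<in> A \<longleftrightarrow> r\<^sub>i\<^sup>2 < g y \<and> g y < r\<^sub>e\<^sup>2" if y: "y \<in> \<Psi> ` X" for y
  proof -
    obtain z where z: "z \<in> X" "y = \<Psi> z" using y by auto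
    have "y \<in> A \<longleftrightarrow> r\<^sub>i < norm z \<and> norm z < r\<^sub>e"
    proof
      assume "y \<in> A"
      then obtain z' where z': "r\<^sub>i < norm z'" "norm z' < r\<^sub>e" "y = \<Psi> z'"
        by (auto simp: A_def conformal_annulus_def)
      have "z' = z" by (rule inj_onD[OF inj]) (use z z' radii in \<open>auto simp: X_def\<close>)
      then show "r\<^sub>i < norm z \<and> norm z < r\<^sub>e" using z' by simp
    qed (use z in \<open>auto simp: A_def conformal_annulus_def\<close>)
    also have "\<dots> \<longleftrightarrow> r\<^sub>i\<^sup>2 < (norm z)\<^sup>2 \<and> (norm z)\<^sup>2 < r\<^sub>e\<^sup>2"
      using sq[of "r\<^sub>i" "norm z"] sq[of "norm z" "r\<^sub>e"] radii gamma_pos by simp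
    also have "(norm z)\<^sup>2 = g y" using \<Phi>(3)[OF z(1)] z by (simp add: g_def)
    finally show ?thesis .
  qed
  have ray: "((\<lambda>t. (g (x + t *\<^sub>R \<nu>) - \<rho>\<^sup>2) / t) \<longlongrightarrow> L \<nu>) (at_right 0)" for \<nu>
  proof -
    have "((\<lambda>t. x + t *\<^sub>R \<nu>) has_derivative (\<lambda>t. t *\<^sub>R \<nu>)) (at 0)"
      by (auto intro!: derivative_eq_intros)
    then have "((\<lambda>t. g (x + t *\<^sub>R \<nu>)) has_derivative (\<lambda>t. L (t *\<^sub>R \<nu>))) (at 0)"
      by (rule has_derivative_compose) (use gder in simp)
    moreover have "(\<lambda>t. L (t *\<^sub>R \<nu>)) = (*) (L \<nu>)" by (simp add: fun_eq_iff L_def)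
    ultimately have "((\<lambda>t. g (x + t *\<^sub>R \<nu>)) has_field_derivative L \<nu>) (at 0)"
      unfolding has_field_derivative_def by simp
    then have "((\<lambda>t. (g (x + t *\<^sub>R \<nu>) - g x) / t) \<longlongrightarrow> L \<nu>) (at 0)"
      by (simp add: DERIV_def)
    then show ?thesis unfolding gx by (rule filterlim_mono) (auto simp: at_le)
  qed
  have ray_X: "\<forall>\<^sub>F t in at_right 0. x + t *\<^sub>R \<nu> \<in> \<Psi> ` X" for \<nu>
  proof -
    have "((\<lambda>t. x + t *\<^sub>R \<nu>) \<longlongrightarrow> x + 0 *\<^sub>R \<nu>) (at_right 0)" by (intro tendsto_intros)
    then show ?thesis using topological_tendstoD[OF _ oX] xX by fastforce
  qed
  have L_sgn: "L (of_real a * sgn d) = c * a" for a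
    using d by (simp add: L_def norm_sgn flip: scaleR_conv_of_real power2_norm_eq_inner)
  have out: "\<forall>\<^sub>F t in at_right 0. x + t *\<^sub>R (of_real s * sgn d) \<notin> A"
  proof -
    have "((\<lambda>t. s * ((g (x + t *\<^sub>R (of_real s * sgn d)) - \<rho>\<^sup>2) / t)) \<longlongrightarrow> s * (c * s)) (at_right 0)"
      using ray[of "of_real s * sgn d"] unfolding L_sgn by (intro tendsto_intros)
    moreover have "s * (c * s) > 0" using s c by auto
    ultimately have "\<forall>\<^sub>F t in at_right 0. s * ((g (x + t *\<^sub>R (of_real s * sgn d)) - \<rho>\<^sup>2) / t) > 0"
      by (rule order_tendstoD(1))
    then show ?thesis using ray_X[of "of_real s * sgn d"] eventually_at_right_less[of 0]
    proof eventually_elim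
      case (elim t)
      then show ?case using in_A[OF elim(2)] \<rho>s by (auto simp: zero_less_divide_iff divide_less_0_iff)
    qed
  qed
  \<comment> \<open>The opposite unit vector is excluded since its ray enters the annulus: the sign
    of the derivative settles the inequality at the radius \<rho> itself (\<open>e1\<close>),
    continuity the one at the other radius (\<open>e2\<close>).\<close>
  have inward: "\<not> (\<forall>\<^sub>F t in at_right 0. x + t *\<^sub>R (of_real (-s) * sgn d) \<notin> A)"
  proof
    assume ev: "\<forall>\<^sub>F t in at_right 0. x + t *\<^sub>R (of_real (-s) * sgn d) \<notin> A"
    define f where "f t = g (x + t *\<^sub>R (of_real (-s) * sgn d))" for t
    have "((\<lambda>t. s * ((f t - \<rho>\<^sup>2) / t)) \<longlongrightarrow> s * (c * - s)) (at_right 0)"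
      unfolding f_def using ray[of "of_real (-s) * sgn d"] unfolding L_sgn by (intro tendsto_intros)
    moreover have "s * (c * - s) < 0" using s c by auto
    ultimately have e1: "\<forall>\<^sub>F t in at_right 0. s * ((f t - \<rho>\<^sup>2) / t) < 0"
      by (rule order_tendstoD(2))
    have "isCont g x" using has_derivative_continuous[OF gder] by simp
    moreover have "((\<lambda>t. x + t *\<^sub>R (of_real (-s) * sgn d)) \<longlongrightarrow> x + 0 *\<^sub>R (of_real (-s) * sgn d)) (at_right 0)"
      by (intro tendsto_intros)
    ultimately have "(f \<longlongrightarrow> \<rho>\<^sup>2) (at_right 0)"
      unfolding f_def gx[symmetric] by (intro isCont_tendsto_compose[of x g]) auto
    moreover have "\<rho>\<^sup>2 < r\<^sub>e\<^sup>2 \<or> s = 1" "r\<^sub>i\<^sup>2 < \<rho>\<^sup>2 \<or> s = -1"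
      using \<rho>s sq[of \<rho> "r\<^sub>e"] sq[of "r\<^sub>i" \<rho>] radii gamma_pos by auto
    ultimately have e2: "\<forall>\<^sub>F t in at_right 0. (f t < r\<^sub>e\<^sup>2 \<or> s = 1) \<and> (r\<^sub>i\<^sup>2 < f t \<or> s = -1)"
      by (auto intro!: eventually_conj order_tendstoD elim: eventually_mono)
    have "\<forall>\<^sub>F t in at_right (0::real). False"
      using ev e1 e2 ray_X[of "of_real (-s) * sgn d"] eventually_at_right_less[of 0]
    proof eventually_elim
      case (elim t)
      then show ?case using in_A[OF elim(4)] \<rho>s unfolding f_def
        by (auto simp: zero_less_divide_iff divide_less_0_iff)
    qed
    then show False by simp
  qed
  have fr: "frontier A = level_curve r\<^sub>i \<union> level_curve r\<^sub>e"
    unfolding A_def by (rule frontier_annulus)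
  \<comment> \<open>The other boundary curve is closed and misses \<open>x\<close>, so near
    \<open>x\<close> the frontier is a piece of the level set of \<open>g\<close> through
    \<open>x\<close>.\<close>
  have near: "\<forall>\<^sub>F y in at x within frontier A. g y = \<rho>\<^sup>2"
  proof -
    have "closed (level_curve r\<^sub>i)" "closed (level_curve r\<^sub>e)"
      using radii by (auto intro!: compact_imp_closed compact_level_curve)
    moreover have "x \<notin> level_curve \<rho>'" if "\<rho>' \<noteq> \<rho>" "\<rho>' = r\<^sub>i \<or> \<rho>' = r\<^sub>e" for \<rho>'
      unfolding x_def using that radii \<rho> by (intro level_curve_disjoint[of \<rho>] curve_in_level_curve) auto
    ultimately have "\<exists>U. open U \<and> x \<in> U \<and> (\<forall>y\<in>U. y \<in> frontier A \<longrightarrow> y \<in> level_curve \<rho>)"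
    proof -
      define \<rho>' where "\<rho>' = (if \<rho> = r\<^sub>i then r\<^sub>e else r\<^sub>i)"
      have "\<rho>' \<noteq> \<rho>" "\<rho>' = r\<^sub>i \<or> \<rho>' = r\<^sub>e" using radii \<rho>s by (auto simp: \<rho>'_def)
      then have "x \<in> - level_curve \<rho>'" "closed (level_curve \<rho>')"
        using \<open>\<And>\<rho>'. \<lbrakk>\<rho>' \<noteq> \<rho>; \<rho>' = r\<^sub>i \<or> \<rho>' = r\<^sub>e\<rbrakk> \<Longrightarrow> x \<notin> level_curve \<rho>'\<close>
          \<open>closed (level_curve r\<^sub>i)\<close> \<open>closed (level_curve r\<^sub>e)\<close> by auto
      then show ?thesis
        using \<rho>s by (intro exI[of _ "- level_curve \<rho>'"]) (auto simp: fr \<rho>'_def split: if_splits)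
    qed
    then obtain U where U: "open U" "x \<in> U" "\<And>y. y \<in> U \<Longrightarrow> y \<in> frontier A \<Longrightarrow> y \<in> level_curve \<rho>"
      by blast
    have "g y = \<rho>\<^sup>2" if "y \<in> level_curve \<rho>" for y
    proof -
      obtain z where "y = \<Psi> z" "norm z = \<rho>" using \<open>y \<in> level_curve \<rho>\<close> by (auto simp: level_curve_def)
      then show ?thesis using \<Phi>(3)[of z] \<rho> by (simp add: g_def X_def)
    qed
    then show ?thesis
      unfolding eventually_at_topological using U by blast
  qed
  have tangent: "((\<lambda>y. inner (y - x) (of_real s * sgn d) / norm (y - x)) \<longlongrightarrow> 0) (at x within frontier A)"
  proof -
    have "((\<lambda>y. (g y - g x - L (y - x)) /\<^sub>R norm (y - x)) \<longlongrightarrow> 0) (at x within frontier A)"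
      using has_derivative_at_withinI[OF gder] unfolding has_derivative_at_within by blast
    then have "((\<lambda>y. (- s / c) * ((g y - g x - L (y - x)) /\<^sub>R norm (y - x))) \<longlongrightarrow> (- s / c) * 0) (at x within frontier A)"
      by (rule tendsto_mult_left)
    moreover have "\<forall>\<^sub>F y in at x within frontier A. (- s / c) * ((g y - g x - L (y - x)) /\<^sub>R norm (y - x))
        = inner (y - x) (of_real s * sgn d) / norm (y - x)"
      using near
    proof eventually_elim
      case (elim y)
      then show ?case using c by (simp add: gx L_def divide_inverse flip: scaleR_conv_of_real)
    qed
    ultimately show ?thesis by (simp add: tendsto_cong)
  qed
  have unique: "\<nu> = of_real s * sgn d"
    if \<nu>: "norm \<nu> = 1" "((\<lambda>y. inner (y - x) \<nu> / norm (y - x)) \<longlongrightarrow> 0) (at x within frontier A)"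
      "\<forall>\<^sub>F t in at_right 0. x + t *\<^sub>R \<nu> \<notin> A" for \<nu>
  proof -
    define q where "q t = (curve \<rho> (\<theta> + t) - x) /\<^sub>R t" for t
    have cd: "(curve \<rho> has_vector_derivative \<i> * d) (at \<theta>)"
      using curve_deriv[OF \<rho>(1), of \<theta>] by (simp add: d_def w_def mult_ac)
    then have "((\<lambda>t. norm (curve \<rho> (\<theta> + t) - curve \<rho> \<theta> - t *\<^sub>R (\<i> * d)) / norm t) \<longlongrightarrow> 0) (at 0)"
      unfolding has_vector_derivative_def has_derivative_at by simp
    then have "((\<lambda>t. norm (curve \<rho> (\<theta> + t) - curve \<rho> \<theta> - t *\<^sub>R (\<i> * d)) / norm t) \<longlongrightarrow> 0) (at_right 0)"
      by (rule filterlim_mono) (auto simp: at_le)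
    moreover have "\<forall>\<^sub>F t in at_right 0. norm (curve \<rho> (\<theta> + t) - curve \<rho> \<theta> - t *\<^sub>R (\<i> * d)) / norm t = norm (q t - \<i> * d)"
      using eventually_at_right_less[of 0]
    proof eventually_elim
      case (elim t)
      have "q t - \<i> * d = (curve \<rho> (\<theta> + t) - curve \<rho> \<theta> - t *\<^sub>R (\<i> * d)) /\<^sub>R t"
        unfolding q_def x_def using elim by (simp add: scaleR_right_diff_distrib)
      then show ?case using elim by (simp add: divide_inverse)
    qed
    ultimately have "((\<lambda>t. norm (q t - \<i> * d)) \<longlongrightarrow> 0) (at_right 0)"
      by (simp add: tendsto_cong)
    then have q: "(q \<longlongrightarrow> \<i> * d) (at_right 0)"
      by (rule LIM_zero_cancel[OF tendsto_norm_zero_cancel])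
    then have ne: "\<forall>\<^sub>F t in at_right 0. q t \<noteq> 0"
      by (rule tendsto_imp_eventually_ne) (use d in auto)
    have "filterlim (\<lambda>t. curve \<rho> (\<theta> + t)) (at x within frontier A) (at_right 0)"
      unfolding filterlim_at
    proof
      have "isCont (curve \<rho>) \<theta>" using has_vector_derivative_continuous[OF cd] .
      moreover have "((\<lambda>t. \<theta> + t) \<longlongrightarrow> \<theta>) (at_right 0)"
        by (auto intro!: tendsto_eq_intros)
      ultimately show "((\<lambda>t. curve \<rho> (\<theta> + t)) \<longlongrightarrow> x) (at_right 0)"
        unfolding x_def by (rule isCont_tendsto_compose)
      show "\<forall>\<^sub>F t in at_right 0. curve \<rho> (\<theta> + t) \<in> frontier A \<and> curve \<rho> (\<theta> + t) \<noteq> x"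
        using ne by eventually_elim
          (use curve_in_level_curve[OF \<rho>(1)] \<rho>s in \<open>auto simp: fr q_def\<close>)
    qed
    from filterlim_compose[OF \<nu>(2) this]
    have "((\<lambda>t. inner (curve \<rho> (\<theta> + t) - x) \<nu> / norm (curve \<rho> (\<theta> + t) - x)) \<longlongrightarrow> 0) (at_right 0)" .
    moreover have "\<forall>\<^sub>F t in at_right 0. inner (curve \<rho> (\<theta> + t) - x) \<nu> / norm (curve \<rho> (\<theta> + t) - x) = inner (q t) \<nu> / norm (q t)"
      using eventually_at_right_less[of 0] by eventually_elim (simp add: q_def)
    ultimately have "((\<lambda>t. inner (q t) \<nu> / norm (q t)) \<longlongrightarrow> 0) (at_right 0)"
      by (simp add: tendsto_cong)
    moreover have "((\<lambda>t. inner (q t) \<nu> / norm (q t)) \<longlongrightarrow> inner (\<i> * d) \<nu> / norm (\<i> * d)) (at_right 0)"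
      using d by (intro tendsto_intros q) auto
    ultimately have "inner (\<i> * d) \<nu> / norm (\<i> * d) = 0"
      by (intro tendsto_unique[OF trivial_limit_at_right_real])
    then have "inner (\<i> * d) \<nu> = 0" using d by simp
    \<comment> \<open>The direction is rotated so that \<open>sgn d\<close> becomes 1. Difference
      quotients along the curve show that it is orthogonal to the tangent \<open>\<i> * d\<close>,
      so \<open>u\<close> is real, and being a unit it is 1 or -1.\<close>
    define u where "u = cnj (sgn d) * \<nu>"
    have nu: "norm u = 1" using \<nu>(1) d by (simp add: u_def norm_mult norm_sgn)
    have "Im u = inner (\<i> * d) \<nu> / norm d"
      using d by (simp add: u_def sgn_div_norm inner_complex_def field_simps)
    then have "Im u = 0" using \<open>inner (\<i> * d) \<nu> = 0\<close> by simp
    then have "u = 1 \<or> u = -1" using nu by (auto simp: complex_eq_iff cmod_def abs_if split: if_splits)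
    moreover have "\<nu> = u * sgn d"
    proof -
      have "sgn d * cnj (sgn d) = 1" using d by (simp add: complex_norm_square[symmetric] norm_sgn)
      then show ?thesis unfolding u_def by (metis mult.commute mult.left_commute mult.right_neutral)
    qed
    ultimately have "\<nu> = of_real s * sgn d \<or> \<nu> = of_real (-s) * sgn d" using s by auto
    then show ?thesis using inward \<nu>(3) by blast
  qed
  show ?thesis
    unfolding outward_normal_def A_def[symmetric] x_def[symmetric] w_def[symmetric] d_def[symmetric]
    using unique tangent out s d by (intro the_equality) (auto simp: norm_mult norm_sgn)
qed

end

end

section \<open>The kernel as a double trigonometric series\<close>

lemma has_sum_transport:
  assumes "(g has_sum s) UNIV" "inj j" "\<And>x. f (j x) = g x" "\<And>y. y \<notin> range j \<Longrightarrow> f y = 0"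
  shows "(f has_sum s) UNIV"
proof -
  have "((f \<circ> j) has_sum s) UNIV" using assms(1,3) by (simp add: o_def)
  then have "(f has_sum s) (range j)" using has_sum_reindex[OF assms(2)] by blast
  then show ?thesis by (rule has_sum_cong_neutral[THEN iffD1, rotated -1]) (use assms(4) in auto)
qed

lemma summable_on_transport:
  assumes "g summable_on UNIV" "inj j" "\<And>x. f (j x) = g x" "\<And>y. y \<notin> range j \<Longrightarrow> f y = 0"
  shows "f summable_on UNIV"
  using assms has_sum_transport unfolding summable_on_def by metis

lemma not_in_range_int: "y \<notin> range int \<Longrightarrow> y < 0" "y \<notin> range (\<lambda>n. - int n) \<Longrightarrow> y > 0"
proof -
  show "y \<notin> range int \<Longrightarrow> y < 0"
    by (metis linorder_not_less nonneg_int_cases rangeI)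
  show "y \<notin> range (\<lambda>n. - int n) \<Longrightarrow> y > 0"
    by (metis linorder_not_less nonpos_int_cases rangeI)
qed

definition int_power :: "real \<Rightarrow> int \<Rightarrow> real" where
  "int_power x n = x ^ nat \<bar>n\<bar>"

lemma geometric_has_sum:
  fixes z :: "'a::{real_normed_field, banach}"
  assumes "norm z < 1"
  shows "((\<lambda>n. z ^ n) has_sum (1 / (1 - z))) UNIV"
  by (rule norm_summable_imp_has_sum[OF _ geometric_sums[OF assms]])
     (use assms in \<open>simp add: norm_power summable_geometric\<close>)

text \<open>Two geometric series, over the nonnegative and over the nonpositive integers, minus the
  term 0 counted twice.\<close>

lemma int_power_has_sum:
  assumes "0 \<le> x" "x < 1"
  shows "((\<lambda>n. int_power x n) has_sum (2 * (1 / (1 - x)) - 1)) UNIV"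
    "(\<lambda>n. int_power x n) summable_on UNIV"
proof -
  have g: "((\<lambda>n. x ^ n) has_sum (1 / (1 - x))) UNIV" by (rule geometric_has_sum) (use assms in simp)
  have 1: "((\<lambda>n. if n \<ge> 0 then int_power x n else 0) has_sum (1 / (1 - x))) UNIV"
    by (rule has_sum_transport[where j=int, OF g])
       (auto simp: int_power_def dest: not_in_range_int)
  have 2: "((\<lambda>n. if n \<le> 0 then int_power x n else 0) has_sum (1 / (1 - x))) UNIV"
    by (rule has_sum_transport[where j="\<lambda>n. - int n", OF g])
       (auto simp: int_power_def inj_def dest: not_in_range_int)
  have 3: "((\<lambda>n::int. if n = 0 then - 1 else 0) has_sum (- 1::real)) UNIV"
    using has_sum_finite_neutralI[of "{0}" UNIV "\<lambda>n::int. if n = 0 then - 1 else 0" "- 1::real"] by simp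
  have "(\<lambda>n. (if n \<ge> 0 then int_power x n else 0) + (if n \<le> 0 then int_power x n else 0) + (if n = 0 then - 1 else 0))
     = int_power x" by (auto simp: int_power_def)
  with has_sum_add[OF has_sum_add[OF 1 2] 3]
  show "((\<lambda>n. int_power x n) has_sum (2 * (1 / (1 - x)) - 1)) UNIV" by simp
  then show "(\<lambda>n. int_power x n) summable_on UNIV" by (rule has_sum_imp_summable)
qed

text \<open>The Poisson kernel: a geometric series and its conjugate, minus the term 0 counted
  twice.\<close>

lemma poisson_has_sum:
  assumes "0 \<le> r" "r < 1"
  shows "((\<lambda>n. of_real (int_power r n) * cis (of_int n * x)) has_sum
     of_real (2 * Re (1 / (1 - of_real r * cis x)) - 1)) UNIV"
proof -
  define z where "z = of_real r * cis x"
  have z: "cmod z < 1" using assms by (simp add: z_def norm_mult)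
  define f where "f n = of_real (int_power r n) * cis (of_int n * x)" for n
  have zp: "z ^ n = of_real (r ^ n) * cis (real n * x)" for n
    unfolding z_def by (simp only: power_mult_distrib Complex.DeMoivre of_real_power)
  have g: "((\<lambda>n. z ^ n) has_sum (1 / (1 - z))) UNIV" by (rule geometric_has_sum[OF z])
  then have g': "((\<lambda>n. cnj (z ^ n)) has_sum cnj (1 / (1 - z))) UNIV" by (simp only: has_sum_cnj_iff)
  have 1: "((\<lambda>n. if n \<ge> 0 then f n else 0) has_sum (1 / (1 - z))) UNIV"
    by (rule has_sum_transport[where j=int, OF g])
       (auto simp: int_power_def f_def zp dest: not_in_range_int)
  have 2: "((\<lambda>n. if n \<le> 0 then f n else 0) has_sum cnj (1 / (1 - z))) UNIV"
    by (rule has_sum_transport[where j="\<lambda>n. - int n", OF g'])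
       (auto simp: int_power_def inj_def f_def zp cis_cnj dest: not_in_range_int)
  have 3: "((\<lambda>n::int. if n = 0 then - 1 else 0) has_sum (- 1::complex)) UNIV"
    using has_sum_finite_neutralI[of "{0}" UNIV "\<lambda>n::int. if n = 0 then - 1 else 0" "- 1::complex"] by simp
  have "(\<lambda>n. (if n \<ge> 0 then f n else 0) + (if n \<le> 0 then f n else 0) + (if n = 0 then - 1 else 0)) = f"
    by (auto simp: int_power_def f_def)
  with has_sum_add[OF has_sum_add[OF 1 2] 3]
  have "(f has_sum (1 / (1 - z) + cnj (1 / (1 - z)) - 1)) UNIV" by simp
  also have "1 / (1 - z) + cnj (1 / (1 - z)) - 1 = of_real (2 * Re (1 / (1 - z)) - 1)"
    unfolding complex_add_cnj by simp
  finally show ?thesis unfolding f_def z_def .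
qed

lemma summable_matrix_apply:
  fixes M :: "'i \<Rightarrow> 'k \<Rightarrow> complex"
  assumes M: "(\<lambda>(m, n). cmod (M m n)) summable_on UNIV" and a: "\<And>n. cmod (a n) \<le> C"
  shows "(\<lambda>(m, n). cmod (M m n * a n)) summable_on UNIV"
    "\<And>m. (\<lambda>n. M m n * a n) summable_on UNIV"
    "(\<lambda>m. cmod (\<Sum>\<^sub>\<infinity>n. M m n * a n)) summable_on UNIV"
proof -
  have Ma: "(\<lambda>(m, n). cmod (M m n * a n)) summable_on UNIV \<times> UNIV"
  proof -
    have "(\<lambda>x. (case x of (m, n) \<Rightarrow> cmod (M m n)) * C) summable_on UNIV"
      by (rule summable_on_cmult_left[OF M])
    then show ?thesis
      unfolding UNIV_Times_UNIV
      by (rule summable_on_comparison_test) (auto simp: norm_mult intro: mult_left_mono a)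
  qed
  then show "(\<lambda>(m, n). cmod (M m n * a n)) summable_on UNIV" by simp
  have row: "(\<lambda>n. cmod (M m n * a n)) summable_on UNIV" for m
    using summable_on_SigmaD1[OF Ma, of m] by simp
  show rows: "(\<lambda>n. M m n * a n) summable_on UNIV" for m
    by (rule abs_summable_summable[OF row])
  have rs: "(\<lambda>m. \<Sum>\<^sub>\<infinity>n. cmod (M m n * a n)) summable_on UNIV"
    using summable_on_SigmaD[OF Ma] row by simp
  show "(\<lambda>m. cmod (\<Sum>\<^sub>\<infinity>n. M m n * a n)) summable_on UNIV"
    by (rule summable_on_comparison_test[OF rs]) (use norm_infsum_bound[OF row] in auto)
qed

text \<open>Summing over \<open>m\<close> first gives, for fixed \<theta>, a kernel in \<phi> alone,
  to which the one-variable result applies. Absolute summability of \<open>M\<close> then allows the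
  sums to be exchanged, and the integral becomes a series in \<theta>.\<close>

lemma double_kernel_against_series:
  fixes M :: "int \<Rightarrow> int \<Rightarrow> complex"
  assumes M: "(\<lambda>(m, n). cmod (M m n)) summable_on UNIV"
    and \<kappa>: "AE \<phi> in circle_measure.
        ((\<lambda>(m, n). M m n * cis (of_int m * \<theta>) * cis (- of_int n * \<phi>)) has_sum \<kappa> \<phi>) UNIV"
    and m: "\<kappa> \<in> borel_measurable circle_measure"
    and f: "f \<in> borel_measurable circle_measure" "L2_series f a"
    and a: "\<And>n. cmod (a n) \<le> C"
  shows "((\<lambda>m. (\<Sum>\<^sub>\<infinity>n. M m n * a n) * cis (of_int m * \<theta>)) has_sum
      (1 / of_real (2 * pi) * (\<integral>\<phi>. \<kappa> \<phi> * f \<phi> \<partial>circle_measure))) UNIV"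
    "(\<lambda>m. cmod (\<Sum>\<^sub>\<infinity>n. M m n * a n)) summable_on UNIV"
    "\<And>m. (\<lambda>n. M m n * a n) summable_on UNIV"
    "integrable circle_measure (\<lambda>\<phi>. \<kappa> \<phi> * f \<phi>)"
proof -
  have swap: "(\<lambda>(n, m). cmod (M m n)) summable_on UNIV \<times> UNIV"
    using M summable_on_swap[of "\<lambda>(m, n). cmod (M m n)" UNIV UNIV] by (simp add: case_prod_unfold o_def)
  have col: "(\<lambda>m. cmod (M m n)) summable_on UNIV" for n
    using summable_on_SigmaD1[OF swap, of n] by simp
  define k where "k n = (\<Sum>\<^sub>\<infinity>m. M m n * cis (of_int m * \<theta>))" for n
  have kcol: "((\<lambda>m. M m n * cis (of_int m * \<theta>)) has_sum k n) UNIV" for n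
  proof -
    have "(\<lambda>m. cmod (M m n * cis (of_int m * \<theta>))) summable_on UNIV" using col by (simp add: norm_mult)
    from has_sum_infsum[OF abs_summable_summable[OF this]] show ?thesis by (simp add: k_def)
  qed
  have kb: "cmod (k n) \<le> (\<Sum>\<^sub>\<infinity>m. cmod (M m n))" for n
    by (rule has_sum_norm_le[OF kcol has_sum_infsum[OF col]]) (simp add: norm_mult)
  have cs: "(\<lambda>n. \<Sum>\<^sub>\<infinity>m. cmod (M m n)) summable_on UNIV"
    using summable_on_SigmaD[OF swap] col by simp
  have ks: "(\<lambda>n. cmod (k n)) summable_on UNIV"
    by (rule summable_on_comparison_test[OF cs]) (use kb in auto)
  have \<kappa>': "AE \<phi> in circle_measure. ((\<lambda>n. k n * cis (- of_int n * \<phi>)) has_sum \<kappa> \<phi>) UNIV"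
    using \<kappa>
  proof eventually_elim
    case (elim \<phi>)
    have "((\<lambda>(n, m). M m n * cis (of_int m * \<theta>) * cis (- of_int n * \<phi>)) has_sum \<kappa> \<phi>) (UNIV \<times> UNIV)"
      using elim has_sum_swap[of "\<lambda>(m, n). M m n * cis (of_int m * \<theta>) * cis (- of_int n * \<phi>)" UNIV UNIV]
      by (simp add: case_prod_unfold o_def)
    then show ?case
      by (rule has_sum_SigmaD) (use has_sum_cmult_left[OF kcol] in auto)
  qed
  note ker = kernel_against_series[OF ks \<kappa>' m f a]
  show "integrable circle_measure (\<lambda>\<phi>. \<kappa> \<phi> * f \<phi>)" by (rule ker(3))
  have val: "1 / of_real (2 * pi) * (\<integral>\<phi>. \<kappa> \<phi> * f \<phi> \<partial>circle_measure) = (\<Sum>\<^sub>\<infinity>n. k n * a n)"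
    unfolding ker(1) by simp
  note app = summable_matrix_apply[OF M a]
  note rows = app(2)
  show "(\<lambda>m. cmod (\<Sum>\<^sub>\<infinity>n. M m n * a n)) summable_on UNIV" "(\<lambda>n. M m n * a n) summable_on UNIV" for m
    by (rule app)+
  define G where "G = (\<lambda>(m, n). M m n * a n * cis (of_int m * \<theta>))"
  have "(\<lambda>x. cmod (G x)) summable_on UNIV \<times> UNIV"
    using app(1) by (simp add: G_def norm_mult case_prod_unfold)
  from abs_summable_summable[OF this] obtain S where S: "(G has_sum S) (UNIV \<times> UNIV)"
    by (auto simp: summable_on_def)
  have 1: "((\<lambda>m. (\<Sum>\<^sub>\<infinity>n. M m n * a n) * cis (of_int m * \<theta>)) has_sum S) UNIV"
    by (rule has_sum_SigmaD[OF S]) (use has_sum_cmult_left[OF has_sum_infsum[OF rows]] in \<open>auto simp: G_def\<close>)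
  have "((\<lambda>(n, m). G (m, n)) has_sum S) (UNIV \<times> UNIV)"
    using S has_sum_swap[of G UNIV UNIV] by (simp add: case_prod_unfold o_def)
  then have "((\<lambda>n. k n * a n) has_sum S) UNIV"
    by (rule has_sum_SigmaD)
       (use has_sum_cmult_left[OF kcol] in \<open>auto simp: G_def mult_ac\<close>)
  then have "S = (\<Sum>\<^sub>\<infinity>n. k n * a n)" by (simp add: infsumI)
  then show "((\<lambda>m. (\<Sum>\<^sub>\<infinity>n. M m n * a n) * cis (of_int m * \<theta>)) has_sum
      (1 / of_real (2 * pi) * (\<integral>\<phi>. \<kappa> \<phi> * f \<phi> \<partial>circle_measure))) UNIV"
    unfolding val using 1 by simp
qed

text \<open>Removes the diagonal, where the kernel of a curve against itself is given by no
  expansion.\<close>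

lemma AE_circle_cis_neq: "AE \<phi> in circle_measure. cis \<phi> \<noteq> cis \<theta>"
proof -
  have sub: "{\<phi>. cis \<phi> = cis \<theta>} \<subseteq> range (\<lambda>n::int. \<theta> + 2 * pi * of_int n)"
  proof safe
    fix \<phi> assume "cis \<phi> = cis \<theta>"
    then have "exp (\<i> * of_real \<phi>) = exp (\<i> * of_real \<theta>)" by (simp add: cis_conv_exp)
    then obtain n :: int where "\<i> * of_real \<phi> = \<i> * of_real \<theta> + of_real (of_int (2 * n) * pi) * \<i>"
      unfolding exp_eq by auto
    then have "complex_of_real \<phi> = of_real (\<theta> + 2 * pi * of_int n)"
      by (simp add: complex_eq_iff)
    then have "\<phi> = \<theta> + 2 * pi * of_int n" by (simp only: of_real_eq_iff)
    then show "\<phi> \<in> range (\<lambda>n::int. \<theta> + 2 * pi * of_int n)" by blast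
  qed
  have "countable {\<phi>. cis \<phi> = cis \<theta>}" by (rule countable_subset[OF sub]) simp
  then have "{\<phi>. cis \<phi> = cis \<theta>} \<in> null_sets lborel" by (rule countable_imp_null_set_lborel)
  then have "AE \<phi> in lborel. \<phi> \<notin> {\<phi>. cis \<phi> = cis \<theta>}" by (rule AE_not_in)
  then show ?thesis by (subst AE_restrict_space_iff) (auto elim: eventually_mono)
qed

text \<open>The outer radius is absent on purpose: whatever is built from \<open>B\<close>,
  \<open>b\<close> and \<open>c\<close> here is a constant in the limit.\<close>

locale expanded_exterior_map = exterior_map \<Psi> \<alpha> \<gamma> for \<Psi> \<alpha> \<gamma> +
  fixes r\<^sub>i B b :: real and c :: "nat \<Rightarrow> nat \<Rightarrow> complex"
  assumes b: "\<gamma> < b" "b < r\<^sub>i" and B: "B \<ge> 0"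
    and c_bound: "\<And>m n. cmod (c m n) \<le> B * b ^ m * b ^ n"
    and c_sum: "\<And>w \<zeta>. \<lbrakk>r\<^sub>i \<le> norm w; r\<^sub>i \<le> norm \<zeta>; w \<noteq> \<zeta>\<rbrakk> \<Longrightarrow>
       ((\<lambda>(m, n). c m n * (1 / w) ^ m * (1 / \<zeta>) ^ n) has_sum
         (w * deriv \<Psi> w / (\<Psi> w - \<Psi> \<zeta>) - w / (w - \<zeta>))) UNIV"
begin

lemma radii_pos: "b > 0" "r\<^sub>i > 0" "\<gamma> < r\<^sub>i"
  using b gamma_pos by auto

text \<open>
  The extra \<open>1 / 2\<close> at the origin makes the remaining part of the kernel the multiplier \<open>r ^ \<bar>n\<bar> / 2\<close> for
  all \<open>n\<close>, including \<open>n = 0\<close>.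
\<close>

definition C :: "int \<Rightarrow> int \<Rightarrow> complex" where
  "C m n = (if m = 0 \<and> n = 0 then 1 / 2 else 0)
     + (if m \<le> 0 \<and> n \<ge> 0 then c (nat (- m)) (nat n) / 2 else 0)
     + (if m \<ge> 0 \<and> n \<le> 0 then cnj (c (nat m) (nat (- n))) / 2 else 0)"

lemma C_bound: "cmod (C m n) \<le> (1 / 2 + B) * int_power b m * int_power b n"
proof -
  define P where "P = int_power b m * int_power b n"
  have P: "P \<ge> 0" using radii_pos by (simp add: P_def int_power_def)
  have 0: "cmod (if m = 0 \<and> n = 0 then 1 / 2 else 0) \<le> 1 / 2 * P"
    using P by (auto simp: P_def int_power_def)
  have 1: "cmod (if m \<le> 0 \<and> n \<ge> 0 then c (nat (- m)) (nat n) / 2 else 0) \<le> B / 2 * P"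
    using P B c_bound[of "nat (- m)" "nat n"] by (auto simp: P_def int_power_def norm_divide)
  have 2: "cmod (if m \<ge> 0 \<and> n \<le> 0 then cnj (c (nat m) (nat (- n))) / 2 else 0) \<le> B / 2 * P"
    using P B c_bound[of "nat m" "nat (- n)"] by (auto simp: P_def int_power_def norm_divide)
  have "cmod (C m n) \<le> 1 / 2 * P + B / 2 * P + B / 2 * P"
    unfolding C_def by (intro norm_triangle_le add_mono 0 1 2)
  then show ?thesis by (simp add: P_def algebra_simps)
qed

lemma regular_kernel_has_sum:
  assumes \<rho>: "r\<^sub>i \<le> \<rho>" "r\<^sub>i \<le> \<rho>'" and ne: "of_real \<rho> * cis \<theta> \<noteq> of_real \<rho>' * cis \<phi>"
  defines "w \<equiv> of_real \<rho> * cis \<theta>" and "\<zeta> \<equiv> of_real \<rho>' * cis \<phi>"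
  shows "((\<lambda>(m, n). C m n * of_real (int_power (1 / \<rho>) m * int_power (1 / \<rho>') n) * cis (of_int m * \<theta>) * cis (- of_int n * \<phi>))
     has_sum of_real (1 / 2 + Re (w * deriv \<Psi> w / (\<Psi> w - \<Psi> \<zeta>) - w / (w - \<zeta>)))) UNIV"
proof -
  define k where "k = w * deriv \<Psi> w / (\<Psi> w - \<Psi> \<zeta>) - w / (w - \<zeta>)"
  have pos: "\<rho> > 0" "\<rho>' > 0" using \<rho> radii_pos by auto
  have nw: "norm w = \<rho>" "norm \<zeta> = \<rho>'" using pos by (auto simp: w_def \<zeta>_def norm_mult)
  define E where "E = (\<lambda>m n. of_real (int_power (1 / \<rho>) m * int_power (1 / \<rho>') n) * cis (of_int m * \<theta>) * cis (- of_int n * \<phi>))"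
  have "1 / w = of_real (1 / \<rho>) * cis (- \<theta>)" "1 / \<zeta> = of_real (1 / \<rho>') * cis (- \<phi>)"
    by (simp_all add: w_def \<zeta>_def divide_inverse cis_inverse)
  then have pw: "(1 / w) ^ m = of_real ((1 / \<rho>) ^ m) * cis (- real m * \<theta>)"
      "(1 / \<zeta>) ^ n = of_real ((1 / \<rho>') ^ n) * cis (- real n * \<phi>)" for m n
    by (simp_all only: power_mult_distrib Complex.DeMoivre of_real_power mult_minus_left mult_minus_right)
  have H: "((\<lambda>(m, n). c m n * (1 / w) ^ m * (1 / \<zeta>) ^ n) has_sum k) UNIV"
    unfolding k_def using ne \<rho> nw by (intro c_sum) (auto simp: w_def \<zeta>_def)
  from has_sum_cmult_left[OF this, of "1 / 2"]
  have H1: "((\<lambda>x. (case x of (m, n) \<Rightarrow> c m n * (1 / w) ^ m * (1 / \<zeta>) ^ n) * (1 / 2)) has_sum k * (1 / 2)) UNIV" .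
  have H2: "((\<lambda>x. cnj ((case x of (m, n) \<Rightarrow> c m n * (1 / w) ^ m * (1 / \<zeta>) ^ n) * (1 / 2))) has_sum cnj (k * (1 / 2))) UNIV"
    using H1 by (simp only: has_sum_cnj_iff)
  have r1: "x \<in> range (\<lambda>(m, n). (- int m, int n))" if "fst x \<le> 0" "snd x \<ge> 0" for x
    using that by (intro image_eqI[where x="(nat (- fst x), nat (snd x))"]) auto
  have r2: "x \<in> range (\<lambda>(m, n). (int m, - int n))" if "fst x \<ge> 0" "snd x \<le> 0" for x
    using that by (intro image_eqI[where x="(nat (fst x), nat (- snd x))"]) auto
  \<comment> \<open>A real part is half the series plus half its conjugate. Powers of
    \<open>1 / w\<close> carry frequencies at most 0 in \<theta>, and powers of
    \<open>1 / \<zeta>\<close> match \<open>cis (- of_int n * \<phi>)\<close> with \<open>n\<close>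
    at least 0; conjugation gives the opposite quadrant.\<close>
  have 1: "((\<lambda>(m, n). (if m \<le> 0 \<and> n \<ge> 0 then c (nat (- m)) (nat n) / 2 else 0) * E m n) has_sum k * (1 / 2)) UNIV"
    by (rule has_sum_transport[where j="\<lambda>(m, n). (- int m, int n)", OF H1])
       (use r1 in \<open>auto simp: inj_def E_def int_power_def pw\<close>)
  have 2: "((\<lambda>(m, n). (if m \<ge> 0 \<and> n \<le> 0 then cnj (c (nat m) (nat (- n))) / 2 else 0) * E m n) has_sum cnj (k * (1 / 2))) UNIV"
    by (rule has_sum_transport[where j="\<lambda>(m, n). (int m, - int n)", OF H2])
       (use r2 in \<open>auto simp: inj_def E_def int_power_def pw cis_cnj\<close>)
  have 0: "((\<lambda>(m, n). (if m = 0 \<and> n = 0 then 1 / 2 else 0) * E m n) has_sum 1 / 2) UNIV"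
    using has_sum_finite_neutralI[of "{(0, 0)}" UNIV "\<lambda>(m, n). (if m = 0 \<and> n = 0 then 1 / 2 else 0) * E m n" "1 / 2"]
    by (auto simp: E_def int_power_def split: if_splits)
  have "(\<lambda>(m, n). C m n * E m n) = (\<lambda>x. (case x of (m, n) \<Rightarrow> (if m = 0 \<and> n = 0 then 1 / 2 else 0) * E m n)
     + (case x of (m, n) \<Rightarrow> (if m \<le> 0 \<and> n \<ge> 0 then c (nat (- m)) (nat n) / 2 else 0) * E m n)
     + (case x of (m, n) \<Rightarrow> (if m \<ge> 0 \<and> n \<le> 0 then cnj (c (nat m) (nat (- n))) / 2 else 0) * E m n))"
    by (auto simp: C_def algebra_simps)
  with has_sum_add[OF has_sum_add[OF 0 1] 2]
  have "((\<lambda>(m, n). C m n * E m n) has_sum (1 / 2 + k * (1 / 2) + cnj (k * (1 / 2)))) UNIV" by simp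
  also have "1 / 2 + k * (1 / 2) + cnj (k * (1 / 2)) = of_real (1 / 2 + Re k)"
    by (simp add: complex_eq_iff)
  finally show ?thesis unfolding E_def k_def by (simp add: mult.assoc)
qed

end

section \<open>The Neumann-Poincare operator in Fourier coordinates\<close>

lemma has_sum_bool_prod:
  fixes f :: "bool \<times> 'k \<Rightarrow> 'a::banach"
  assumes "((\<lambda>n. f (True, n)) has_sum s) UNIV" "((\<lambda>n. f (False, n)) has_sum t) UNIV"
  shows "(f has_sum (s + t)) UNIV"
proof -
  have U: "(UNIV :: (bool \<times> 'k) set) = range (Pair True) \<union> range (Pair False)"
    by (auto simp: image_iff)
  have "(f has_sum s) (range (Pair True))" "(f has_sum t) (range (Pair False))"
    using assms by (simp_all add: has_sum_reindex inj_def o_def)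
  then show ?thesis unfolding U by (rule has_sum_Un_disjoint) auto
qed

lemma summable_on_bool_prod:
  fixes f :: "bool \<times> 'k \<Rightarrow> 'a::banach"
  shows "f summable_on UNIV \<longleftrightarrow> (\<lambda>n. f (True, n)) summable_on UNIV \<and> (\<lambda>n. f (False, n)) summable_on UNIV"
proof
  assume f: "f summable_on UNIV"
  have "(\<lambda>n. f (\<beta>, n)) summable_on UNIV" for \<beta>
  proof -
    have "f summable_on range (Pair \<beta>)" by (rule summable_on_subset_banach[OF f]) auto
    then show ?thesis by (simp add: summable_on_reindex inj_def o_def)
  qed
  then show "(\<lambda>n. f (True, n)) summable_on UNIV \<and> (\<lambda>n. f (False, n)) summable_on UNIV" by blast
next
  assume "(\<lambda>n. f (True, n)) summable_on UNIV \<and> (\<lambda>n. f (False, n)) summable_on UNIV"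
  then show "f summable_on UNIV" using has_sum_bool_prod unfolding summable_on_def by blast
qed

lemma infsum_bool_prod:
  fixes f :: "bool \<times> 'k \<Rightarrow> 'a::banach"
  assumes "f summable_on UNIV"
  shows "infsum f UNIV = (\<Sum>\<^sub>\<infinity>n. f (True, n)) + (\<Sum>\<^sub>\<infinity>n. f (False, n))"
  using assms[unfolded summable_on_bool_prod]
  by (intro infsumI has_sum_bool_prod has_sum_infsum) auto

lemma summable_on_bool_prod_all:
  fixes f :: "bool \<times> 'k \<Rightarrow> 'a::banach"
  shows "f summable_on UNIV \<longleftrightarrow> (\<forall>\<beta>. (\<lambda>n. f (\<beta>, n)) summable_on UNIV)"
  unfolding summable_on_bool_prod by (metis (full_types))

lemma summable_on_product:
  fixes f :: "'i \<Rightarrow> real" and g :: "'k \<Rightarrow> real"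
  assumes "f summable_on UNIV" "g summable_on UNIV" "\<And>x. f x \<ge> 0" "\<And>x. g x \<ge> 0"
  shows "(\<lambda>(x, y). f x * g y) summable_on UNIV"
proof -
  have "(\<lambda>(x, y). f x * g y) summable_on UNIV \<times> UNIV"
  proof (rule summable_on_SigmaI)
    show "((\<lambda>y. case (x, y) of (x, y) \<Rightarrow> f x * g y) has_sum (f x * infsum g UNIV)) UNIV" for x
      using has_sum_cmult_right[OF has_sum_infsum[OF assms(2)]] by simp
    show "(\<lambda>x. f x * infsum g UNIV) summable_on UNIV"
      by (rule summable_on_cmult_left[OF assms(1)])
  qed (use assms in auto)
  then show ?thesis by simp
qed

text \<open>The map from \<open>u\<close> to \<open>1 / (1 - u)\<close> sends the unit circle to the
  line with real part 1/2. So the singular part of a curve against itself is constant, and the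
  multiplier occurs only between different curves.\<close>

lemma Re_one_div_one_minus_unit:
  assumes "cmod u = 1" "u \<noteq> 1"
  shows "Re (1 / (1 - u)) = 1 / 2"
proof -
  have "u * cnj u = 1" using assms(1) by (simp add: complex_norm_square[symmetric])
  then have "cnj (1 / (1 - u)) = - u / (1 - u)"
    using assms(2) by (simp add: divide_simps) (simp add: algebra_simps)?
  then have "1 / (1 - u) + cnj (1 / (1 - u)) = (1 - u) / (1 - u)"
    by (simp only: diff_divide_distrib) simp
  then have "complex_of_real (2 * Re (1 / (1 - u))) = 1"
    using assms(2) unfolding complex_add_cnj by simp
  then show ?thesis by (metis of_real_eq_1_iff mult.commute nonzero_eq_divide_eq zero_neq_numeral)
qed

locale conformal_annulus_map = expanded_exterior_map +
  fixes r\<^sub>e :: real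
  assumes re: "r\<^sub>i < r\<^sub>e"
begin

text \<open>\<open>True\<close> stands for the inner and \<open>False\<close> for the outer boundary curve.\<close>

definition rad :: "bool \<Rightarrow> real" where "rad \<beta> = (if \<beta> then r\<^sub>i else r\<^sub>e)"
definition sg :: "bool \<Rightarrow> real" where "sg \<beta> = (if \<beta> then - 1 else 1)"
definition ratio :: real where "ratio = r\<^sub>i / r\<^sub>e"

lemma rad: "rad \<beta> > 0" "r\<^sub>i \<le> rad \<beta>" "\<gamma> < rad \<beta>"
  using re radii_pos by (auto simp: rad_def)

lemma ratio: "0 < ratio" "ratio < 1"
  using re radii_pos by (auto simp: ratio_def)

text \<open>\<sigma> is the curve of evaluation and \<beta> the curve carrying the density. The sign
  \<open>sg \<sigma>\<close> is that of the normal, which points towards smaller radii on the inner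
  curve.\<close>

definition Mat :: "bool \<Rightarrow> bool \<Rightarrow> int \<Rightarrow> int \<Rightarrow> complex" where
  "Mat \<sigma> \<beta> m n = of_real (sg \<sigma>) * (C m n * of_real (int_power (1 / rad \<sigma>) m * int_power (1 / rad \<beta>) n))
     + (if \<sigma> \<noteq> \<beta> \<and> m = n then of_real (int_power ratio m) / 2 else 0)"

lemma Mat_summable: "(\<lambda>(m, n). cmod (Mat \<sigma> \<beta> m n)) summable_on UNIV"
proof -
  define q where "q = b / r\<^sub>i"
  have q: "0 \<le> q" "q < 1" using b radii_pos by (auto simp: q_def)
  have le: "int_power b m * int_power (1 / rad \<beta>) m \<le> int_power q m" for \<beta> m
  proof -
    have "b * (1 / rad \<beta>) \<le> q" unfolding q_def using rad[of \<beta>] radii_pos by (simp add: frac_le)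
    then have "(b * (1 / rad \<beta>)) ^ nat \<bar>m\<bar> \<le> q ^ nat \<bar>m\<bar>"
      using rad[of \<beta>] radii_pos by (intro power_mono) auto
    then show ?thesis by (simp add: int_power_def power_mult_distrib power_one_over field_simps)
  qed
  have ipn: "int_power x m \<ge> 0" if "x \<ge> 0" for x m using that by (simp add: int_power_def)
  have s1: "(\<lambda>x. (case x of (m, n) \<Rightarrow> int_power q m * int_power q n) * (1 / 2 + B)) summable_on UNIV"
    using q by (intro summable_on_cmult_left summable_on_product int_power_has_sum ipn)
  have s2: "(\<lambda>(m, n). if m = n then int_power ratio m else 0) summable_on UNIV"
    by (rule summable_on_transport[where j="\<lambda>n::int. (n, n)", OF int_power_has_sum(2)[of ratio]])
       (use ratio in \<open>auto simp: inj_def\<close>)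
  show ?thesis
  proof (rule summable_on_comparison_test[OF summable_on_add[OF s1 s2]])
    fix x :: "int \<times> int"
    obtain m n where x: "x = (m, n)" by force
    define P where "P = int_power (1 / rad \<sigma>) m * int_power (1 / rad \<beta>) n"
    have P: "P \<ge> 0" using rad[of \<sigma>] rad[of \<beta>] by (simp add: P_def ipn)
    have "cmod (of_real (sg \<sigma>) * (C m n * of_real P)) = cmod (C m n) * P"
      using P by (simp add: norm_mult sg_def)
    also have "\<dots> \<le> (1 / 2 + B) * int_power b m * int_power b n * P"
      by (rule mult_right_mono[OF C_bound P])
    also have "\<dots> = (1 / 2 + B) * ((int_power b m * int_power (1 / rad \<sigma>) m) * (int_power b n * int_power (1 / rad \<beta>) n))"
      by (simp add: P_def mult_ac)
    also have "\<dots> \<le> (1 / 2 + B) * (int_power q m * int_power q n)"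
      using B radii_pos rad q by (intro mult_left_mono mult_mono le mult_nonneg_nonneg ipn) (auto simp: less_imp_le)
    finally have 1: "cmod (of_real (sg \<sigma>) * (C m n * of_real P)) \<le> int_power q m * int_power q n * (1 / 2 + B)"
      by (simp add: mult_ac)
    have 2: "cmod (if \<sigma> \<noteq> \<beta> \<and> m = n then of_real (int_power ratio m) / 2 else 0) \<le> (if m = n then int_power ratio m else 0)"
      using ipn[of ratio m] ratio by (auto simp: norm_divide)
    show "(case x of (m, n) \<Rightarrow> cmod (Mat \<sigma> \<beta> m n)) \<le>
      (case x of (m, n) \<Rightarrow> int_power q m * int_power q n) * (1 / 2 + B) + (case x of (m, n) \<Rightarrow> if m = n then int_power ratio m else 0)"
      unfolding x Mat_def P_def[symmetric] prod.case by (rule norm_triangle_le[OF add_mono[OF 1 2]])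
  qed auto
qed

lemma kernel_has_sum:
  assumes ne: "of_real (rad \<sigma>) * cis \<theta> \<noteq> of_real (rad \<beta>) * cis \<phi>"
  defines "w \<equiv> of_real (rad \<sigma>) * cis \<theta>" and "\<zeta> \<equiv> of_real (rad \<beta>) * cis \<phi>"
  shows "((\<lambda>(m, n). Mat \<sigma> \<beta> m n * cis (of_int m * \<theta>) * cis (- of_int n * \<phi>)) has_sum
     of_real (sg \<sigma> * Re (w * deriv \<Psi> w / (\<Psi> w - \<Psi> \<zeta>)))) UNIV"
proof -
  define K where "K = Re (w * deriv \<Psi> w / (\<Psi> w - \<Psi> \<zeta>))"
  define D where "D = (if \<sigma> \<noteq> \<beta> then Re (1 / (1 - of_real ratio * cis (\<theta> - \<phi>))) - 1 / 2 else 0)"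
  define T where "T = (\<lambda>(m, n). C m n * of_real (int_power (1 / rad \<sigma>) m * int_power (1 / rad \<beta>) n) * cis (of_int m * \<theta>) * cis (- of_int n * \<phi>))"
  have reg: "(T has_sum of_real (1 / 2 + K - Re (w / (w - \<zeta>)))) UNIV"
    using regular_kernel_has_sum[OF rad(2) rad(2) ne] unfolding K_def w_def \<zeta>_def T_def by (simp add: add_diff_eq)
  have wz: "w \<noteq> 0" "\<zeta> \<noteq> 0" "w \<noteq> \<zeta>" using rad[of \<sigma>] rad[of \<beta>] ne by (auto simp: w_def \<zeta>_def)
  have id1: "w / (w - \<zeta>) = 1 / (1 - \<zeta> / w)" using wz by (simp add: field_simps)
  have id2: "w / (w - \<zeta>) = 1 - 1 / (1 - w / \<zeta>)" using wz by (simp add: field_simps)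
  have quot: "\<zeta> / w = of_real (rad \<beta> / rad \<sigma>) * cis (\<phi> - \<theta>)" "w / \<zeta> = of_real (rad \<sigma> / rad \<beta>) * cis (\<theta> - \<phi>)"
    by (simp_all add: w_def \<zeta>_def flip: cis_divide)
  \<comment> \<open>\<open>id1\<close> serves the outer curve and \<open>id2\<close> the inner one,
    so that the geometric ratio has modulus \<open>ratio < 1\<close>. The change of sign of
    \<open>sg \<sigma>\<close> is offset by the 1 in \<open>id2\<close>, so both cases leave the
    same Poisson term \<open>D\<close>; on equal curves the 1/2 built into \<open>C\<close>
    cancels.\<close>
  have fin: "sg \<sigma> * (1 / 2 + K - Re (w / (w - \<zeta>))) + D = sg \<sigma> * K"
  proof (cases "\<sigma> = \<beta>")
    case True
    have "cmod (\<zeta> / w) = 1" using True rad[of \<beta>] by (simp add: w_def \<zeta>_def norm_divide norm_mult)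
    moreover have "\<zeta> / w \<noteq> 1" using wz by auto
    ultimately have "Re (w / (w - \<zeta>)) = 1 / 2" unfolding id1 by (rule Re_one_div_one_minus_unit)
    then show ?thesis using True by (simp add: D_def)
  next
    case False
    show ?thesis
    proof (cases \<sigma>)
      case True
      then have "w / \<zeta> = of_real ratio * cis (\<theta> - \<phi>)" using False by (simp add: quot ratio_def rad_def)
      then show ?thesis using True False unfolding id2 D_def sg_def by simp
    next
      case F: False
      then have "\<zeta> / w = cnj (of_real ratio * cis (\<theta> - \<phi>))" using False by (simp add: quot ratio_def rad_def cis_cnj)
      then have "1 / (1 - \<zeta> / w) = cnj (1 / (1 - of_real ratio * cis (\<theta> - \<phi>)))" by simp
      then have "Re (w / (w - \<zeta>)) = Re (1 / (1 - of_real ratio * cis (\<theta> - \<phi>)))" unfolding id1 by (metis complex_cnj(1) complex.sel(1) complex_cnj_cnj cnj.simps(1))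
      then show ?thesis using F False unfolding D_def sg_def by simp
    qed
  qed
  have diag: "((\<lambda>(m, n). (if \<sigma> \<noteq> \<beta> \<and> m = n then of_real (int_power ratio m) / 2 else 0) * cis (of_int m * \<theta>) * cis (- of_int n * \<phi>)) has_sum of_real D) UNIV"
  proof (cases "\<sigma> = \<beta>")
    case True
    then show ?thesis by (simp add: D_def case_prod_unfold)
  next
    case False
    have P: "((\<lambda>n. (of_real (int_power ratio n) * cis (of_int n * (\<theta> - \<phi>))) * (1 / 2)) has_sum
       of_real (2 * Re (1 / (1 - of_real ratio * cis (\<theta> - \<phi>))) - 1) * (1 / 2)) UNIV"
      using ratio by (intro has_sum_cmult_left poisson_has_sum) auto
    have e: "of_real (2 * Re (1 / (1 - of_real ratio * cis (\<theta> - \<phi>))) - 1) * (1 / 2) = complex_of_real D"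
      using False by (simp add: D_def)
    show ?thesis
      by (rule has_sum_transport[where j="\<lambda>n::int. (n, n)", OF P[unfolded e]])
         (use False in \<open>auto simp: inj_def mult.assoc cis_mult right_diff_distrib split: if_splits\<close>)
  qed
  have "((\<lambda>x. of_real (sg \<sigma>) * T x + (case x of (m, n) \<Rightarrow> (if \<sigma> \<noteq> \<beta> \<and> m = n then of_real (int_power ratio m) / 2 else 0) * cis (of_int m * \<theta>) * cis (- of_int n * \<phi>)))
      has_sum (of_real (sg \<sigma>) * of_real (1 / 2 + K - Re (w / (w - \<zeta>))) + of_real D)) UNIV"
    by (intro has_sum_add has_sum_cmult_right reg diag)
  moreover have "(\<lambda>x. of_real (sg \<sigma>) * T x + (case x of (m, n) \<Rightarrow> (if \<sigma> \<noteq> \<beta> \<and> m = n then of_real (int_power ratio m) / 2 else 0) * cis (of_int m * \<theta>) * cis (- of_int n * \<phi>)))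
      = (\<lambda>(m, n). Mat \<sigma> \<beta> m n * cis (of_int m * \<theta>) * cis (- of_int n * \<phi>))"
    by (auto simp: fun_eq_iff T_def Mat_def distrib_right mult.assoc)
  moreover have "of_real (sg \<sigma>) * of_real (1 / 2 + K - Re (w / (w - \<zeta>))) + of_real D = complex_of_real (sg \<sigma> * K)"
    unfolding fin[symmetric] by simp
  ultimately show ?thesis unfolding K_def by simp
qed

section \<open>The operator as a matrix acting on coefficient sequences\<close>

abbreviation V :: "(complex \<Rightarrow> complex) set" where "V \<equiv> density_space \<Psi> r\<^sub>i r\<^sub>e"
abbreviation dnorm :: "(complex \<Rightarrow> complex) \<Rightarrow> real" where "dnorm \<equiv> density_norm \<Psi> r\<^sub>i r\<^sub>e"

definition coef :: "(complex \<Rightarrow> complex) \<Rightarrow> bool \<times> int \<Rightarrow> complex" where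
  "coef \<phi> = (\<lambda>(\<beta>, n). (THE a. density_series \<Psi> (rad \<beta>) \<phi> a) n)"

definition l2 :: "(bool \<times> int \<Rightarrow> complex) \<Rightarrow> bool" where
  "l2 y \<longleftrightarrow> (\<lambda>j. (cmod (y j))\<^sup>2) summable_on UNIV"

definition l2norm :: "(bool \<times> int \<Rightarrow> complex) \<Rightarrow> real" where
  "l2norm y = sqrt (\<Sum>\<^sub>\<infinity>j. (cmod (y j))\<^sup>2)"

definition Mop :: "(bool \<times> int \<Rightarrow> complex) \<Rightarrow> bool \<times> int \<Rightarrow> complex" where
  "Mop y = (\<lambda>(\<sigma>, m). (\<Sum>\<^sub>\<infinity>n. Mat \<sigma> True m n * y (True, n)) + (\<Sum>\<^sub>\<infinity>n. Mat \<sigma> False m n * y (False, n)))"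

definition asynth :: "(bool \<times> int \<Rightarrow> complex) \<Rightarrow> complex \<Rightarrow> complex" where
  "asynth y x = (if x \<in> level_curve r\<^sub>i then synth r\<^sub>i (\<lambda>n. y (True, n)) x else synth r\<^sub>e (\<lambda>n. y (False, n)) x)"

lemma V_measurable: "\<phi> \<in> V \<Longrightarrow> \<phi> \<in> borel_measurable borel"
  by (simp add: density_space_def)

lemma coefI:
  assumes "\<phi> \<in> borel_measurable borel" "\<And>\<beta>. density_series \<Psi> (rad \<beta>) \<phi> (\<lambda>n. y (\<beta>, n))"
  shows "\<phi> \<in> V" "coef \<phi> = y"
proof -
  show "\<phi> \<in> V" unfolding density_space_def
    using assms(1) assms(2)[of True] assms(2)[of False] by (auto simp: rad_def)
  show "coef \<phi> = y"
    using the_density_series[OF rad(3) assms(1) assms(2)] by (auto simp: coef_def fun_eq_iff)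
qed

lemma coef_series: "\<phi> \<in> V \<Longrightarrow> density_series \<Psi> (rad \<beta>) \<phi> (\<lambda>n. coef \<phi> (\<beta>, n))"
proof -
  assume \<phi>: "\<phi> \<in> V"
  then have "\<exists>a. density_series \<Psi> (rad \<beta>) \<phi> a"
    by (simp add: density_space_def rad_def)
  then obtain a where a: "density_series \<Psi> (rad \<beta>) \<phi> a" ..
  have "(\<lambda>n. coef \<phi> (\<beta>, n)) = a"
    using the_density_series[OF rad(3) V_measurable[OF \<phi>] a] by (simp add: coef_def)
  then show ?thesis using a by simp
qed

lemma coef_l2: "\<phi> \<in> V \<Longrightarrow> l2 (coef \<phi>)"
  unfolding l2_def summable_on_bool_prod_all
  using coef_series by (auto simp: density_series_def)

lemma dnorm_eq: "\<phi> \<in> V \<Longrightarrow> dnorm \<phi> = l2norm (coef \<phi>)"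
  using coef_l2[unfolded l2_def, THEN infsum_bool_prod]
  by (simp add: density_norm_def l2norm_def coef_def rad_def)

lemma coef_linear:
  assumes "\<phi> \<in> V" "\<psi> \<in> V"
  shows "(\<lambda>x. s * \<phi> x + t * \<psi> x) \<in> V" "coef (\<lambda>x. s * \<phi> x + t * \<psi> x) = (\<lambda>j. s * coef \<phi> j + t * coef \<psi> j)"
proof -
  note m [measurable] = V_measurable[OF assms(1)] V_measurable[OF assms(2)]
  have "(\<lambda>x. s * \<phi> x + t * \<psi> x) \<in> borel_measurable borel" by measurable
  moreover have "density_series \<Psi> (rad \<beta>) (\<lambda>x. s * \<phi> x + t * \<psi> x) (\<lambda>n. s * coef \<phi> (\<beta>, n) + t * coef \<psi> (\<beta>, n))" for \<beta>
    by (intro density_series_linear rad m coef_series assms)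
  ultimately show "(\<lambda>x. s * \<phi> x + t * \<psi> x) \<in> V" "coef (\<lambda>x. s * \<phi> x + t * \<psi> x) = (\<lambda>j. s * coef \<phi> j + t * coef \<psi> j)"
    using coefI[of "\<lambda>x. s * \<phi> x + t * \<psi> x" "\<lambda>j. s * coef \<phi> j + t * coef \<psi> j"] by auto
qed

lemma coef_minus:
  assumes "\<phi> \<in> V" "\<psi> \<in> V"
  shows "(\<lambda>x. s * \<phi> x - \<psi> x) \<in> V" "coef (\<lambda>x. s * \<phi> x - \<psi> x) = (\<lambda>j. s * coef \<phi> j - coef \<psi> j)"
  using coef_linear[OF assms, of s "-1"] by simp_all

lemma l2norm_zero_iff: "l2 y \<Longrightarrow> l2norm y = 0 \<longleftrightarrow> y = (\<lambda>_. 0)"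
proof
  assume "l2 y" "l2norm y = 0"
  then have "(cmod (y j))\<^sup>2 = 0" for j
    unfolding l2_def l2norm_def
    by (intro nonneg_infsum_le_0D[where A=UNIV and f="\<lambda>j. (cmod (y j))\<^sup>2"]) auto
  then show "y = (\<lambda>_. 0)" by auto
qed (simp add: l2norm_def)

lemma dnorm_zero_iff: "\<phi> \<in> V \<Longrightarrow> dnorm \<phi> = 0 \<longleftrightarrow> coef \<phi> = (\<lambda>_. 0)"
  by (simp add: dnorm_eq coef_l2 l2norm_zero_iff)

lemma norm_le_l2norm:
  assumes "l2 y"
  shows "cmod (y j) \<le> l2norm y"
proof -
  have "(cmod (y j))\<^sup>2 \<le> (\<Sum>\<^sub>\<infinity>n. (cmod (y n))\<^sup>2)"
    using finite_sum_le_infsum[OF assms[unfolded l2_def], of "{j}"] by simp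
  then show ?thesis unfolding l2norm_def by (rule real_le_rsqrt)
qed

lemma asynth:
  assumes y: "(\<lambda>j. cmod (y j)) summable_on UNIV"
  shows "asynth y \<in> V" "coef (asynth y) = y"
proof -
  have s: "(\<lambda>n. cmod (y (\<beta>, n))) summable_on UNIV" for \<beta>
    using y unfolding summable_on_bool_prod_all by blast
  have syn: "asynth y x = synth (rad \<beta>) (\<lambda>n. y (\<beta>, n)) x" if "x \<in> level_curve (rad \<beta>)" for x \<beta>
  proof (cases \<beta>)
    case True
    then show ?thesis using that by (simp add: asynth_def rad_def)
  next
    case False
    then have "x \<in> level_curve r\<^sub>e" using that by (simp add: rad_def)
    then have "x \<notin> level_curve r\<^sub>i"
      using level_curve_disjoint[of r\<^sub>e r\<^sub>i x] re radii_pos by auto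
    then show ?thesis using False by (simp add: asynth_def rad_def)
  qed
  have ms: "synth (rad \<beta>) (\<lambda>n. y (\<beta>, n)) \<in> borel_measurable borel" for \<beta>
    by (rule synth_measurable[OF rad(3) s])
  have [measurable]: "synth r\<^sub>i (\<lambda>n. y (True, n)) \<in> borel_measurable borel"
    "synth r\<^sub>e (\<lambda>n. y (False, n)) \<in> borel_measurable borel"
    using ms[of True] ms[of False] by (simp_all add: rad_def)
  have [measurable]: "level_curve r\<^sub>i \<in> sets borel"
    using level_curve_borel[OF rad(3)[of True]] by (simp add: rad_def)
  have m: "asynth y \<in> borel_measurable borel" unfolding asynth_def[abs_def] by measurable
  have "density_series \<Psi> (rad \<beta>) (asynth y) (\<lambda>n. y (\<beta>, n))" for \<beta>
    by (rule density_series_absolutely_convergent[OF rad(3) s m syn])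
  then show "asynth y \<in> V" "coef (asynth y) = y" using coefI[OF m] by auto
qed

text \<open>Smoothing: \<open>Mat\<close> is summable over both indices, so bounded input gives
  summable output, and \<open>asynth\<close> can sum every output pointwise to a density.\<close>

lemma Mop_summable:
  assumes "\<And>j. cmod (y j) \<le> D"
  shows "(\<lambda>n. Mat \<sigma> \<beta> m n * y (\<beta>, n)) summable_on UNIV" "(\<lambda>j. cmod (Mop y j)) summable_on UNIV"
proof -
  note app = summable_matrix_apply[OF Mat_summable, of "\<lambda>n. y (_, n)" D, OF assms]
  show "(\<lambda>n. Mat \<sigma> \<beta> m n * y (\<beta>, n)) summable_on UNIV" by (rule app(2))
  show "(\<lambda>j. cmod (Mop y j)) summable_on UNIV"
    unfolding summable_on_bool_prod_all
  proof
    fix \<sigma>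
    show "(\<lambda>m. cmod (Mop y (\<sigma>, m))) summable_on UNIV"
      by (rule summable_on_comparison_test[OF summable_on_add[OF app(3)[of \<sigma> True True] app(3)[of \<sigma> False False]]])
         (auto simp: Mop_def norm_triangle_ineq)
  qed
qed

lemma NP_adjoint_curve:
  assumes \<phi>: "\<phi> \<in> V"
  shows "((\<lambda>m. Mop (coef \<phi>) (\<sigma>, m) * cis (of_int m * \<theta>)) has_sum
     of_real (speed (rad \<sigma>) \<theta>) * NP_adjoint \<Psi> r\<^sub>i r\<^sub>e \<phi> (curve (rad \<sigma>) \<theta>)) UNIV"
proof -
  define x where "x = curve (rad \<sigma>) \<theta>"
  define w where "w = of_real (rad \<sigma>) * cis \<theta>"
  define d where "d = w * deriv \<Psi> w"
  define A where "A = conformal_annulus \<Psi> r\<^sub>i r\<^sub>e"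
  define F where "F = (\<lambda>y. of_real (inner (x - y) (outward_normal A x) / (norm (x - y))\<^sup>2) * \<phi> y)"
  define \<kappa> where "\<kappa> \<beta> \<phi>' = complex_of_real (sg \<sigma> * Re (d / (x - curve (rad \<beta>) \<phi>')))" for \<beta> \<phi>'
  have x: "x = \<Psi> w" by (simp add: x_def curve_def w_def)
  have fr: "x \<in> frontier A"
    unfolding A_def frontier_annulus[OF radii_pos(3) re] x_def
    using curve_in_level_curve[OF rad(3)[of \<sigma>], of \<theta>] by (auto simp: rad_def split: if_splits)
  have \<nu>: "outward_normal A x = of_real (sg \<sigma>) * sgn d"
    unfolding A_def x_def d_def w_def
    by (rule outward_normal_curve[OF radii_pos(3) re]) (auto simp: rad_def sg_def)
  have sp: "speed (rad \<sigma>) \<theta> = cmod d" using rad[of \<sigma>] by (simp add: speed_def d_def w_def norm_mult)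
  have d0: "d \<noteq> 0" using speed_pos[OF rad(3), of \<sigma> \<theta>] sp by auto
  \<comment> \<open>The length of \<open>d\<close> is the speed at the evaluation point. It cancels
    the normalisation of the unit normal, and the pulled-back kernel becomes the real part of a
    holomorphic quotient.\<close>
  have ker: "cmod d * (inner z (outward_normal A x) / (norm z)\<^sup>2) = sg \<sigma> * Re (d / z)" for z
  proof -
    have "cmod d * inner z (outward_normal A x) = sg \<sigma> * inner z d"
      unfolding \<nu> using d0 by (simp add: sgn_div_norm inner_complex_def field_simps)
    moreover have "Re (d / z) = inner z d / (norm z)\<^sup>2"
      by (simp add: Re_divide inner_complex_def cmod_power2 add_divide_distrib mult.commute)
    ultimately show ?thesis by simp
  qed
  have m [measurable]: "\<phi> \<in> borel_measurable borel" by (rule V_measurable[OF \<phi>])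
  have mF: "F \<in> borel_measurable borel" unfolding F_def by measurable
  have int: "of_real (cmod d) * (\<integral>y. F y \<partial>level_curve_measure \<Psi> (rad \<beta>)) = (\<integral>\<phi>'. \<kappa> \<beta> \<phi>' * pull (rad \<beta>) \<phi> \<phi>' \<partial>circle_measure)" for \<beta>
  proof -
    have "of_real (cmod d) * (\<integral>y. F y \<partial>level_curve_measure \<Psi> (rad \<beta>)) =
      (\<integral>\<phi>'. of_real (cmod d) * (speed (rad \<beta>) \<phi>' *\<^sub>R F (curve (rad \<beta>) \<phi>')) \<partial>circle_measure)"
      unfolding integral_level[OF rad(3) mF] by (rule integral_mult_right_zero[symmetric])
    also have "\<dots> = (\<integral>\<phi>'. \<kappa> \<beta> \<phi>' * pull (rad \<beta>) \<phi> \<phi>' \<partial>circle_measure)"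
      unfolding F_def \<kappa>_def pull_def ker[symmetric]
      by (intro Bochner_Integration.integral_cong) (auto simp: scaleR_conv_of_real mult_ac)
    finally show ?thesis .
  qed
  have dens: "L2_series (pull (rad \<beta>) \<phi>) (\<lambda>n. coef \<phi> (\<beta>, n))" for \<beta>
    using coef_series[OF \<phi>] by (simp add: density_series_iff[OF rad(3) m])
  note D = norm_le_l2norm[OF coef_l2[OF \<phi>]]
  have hs: "((\<lambda>m. (\<Sum>\<^sub>\<infinity>n. Mat \<sigma> \<beta> m n * coef \<phi> (\<beta>, n)) * cis (of_int m * \<theta>)) has_sum
      (1 / of_real (2 * pi) * (\<integral>\<phi>'. \<kappa> \<beta> \<phi>' * pull (rad \<beta>) \<phi> \<phi>' \<partial>circle_measure))) UNIV" for \<beta>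
  proof (rule double_kernel_against_series(1)[OF Mat_summable _ _ pull_measurable[OF rad(3) m] dens D])
    show "AE \<phi>' in circle_measure. ((\<lambda>(m, n). Mat \<sigma> \<beta> m n * cis (of_int m * \<theta>) * cis (- of_int n * \<phi>')) has_sum \<kappa> \<beta> \<phi>') UNIV"
      using AE_circle_cis_neq[of \<theta>]
    proof eventually_elim
      case (elim \<phi>')
      have "of_real (rad \<sigma>) * cis \<theta> \<noteq> of_real (rad \<beta>) * cis \<phi>'"
      proof
        assume e: "of_real (rad \<sigma>) * cis \<theta> = of_real (rad \<beta>) * cis \<phi>'"
        have "rad \<sigma> = rad \<beta>" using arg_cong[OF e, of cmod] rad(1)[of \<sigma>] rad(1)[of \<beta>] by (simp add: norm_mult)
        then show False using e elim rad(1)[of \<beta>] by simp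
      qed
      from kernel_has_sum[OF this] show ?case
        unfolding \<kappa>_def d_def w_def x_def curve_def by simp
    qed
    have [measurable]: "curve (rad \<beta>) \<in> borel_measurable circle_measure" by (rule curve_measurable[OF rad(3)])
    show "\<kappa> \<beta> \<in> borel_measurable circle_measure" unfolding \<kappa>_def by measurable
  qed
  have "((\<lambda>m. (\<Sum>\<^sub>\<infinity>n. Mat \<sigma> True m n * coef \<phi> (True, n)) * cis (of_int m * \<theta>)
       + (\<Sum>\<^sub>\<infinity>n. Mat \<sigma> False m n * coef \<phi> (False, n)) * cis (of_int m * \<theta>)) has_sum
      (1 / of_real (2 * pi) * (of_real (cmod d) * (\<integral>y. F y \<partial>level_curve_measure \<Psi> (rad True))) +
       1 / of_real (2 * pi) * (of_real (cmod d) * (\<integral>y. F y \<partial>level_curve_measure \<Psi> (rad False))))) UNIV"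
    unfolding int by (intro has_sum_add hs)
  moreover have "1 / of_real (2 * pi) * (of_real (cmod d) * (\<integral>y. F y \<partial>level_curve_measure \<Psi> (rad True))) +
       1 / of_real (2 * pi) * (of_real (cmod d) * (\<integral>y. F y \<partial>level_curve_measure \<Psi> (rad False)))
     = of_real (speed (rad \<sigma>) \<theta>) * NP_adjoint \<Psi> r\<^sub>i r\<^sub>e \<phi> x"
    unfolding NP_adjoint_def Let_def A_def[symmetric] F_def[symmetric] sp using fr
    by (simp add: rad_def algebra_simps)
  ultimately show ?thesis unfolding Mop_def x_def by (simp add: distrib_right)
qed

text \<open>The equality holds at every point of the plane: on the curves by the absolutely
  convergent expansion, elsewhere because both sides are 0. Measurability and membership in
  \<open>V\<close> follow from those of \<open>asynth\<close>.\<close>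

lemma NP_adjoint_eq:
  assumes \<phi>: "\<phi> \<in> V"
  shows "NP_adjoint \<Psi> r\<^sub>i r\<^sub>e \<phi> = asynth (Mop (coef \<phi>))"
proof
  fix x
  note D = norm_le_l2norm[OF coef_l2[OF \<phi>]]
  define y where "y = Mop (coef \<phi>)"
  have s: "(\<lambda>n. cmod (y (\<beta>, n))) summable_on UNIV" for \<beta>
    using Mop_summable(2)[where y="coef \<phi>", OF D] unfolding summable_on_bool_prod_all y_def by blast
  have eq: "NP_adjoint \<Psi> r\<^sub>i r\<^sub>e \<phi> x = synth (rad \<beta>) (\<lambda>n. y (\<beta>, n)) x" if x_in: "x \<in> level_curve (rad \<beta>)" for \<beta>
  proof -
    obtain \<theta> where x: "x = curve (rad \<beta>) \<theta>" using level_curveE[OF rad(3) x_in] by blast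
    have "of_real (speed (rad \<beta>) \<theta>) * NP_adjoint \<Psi> r\<^sub>i r\<^sub>e \<phi> x = pull (rad \<beta>) (synth (rad \<beta>) (\<lambda>n. y (\<beta>, n))) \<theta>"
      using has_sum_unique[OF NP_adjoint_curve[OF \<phi>, of \<beta> \<theta>] synth_curve(1)[OF rad(3) s, of \<beta> \<theta>, unfolded y_def]]
      by (simp add: x y_def)
    then show ?thesis using speed_pos[OF rad(3), of \<beta> \<theta>] by (simp add: pull_def x)
  qed
  have out: "NP_adjoint \<Psi> r\<^sub>i r\<^sub>e \<phi> x = 0" if "x \<notin> level_curve r\<^sub>i" "x \<notin> level_curve r\<^sub>e"
    using that frontier_annulus[OF radii_pos(3) re] by (simp add: NP_adjoint_def)
  show "NP_adjoint \<Psi> r\<^sub>i r\<^sub>e \<phi> x = asynth (Mop (coef \<phi>)) x"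
    using eq[of True] eq[of False] out unfolding asynth_def y_def
    by (auto simp: rad_def synth_def)
qed

lemma NP_adjoint_coef:
  assumes \<phi>: "\<phi> \<in> V"
  shows "NP_adjoint \<Psi> r\<^sub>i r\<^sub>e \<phi> \<in> V" "coef (NP_adjoint \<Psi> r\<^sub>i r\<^sub>e \<phi>) = Mop (coef \<phi>)"
proof -
  note D = norm_le_l2norm[OF coef_l2[OF \<phi>]]
  show "NP_adjoint \<Psi> r\<^sub>i r\<^sub>e \<phi> \<in> V" "coef (NP_adjoint \<Psi> r\<^sub>i r\<^sub>e \<phi>) = Mop (coef \<phi>)"
    unfolding NP_adjoint_eq[OF \<phi>] using asynth[OF Mop_summable(2)[where y="coef \<phi>", OF D]] by auto
qed

end

section \<open>Resolvents in Fourier coordinates\<close>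

context conformal_annulus_map
begin

section \<open>Square-summable sequences\<close>

lemma l2_mono:
  assumes "l2 y" "\<And>j. cmod (x j) \<le> cmod (y j)"
  shows "l2 x" "l2norm x \<le> l2norm y"
proof -
  have le: "(cmod (x j))\<^sup>2 \<le> (cmod (y j))\<^sup>2" for j by (rule power_mono[OF assms(2)]) simp
  show x: "l2 x" unfolding l2_def
    by (rule summable_on_comparison_test[OF assms(1)[unfolded l2_def]]) (use le in auto)
  show "l2norm x \<le> l2norm y" unfolding l2norm_def
    using x assms(1) le by (intro real_sqrt_le_mono infsum_mono) (auto simp: l2_def)
qed

lemma l2_add:
  assumes x: "l2 x" and y: "l2 y"
  shows "l2 (\<lambda>j. x j + y j)" "l2norm (\<lambda>j. x j + y j) \<le> l2norm x + l2norm y"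
proof -
  have fin: "(\<Sum>j\<in>F. (cmod (x j + y j))\<^sup>2) \<le> (l2norm x + l2norm y)\<^sup>2" if "finite F" for F
  proof -
    have le: "L2_set (\<lambda>j. cmod (z j)) F \<le> l2norm z" if "l2 z" for z
      unfolding L2_set_def l2norm_def
      by (intro real_sqrt_le_mono finite_sum_le_infsum) (use that \<open>finite F\<close> in \<open>auto simp: l2_def\<close>)
    have "L2_set (\<lambda>j. cmod (x j + y j)) F \<le> L2_set (\<lambda>j. cmod (x j) + cmod (y j)) F"
      by (rule L2_set_mono) (auto intro: norm_triangle_ineq)
    also have "\<dots> \<le> L2_set (\<lambda>j. cmod (x j)) F + L2_set (\<lambda>j. cmod (y j)) F"
      by (rule L2_set_triangle_ineq)
    also have "\<dots> \<le> l2norm x + l2norm y" by (intro add_mono le x y)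
    finally have "(L2_set (\<lambda>j. cmod (x j + y j)) F)\<^sup>2 \<le> (l2norm x + l2norm y)\<^sup>2"
      by (rule power_mono) (simp add: L2_set_nonneg)
    then show ?thesis by (simp add: L2_set_def sum_nonneg)
  qed
  show s: "l2 (\<lambda>j. x j + y j)" unfolding l2_def
  proof (rule nonneg_bdd_above_summable_on)
    show "bdd_above (sum (\<lambda>j. (cmod (x j + y j))\<^sup>2) ` {F. F \<subseteq> UNIV \<and> finite F})"
      using fin by (intro bdd_aboveI[where M="(l2norm x + l2norm y)\<^sup>2"]) auto
  qed auto
  have "(\<Sum>\<^sub>\<infinity>j. (cmod (x j + y j))\<^sup>2) \<le> (l2norm x + l2norm y)\<^sup>2"
    by (rule infsum_le_finite_sums) (use s fin in \<open>auto simp: l2_def\<close>)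
  moreover have "l2norm z \<ge> 0" for z by (simp add: l2norm_def infsum_nonneg)
  ultimately show "l2norm (\<lambda>j. x j + y j) \<le> l2norm x + l2norm y"
    unfolding l2norm_def[of "\<lambda>j. x j + y j"] by (intro real_le_lsqrt) (auto simp: infsum_nonneg)
qed

lemma l2_cmult:
  assumes "l2 x"
  shows "l2 (\<lambda>j. s * x j)" "l2norm (\<lambda>j. s * x j) = cmod s * l2norm x"
proof -
  have e: "(\<lambda>j. (cmod (s * x j))\<^sup>2) = (\<lambda>j. (cmod s)\<^sup>2 * (cmod (x j))\<^sup>2)"
    by (simp add: norm_mult power_mult_distrib)
  show "l2 (\<lambda>j. s * x j)" using assms unfolding l2_def e by (rule summable_on_cmult_right)
  show "l2norm (\<lambda>j. s * x j) = cmod s * l2norm x"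
    using infsum_cmult_right[of "(cmod s)\<^sup>2" "\<lambda>j. (cmod (x j))\<^sup>2" UNIV] assms
    unfolding l2norm_def e l2_def by (simp add: real_sqrt_mult)
qed

lemma l2_linear: "l2 x \<Longrightarrow> l2 y \<Longrightarrow> l2 (\<lambda>j. s * x j + t * y j)"
  by (intro l2_add(1) l2_cmult(1))

lemma l2norm_nonneg [simp]: "l2norm y \<ge> 0"
  by (simp add: l2norm_def infsum_nonneg)

lemma Mop_linear:
  assumes "l2 x" "l2 y"
  shows "Mop (\<lambda>j. s * x j + t * y j) = (\<lambda>j. s * Mop x j + t * Mop y j)"
proof -
  note sx = Mop_summable(1)[where y=x, OF norm_le_l2norm[OF assms(1)]]
  note sy = Mop_summable(1)[where y=y, OF norm_le_l2norm[OF assms(2)]]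
  have "(\<Sum>\<^sub>\<infinity>n. Mat \<sigma> \<beta> m n * (s * x (\<beta>, n) + t * y (\<beta>, n)))
     = s * (\<Sum>\<^sub>\<infinity>n. Mat \<sigma> \<beta> m n * x (\<beta>, n)) + t * (\<Sum>\<^sub>\<infinity>n. Mat \<sigma> \<beta> m n * y (\<beta>, n))" for \<sigma> \<beta> m
  proof -
    have "((\<lambda>n. s * (Mat \<sigma> \<beta> m n * x (\<beta>, n)) + t * (Mat \<sigma> \<beta> m n * y (\<beta>, n))) has_sum
       (s * (\<Sum>\<^sub>\<infinity>n. Mat \<sigma> \<beta> m n * x (\<beta>, n)) + t * (\<Sum>\<^sub>\<infinity>n. Mat \<sigma> \<beta> m n * y (\<beta>, n)))) UNIV"
      by (intro has_sum_add has_sum_cmult_right has_sum_infsum sx sy)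
    then show ?thesis by (simp add: algebra_simps infsumI)
  qed
  then show ?thesis by (auto simp: Mop_def fun_eq_iff algebra_simps)
qed

text \<open>
  Since \<open>Mop\<close> maps bounded sequences to summable ones, the solution of \<open>l y - Mop y = x\<close> is \<open>x / l\<close> plus
  a summable sequence. So only absolutely convergent series have to be summed to a density, and the
  Riesz-Fischer theorem is not needed.
\<close>

lemma not_in_NP_spectrum:
  assumes "l \<noteq> 0"
    and ex: "\<And>x. l2 x \<Longrightarrow> \<exists>y. l2 y \<and> (\<forall>j. l * y j - Mop y j = x j) \<and> l2norm y \<le> L * l2norm x"
    and uniq: "\<And>y. l2 y \<Longrightarrow> (\<And>j. l * y j - Mop y j = 0) \<Longrightarrow> y = (\<lambda>_. 0)"
  shows "l \<notin> NP_spectrum \<Psi> r\<^sub>i r\<^sub>e"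
proof -
  define T where "T = NP_adjoint \<Psi> r\<^sub>i r\<^sub>e"
  have T: "T f \<in> V" "coef (T f) = Mop (coef f)" if "f \<in> V" for f
    using NP_adjoint_coef[OF that] by (simp_all add: T_def)
  define R where "R x = (SOME y. l2 y \<and> (\<forall>j. l * y j - Mop y j = x j) \<and> l2norm y \<le> L * l2norm x)" for x
  have R: "l2 (R x)" "\<And>j. l * R x j - Mop (R x) j = x j" "l2norm (R x) \<le> L * l2norm x" if "l2 x" for x
    using someI_ex[OF ex[OF that]] unfolding R_def by auto
  \<comment> \<open>\<open>R\<close> is a mere choice of solutions; uniqueness is what makes it
    linear.\<close>
  have Ru: "y = R x" if "l2 y" "l2 x" "\<And>j. l * y j - Mop y j = x j" for x y
  proof -
    have "l2 (\<lambda>j. 1 * y j + (- 1) * R x j)" by (rule l2_linear[OF that(1) R(1)[OF that(2)]])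
    moreover have "l * (1 * y j + (- 1) * R x j) - Mop (\<lambda>j. 1 * y j + (- 1) * R x j) j = 0" for j
      using that(3)[of j] R(2)[OF that(2), of j]
      unfolding Mop_linear[OF that(1) R(1)[OF that(2)]] by (simp add: algebra_simps)
    ultimately have "(\<lambda>j. 1 * y j + (- 1) * R x j) = (\<lambda>_. 0)" by (rule uniq)
    then have "1 * y j + (- 1) * R x j = 0" for j by (rule fun_cong)
    then show ?thesis by (auto simp: fun_eq_iff)
  qed
  have Rlin: "R (\<lambda>j. s * x j + t * y j) = (\<lambda>j. s * R x j + t * R y j)" if "l2 x" "l2 y" for x y s t
  proof (rule Ru[symmetric])
    show "l * (s * R x j + t * R y j) - Mop (\<lambda>j. s * R x j + t * R y j) j = s * x j + t * y j" for j
      unfolding Mop_linear[OF R(1)[OF that(1)] R(1)[OF that(2)]]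
        R(2)[OF that(1), of j, symmetric] R(2)[OF that(2), of j, symmetric]
      by (simp add: algebra_simps)
  qed (intro l2_linear R that)+
  define S where "S f = (\<lambda>z. (1 / l) * f z + (1 / l) * asynth (Mop (R (coef f))) z)" for f
  have S: "S f \<in> V" "coef (S f) = R (coef f)" if f: "f \<in> V" for f
  proof -
    have s: "(\<lambda>j. cmod (Mop (R (coef f)) j)) summable_on UNIV"
      by (rule Mop_summable(2)[where y="R (coef f)", OF norm_le_l2norm[OF R(1)[OF coef_l2[OF f]]]])
    show "S f \<in> V" unfolding S_def by (rule coef_linear(1)[OF f asynth(1)[OF s]])
    have "coef (S f) = (\<lambda>j. (1 / l) * coef f j + (1 / l) * Mop (R (coef f)) j)"
      unfolding S_def coef_linear(2)[OF f asynth(1)[OF s]] asynth(2)[OF s] ..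
    also have "\<dots> = R (coef f)"
    proof
      fix j
      show "(1 / l) * coef f j + (1 / l) * Mop (R (coef f)) j = R (coef f) j"
        using R(2)[OF coef_l2[OF f], of j, symmetric] \<open>l \<noteq> 0\<close> by (simp add: field_simps)
    qed
    finally show "coef (S f) = R (coef f)" .
  qed
  have lin: "(\<lambda>x. f x + g x) \<in> V" "coef (\<lambda>x. f x + g x) = (\<lambda>j. coef f j + coef g j)"
    "(\<lambda>x. c * f x) \<in> V" "coef (\<lambda>x. c * f x) = (\<lambda>j. c * coef f j)"
    "(\<lambda>x. f x - g x) \<in> V" "coef (\<lambda>x. f x - g x) = (\<lambda>j. coef f j - coef g j)"
    if "f \<in> V" "g \<in> V" for f g c
    using coef_linear[OF that, of 1 1] coef_linear[OF that, of c 0] coef_linear[OF that, of 1 "-1"] by simp_all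
  have zero: "dnorm (\<lambda>x. f x - g x) = 0" if "f \<in> V" "g \<in> V" "coef f = coef g" for f g
    using that lin(5,6)[OF that(1,2)] by (simp add: dnorm_zero_iff)
  have lf: "(\<lambda>y. l * f y - T f y) \<in> V" "coef (\<lambda>y. l * f y - T f y) = (\<lambda>j. l * coef f j - Mop (coef f) j)" if f: "f \<in> V" for f
    using coef_minus[OF f T(1)[OF f], of l] T(2)[OF f] by simp_all
  have "bounded_operator_on V dnorm S"
    unfolding bounded_operator_on_def
  proof (intro conjI ballI allI)
    fix f g assume fg: "f \<in> V" "g \<in> V"
    show "dnorm (\<lambda>x. S (\<lambda>y. f y + g y) x - (S f x + S g x)) = 0"
      using fg Rlin[OF coef_l2 coef_l2, of f g 1 1] by (intro zero lin S) (simp_all add: S lin)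
  next
    fix f c assume f: "f \<in> V"
    show "dnorm (\<lambda>x. S (\<lambda>y. c * f y) x - c * S f x) = 0"
      using f Rlin[OF coef_l2 coef_l2, of f f c 0] by (intro zero lin S) (simp_all add: S lin(3,4)[OF f f] lin(4)[OF S(1)[OF f] f])
  next
    show "\<exists>C. \<forall>f\<in>V. dnorm (S f) \<le> C * dnorm f"
      using R(3) by (intro exI[of _ L]) (simp add: dnorm_eq S coef_l2)
  qed (use S in auto)
  moreover have "dnorm (\<lambda>x. S (\<lambda>y. l * f y - T f y) x - f x) = 0 \<and> dnorm (\<lambda>x. (l * S f x - T (S f) x) - f x) = 0"
    if f: "f \<in> V" for f
  proof
    have "coef f = R (coef (\<lambda>y. l * f y - T f y))"
      by (rule Ru[OF coef_l2[OF f] coef_l2[OF lf(1)[OF f]]]) (simp add: lf(2)[OF f])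
    then show "dnorm (\<lambda>x. S (\<lambda>y. l * f y - T f y) x - f x) = 0"
      using f lf[OF f] S by (intro zero) auto
    show "dnorm (\<lambda>x. (l * S f x - T (S f) x) - f x) = 0"
      by (rule zero) (use lf[OF S(1)[OF f]] S[OF f] f R(2)[OF coef_l2[OF f]] in auto)
  qed
  ultimately show ?thesis
    unfolding NP_spectrum_def operator_spectrum_def T_def by blast
qed

section \<open>The resolvent on coefficients of densities\<close>

text \<open>The sequences that come from actual densities; only on these does the inverse in the
  definition of the spectrum act. Equality with l2 would be Riesz-Fischer; it is enough that
  \<open>X\<close> is a linear space containing the absolutely summable sequences.\<close>

definition X :: "(bool \<times> int \<Rightarrow> complex) set" where "X = coef ` V"

lemma X_l2: "x \<in> X \<Longrightarrow> l2 x"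
  using coef_l2 by (auto simp: X_def)

lemma X_linear: "x \<in> X \<Longrightarrow> y \<in> X \<Longrightarrow> (\<lambda>j. s * x j + t * y j) \<in> X"
  unfolding X_def by (safe, subst coef_linear(2)[symmetric]) (auto intro: coef_linear(1))

lemma X_summable: "(\<lambda>j. cmod (y j)) summable_on UNIV \<Longrightarrow> y \<in> X"
  unfolding X_def using asynth[of y] by (metis imageI)

text \<open>The inverse acts on representatives and satisfies its identities up to functions of norm
  0. Two densities differ by such a function exactly if their coefficients agree, so in coefficients
  the identities become exact.\<close>

lemma resolvent_on_X:
  assumes "l \<notin> NP_spectrum \<Psi> r\<^sub>i r\<^sub>e"
  obtains R L where "L \<ge> 0"
    "\<And>x. x \<in> X \<Longrightarrow> R x \<in> X" "\<And>x j. x \<in> X \<Longrightarrow> l * R x j - Mop (R x) j = x j"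
    "\<And>x. x \<in> X \<Longrightarrow> l2norm (R x) \<le> L * l2norm x"
    "\<And>x y. \<lbrakk>x \<in> X; y \<in> X; \<And>j. l * y j - Mop y j = x j\<rbrakk> \<Longrightarrow> y = R x"
proof -
  define T where "T = NP_adjoint \<Psi> r\<^sub>i r\<^sub>e"
  have T: "T f \<in> V" "coef (T f) = Mop (coef f)" if "f \<in> V" for f
    using NP_adjoint_coef[OF that] by (simp_all add: T_def)
  obtain S where S: "bounded_operator_on V dnorm S"
    "\<And>f. f \<in> V \<Longrightarrow> dnorm (\<lambda>x. S (\<lambda>y. l * f y - T f y) x - f x) = 0"
    "\<And>f. f \<in> V \<Longrightarrow> dnorm (\<lambda>x. (l * S f x - T (S f) x) - f x) = 0"
    using assms unfolding NP_spectrum_def operator_spectrum_def T_def by blast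
  obtain L where L: "\<And>f. f \<in> V \<Longrightarrow> dnorm (S f) \<le> L * dnorm f"
    using S(1) unfolding bounded_operator_on_def by blast
  have SV: "S f \<in> V" if "f \<in> V" for f using S(1) that unfolding bounded_operator_on_def by blast
  have lf: "(\<lambda>y. l * f y - T f y) \<in> V" "coef (\<lambda>y. l * f y - T f y) = (\<lambda>j. l * coef f j - Mop (coef f) j)" if f: "f \<in> V" for f
    using coef_minus[OF f T(1)[OF f], of l] T(2)[OF f] by simp_all
  have eq: "coef f = coef g" if "f \<in> V" "g \<in> V" "dnorm (\<lambda>x. f x - g x) = 0" for f g
  proof -
    have "(\<lambda>j. coef f j - coef g j) = (\<lambda>_. 0)"
      using that coef_minus[of f g 1] by (simp add: dnorm_zero_iff)
    then show ?thesis by (simp add: fun_eq_iff)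
  qed
  \<comment> \<open>The norm bound of \<open>S\<close> shows that \<open>S\<close> respects the
    quotient by functions of norm 0; uniqueness rests on this.\<close>
  have small: "coef (S f) = (\<lambda>_. 0)" if "f \<in> V" "coef f = (\<lambda>_. 0)" for f
  proof -
    have "dnorm f = 0" using that dnorm_zero_iff by blast
    then have "dnorm (S f) \<le> 0" using L[OF that(1)] by simp
    moreover have "dnorm (S f) \<ge> 0" using SV[OF that(1)] by (simp add: dnorm_eq)
    ultimately show ?thesis using dnorm_zero_iff[OF SV[OF that(1)]] by simp
  qed
  define F where "F x = (SOME f. f \<in> V \<and> coef f = x)" for x
  have F: "F x \<in> V" "coef (F x) = x" if "x \<in> X" for x
    using someI_ex[of "\<lambda>f. f \<in> V \<and> coef f = x"] that unfolding F_def X_def by blast+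
  define R where "R x = coef (S (F x))" for x
  show thesis
  proof (rule that[of "max 0 L" R])
    show "R x \<in> X" if "x \<in> X" for x using SV[OF F(1)[OF that]] by (simp add: R_def X_def)
    show Req: "l * R x j - Mop (R x) j = x j" if "x \<in> X" for x j
    proof -
      have "coef (\<lambda>y. l * S (F x) y - T (S (F x)) y) = coef (F x)"
        by (rule eq[OF lf(1)[OF SV[OF F(1)[OF that]]] F(1)[OF that] S(3)[OF F(1)[OF that]]])
      then show ?thesis
        using fun_cong[OF lf(2)[OF SV[OF F(1)[OF that]]], of j] F(2)[OF that] by (simp add: R_def)
    qed
    show "l2norm (R x) \<le> max 0 L * l2norm x" if "x \<in> X" for x
    proof -
      have "l2norm (R x) \<le> L * l2norm x"
        using L[OF F(1)[OF that]] F[OF that] SV by (simp add: R_def dnorm_eq)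
      also have "\<dots> \<le> max 0 L * l2norm x" by (intro mult_right_mono) auto
      finally show ?thesis .
    qed
    show "y = R x" if "x \<in> X" "y \<in> X" "\<And>j. l * y j - Mop y j = x j" for x y
    proof -
      define z where "z = (\<lambda>j. 1 * y j + (- 1) * R x j)"
      have RX: "R x \<in> X" using SV[OF F(1)[OF that(1)]] by (simp add: R_def X_def)
      have z: "z \<in> X" unfolding z_def by (rule X_linear[OF that(2) RX])
      have "l * z j - Mop z j = 0" for j
        using that(3)[of j] Req[OF that(1), of j] unfolding z_def Mop_linear[OF X_l2[OF that(2)] X_l2[OF RX]]
        by (simp add: algebra_simps)
      then have "coef (\<lambda>y. l * F z y - T (F z) y) = (\<lambda>_. 0)"
        using lf(2)[OF F(1)[OF z]] F(2)[OF z] by simp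
      then have "coef (S (\<lambda>y. l * F z y - T (F z) y)) = (\<lambda>_. 0)"
        by (rule small[OF lf(1)[OF F(1)[OF z]]])
      moreover have "coef (S (\<lambda>y. l * F z y - T (F z) y)) = coef (F z)"
        by (rule eq[OF SV[OF lf(1)[OF F(1)[OF z]]] F(1)[OF z] S(2)[OF F(1)[OF z]]])
      ultimately have "z = (\<lambda>_. 0)" using F(2)[OF z] by simp
      then have "1 * y j + (- 1) * R x j = 0" for j unfolding z_def by (rule fun_cong)
      then show ?thesis by (auto simp: fun_eq_iff)
    qed
  qed simp
qed

text \<open>Uniqueness at \<open>l\<close> gives the resolvent identity
  \<open>y m = y l + (l - m) R (y m)\<close>; it yields a local bound, then continuity of
  \<open>R (y m)\<close>, then the derivative \<open>- R (y l)\<close>. Differentiability is meant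
  within \<open>U\<close>, which may be closed: for a closed disc, continuity up to the circle is
  included.\<close>

lemma resolvent_holomorphic:
  assumes U: "U \<inter> NP_spectrum \<Psi> r\<^sub>i r\<^sub>e = {}" and x: "x \<in> X"
  obtains y where "\<And>l. l \<in> U \<Longrightarrow> y l \<in> X" "\<And>l j. l \<in> U \<Longrightarrow> l * y l j - Mop (y l) j = x j"
    "\<And>j. (\<lambda>l. y l j) holomorphic_on U"
proof -
  define y where "y l = (SOME y. y \<in> X \<and> (\<forall>j. l * y j - Mop y j = x j))" for l
  have y: "y l \<in> X" "\<And>j. l * y l j - Mop (y l) j = x j" if "l \<in> U" for l
  proof -
    have "l \<notin> NP_spectrum \<Psi> r\<^sub>i r\<^sub>e" using that U by auto
    then obtain R L where "R x \<in> X" "\<And>j. l * R x j - Mop (R x) j = x j" using resolvent_on_X x by metis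
    then have "\<exists>y. y \<in> X \<and> (\<forall>j. l * y j - Mop y j = x j)" by blast
    from someI_ex[OF this] show "y l \<in> X" "\<And>j. l * y l j - Mop (y l) j = x j" unfolding y_def by auto
  qed
  have "(\<lambda>l. y l j) field_differentiable (at l within U)" if l: "l \<in> U" for l j
  proof -
    have "l \<notin> NP_spectrum \<Psi> r\<^sub>i r\<^sub>e" using l U by auto
    then obtain R L where L: "L \<ge> 0" and RX: "\<And>x. x \<in> X \<Longrightarrow> R x \<in> X"
      and Req: "\<And>x j. x \<in> X \<Longrightarrow> l * R x j - Mop (R x) j = x j"
      and Rb: "\<And>x. x \<in> X \<Longrightarrow> l2norm (R x) \<le> L * l2norm x"
      and Ru: "\<And>x y. \<lbrakk>x \<in> X; y \<in> X; \<And>j. l * y j - Mop y j = x j\<rbrakk> \<Longrightarrow> y = R x"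
      using resolvent_on_X by metis
    have step: "y m = (\<lambda>j. y l j + (l - m) * R (y m) j)" if m: "m \<in> U" for m
    proof -
      have "(\<lambda>j. 1 * y l j + (l - m) * R (y m) j) = R (\<lambda>j. 1 * x j + (l - m) * y m j)"
      proof (rule Ru)
        show "l * (1 * y l j + (l - m) * R (y m) j) - Mop (\<lambda>j. 1 * y l j + (l - m) * R (y m) j) j
            = 1 * x j + (l - m) * y m j" for j
          unfolding Mop_linear[OF X_l2[OF y(1)[OF l]] X_l2[OF RX[OF y(1)[OF m]]]]
            y(2)[OF l, of j, symmetric] Req[OF y(1)[OF m], of j, symmetric]
          by (simp add: algebra_simps)
      qed (intro X_linear x y RX l m)+
      moreover have "y m = R (\<lambda>j. 1 * x j + (l - m) * y m j)"
      proof (rule Ru)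
        show "l * y m j - Mop (y m) j = 1 * x j + (l - m) * y m j" for j
          using y(2)[OF m, of j, symmetric] by (simp add: algebra_simps)
      qed (intro X_linear x y m)+
      ultimately show ?thesis by simp
    qed
    \<comment> \<open>The bound on \<open>cmod (l - m) * L\<close> leaves at most half of
      \<open>l2norm (y m)\<close> on the right of the resolvent identity; absorbing it produces the
      factor 2.\<close>
    define Y where "Y = 2 * l2norm (y l)"
    have Y: "l2norm (y m) \<le> Y" if m: "m \<in> U" and near: "cmod (l - m) * L \<le> 1 / 2" for m
    proof -
      have "l2norm (y m) \<le> l2norm (y l) + l2norm (\<lambda>j. (l - m) * R (y m) j)"
        by (subst step[OF m]) (intro l2_add l2_cmult X_l2 RX y l m)
      also have "l2norm (\<lambda>j. (l - m) * R (y m) j) = cmod (l - m) * l2norm (R (y m))"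
        by (intro l2_cmult X_l2 RX y m)
      also have "\<dots> \<le> cmod (l - m) * (L * l2norm (y m))"
        by (intro mult_left_mono Rb y m) auto
      also have "\<dots> \<le> 1 / 2 * l2norm (y m)"
        using mult_right_mono[OF near l2norm_nonneg[of "y m"]] by (simp add: mult.assoc)
      finally show ?thesis by (simp add: Y_def)
    qed
    \<comment> \<open>The resolvent identity once more, after \<open>R\<close> has been applied to
      it.\<close>
    have cont: "cmod (R (y m) j - R (y l) j) \<le> cmod (l - m) * (L * (L * Y))"
      if m: "m \<in> U" and near: "cmod (l - m) * L \<le> 1 / 2" for m
    proof -
      define z where "z = R (y m)"
      have zX: "z \<in> X" unfolding z_def by (intro RX y m)
      have ymj: "y m j = y l j + (l - m) * z j" for j
        using fun_cong[OF step[OF m], of j] by (simp add: z_def)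
      have Rlin: "(\<lambda>j. 1 * R (y l) j + (l - m) * R z j) = R (y m)"
      proof (rule Ru)
        show "l * (1 * R (y l) j + (l - m) * R z j) - Mop (\<lambda>j. 1 * R (y l) j + (l - m) * R z j) j = y m j" for j
          unfolding Mop_linear[OF X_l2[OF RX[OF y(1)[OF l]]] X_l2[OF RX[OF zX]]]
            ymj Req[OF y(1)[OF l], of j, symmetric] Req[OF zX, of j, symmetric]
          by (simp add: algebra_simps)
      qed (intro X_linear RX zX y l m)+
      have "R (y m) j - R (y l) j = (l - m) * R z j"
        using fun_cong[OF Rlin, of j] by (simp add: algebra_simps)
      also have "cmod \<dots> \<le> cmod (l - m) * l2norm (R z)"
        by (simp add: norm_mult mult_left_mono norm_le_l2norm X_l2 RX zX)
      also have "l2norm (R z) \<le> L * (L * Y)"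
      proof -
        have "l2norm (R z) \<le> L * l2norm z" by (rule Rb[OF zX])
        also have "l2norm z \<le> L * l2norm (y m)" unfolding z_def by (intro Rb y m)
        also have "l2norm (y m) \<le> Y" by (rule Y[OF m near])
        finally show ?thesis using L by (simp add: mult_left_mono)
      qed
      finally show ?thesis by (simp add: mult_left_mono)
    qed
    have "((\<lambda>m. (y m j - y l j) / (m - l)) \<longlongrightarrow> - R (y l) j) (at l within U)"
    proof (rule LIM_zero_cancel, rule Lim_null_comparison)
      have "((\<lambda>m. cmod (l - m) * L) \<longlongrightarrow> cmod (l - l) * L) (at l within U)"
        by (intro tendsto_intros)
      then have "\<forall>\<^sub>F m in at l within U. cmod (l - m) * L < 1 / 2" by (rule order_tendstoD) simp
      moreover have "\<forall>\<^sub>F m in at l within U. m \<in> U \<and> m \<noteq> l" by (auto simp: eventually_at intro: exI[of _ 1])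
      ultimately show "\<forall>\<^sub>F m in at l within U. cmod ((y m j - y l j) / (m - l) - - R (y l) j) \<le> cmod (l - m) * (L * (L * Y))"
      proof eventually_elim
        case (elim m)
        have "(y m j - y l j) / (m - l) - - R (y l) j = - (R (y m) j - R (y l) j)"
          using fun_cong[OF step[of m], of j] elim by (simp add: field_simps)
        then show ?case using cont[of m] elim by (simp add: norm_minus_commute)
      qed
      have "((\<lambda>m. cmod (l - m) * (L * (L * Y))) \<longlongrightarrow> cmod (l - l) * (L * (L * Y))) (at l within U)"
        by (intro tendsto_intros)
      then show "((\<lambda>m. cmod (l - m) * (L * (L * Y))) \<longlongrightarrow> 0) (at l within U)" by simp
    qed
    then have "((\<lambda>l. y l j) has_field_derivative - R (y l) j) (at l within U)"
      by (simp add: has_field_derivative_iff)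
    then show ?thesis by (auto simp: field_differentiable_def)
  qed
  then have "(\<lambda>l. y l j) holomorphic_on U" for j by (simp add: holomorphic_on_def)
  then show thesis using that[of y] y by blast
qed

end

section \<open>Diagonalization up to a small perturbation\<close>

lemma int_power_nonneg: "0 \<le> x \<Longrightarrow> 0 \<le> int_power x m"
  by (simp add: int_power_def)

lemma int_power_pos: "0 < x \<Longrightarrow> 0 < int_power x m"
  by (simp add: int_power_def)

lemma int_power_mult: "int_power (x * y) m = int_power x m * int_power y m"
  by (simp add: int_power_def power_mult_distrib)

lemma int_power_le_one: "0 \<le> x \<Longrightarrow> x \<le> 1 \<Longrightarrow> int_power x m \<le> 1"
  by (simp add: int_power_def power_le_one)

lemma one_minus_power_le:
  fixes x :: real
  assumes "0 \<le> x"
  shows "1 - x ^ k \<le> real k * (1 - x)"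
  using Bernoulli_inequality[of "x - 1" k] assms by (simp add: algebra_simps)

context expanded_exterior_map
begin

definition decay :: real where "decay = b / r\<^sub>i"

lemma decay: "0 < decay" "decay < 1"
  using b radii_pos by (auto simp: decay_def)

text \<open>The factor \<open>1 + \<bar>m\<bar>\<close> pays for \<open>r\<^sub>i ^ -m - r\<^sub>e ^ -m \<le> m (1 - r) r\<^sub>i ^ -m\<close>.\<close>

definition wt :: "bool \<times> int \<Rightarrow> real" where
  "wt j = (1 + real_of_int \<bar>snd j\<bar>) * int_power decay (snd j)"

text \<open>The extra factor \<open>1 + \<bar>m\<bar>\<close> makes room for inverse distances to
  the diagonal entries that grow linearly in the frequency, as happens on the small circles around
  \<open>r ^ n / 2\<close>.\<close>

definition kappa :: real where
  "kappa = (\<Sum>\<^sub>\<infinity>j. (wt j)\<^sup>2 * (1 + real_of_int \<bar>snd j\<bar>))"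

lemma wt_pos: "wt j > 0"
  unfolding wt_def using decay by (intro mult_pos_pos int_power_pos) auto

lemma kappa_summable: "(\<lambda>j. (wt j)\<^sup>2 * (1 + real_of_int \<bar>snd j\<bar>)) summable_on UNIV"
proof -
  \<comment> \<open>The summand is \<open>(1 + k) ^ 3\<close> times two powers of
    \<open>decay\<close>. One power is kept for convergence; the other, written as a cube, bounds
    the polynomial factor through \<open>((1 + k) * \<tau> ^ k) ^ 3\<close>.\<close>
  define \<tau> where "\<tau> = root 3 decay"
  have \<tau>: "0 < \<tau>" "\<tau> < 1" "\<tau> ^ 3 = decay"
    using decay by (auto simp: \<tau>_def)
  have "(\<lambda>n. real n * \<tau> ^ n + \<tau> ^ n) \<longlonglongrightarrow> 0 + 0"
    using \<tau> by (intro tendsto_add powser_times_n_limit_0 LIMSEQ_power_zero) auto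
  then have "Bseq (\<lambda>n. real n * \<tau> ^ n + \<tau> ^ n)" by (intro convergent_imp_Bseq) (auto simp: convergent_def)
  then obtain L where L: "L > 0" "\<And>n. \<bar>real n * \<tau> ^ n + \<tau> ^ n\<bar> \<le> L" by (auto elim!: BseqE)
  have le: "(wt (\<beta>, m))\<^sup>2 * (1 + real_of_int \<bar>m\<bar>) \<le> L ^ 3 * int_power decay m" for \<beta> m
  proof -
    define k where "k = nat \<bar>m\<bar>"
    have k: "real_of_int \<bar>m\<bar> = real k" by (simp add: k_def)
    have "(wt (\<beta>, m))\<^sup>2 * (1 + real_of_int \<bar>m\<bar>) = ((1 + real k) ^ 3 * (\<tau> ^ k) ^ 3) * int_power decay m"
      unfolding wt_def int_power_def snd_conv k k_def[symmetric] \<tau>(3)[symmetric]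
      by (simp add: power2_eq_square power3_eq_cube power_mult_distrib)
    also have "(1 + real k) ^ 3 * (\<tau> ^ k) ^ 3 = (real k * \<tau> ^ k + \<tau> ^ k) ^ 3"
      by (simp add: algebra_simps flip: power_mult_distrib)
    also have "\<dots> \<le> L ^ 3"
      using L(2)[of k] \<tau> by (intro power_mono) auto
    finally show ?thesis using decay by (simp add: int_power_nonneg mult_right_mono)
  qed
  have s: "(\<lambda>m. L ^ 3 * int_power decay m) summable_on UNIV"
    using decay by (intro summable_on_cmult_right int_power_has_sum) auto
  show ?thesis
    unfolding summable_on_bool_prod_all
  proof
    fix \<beta>
    show "(\<lambda>m. (wt (\<beta>, m))\<^sup>2 * (1 + real_of_int \<bar>snd (\<beta>, m)\<bar>)) summable_on UNIV"
      by (rule summable_on_comparison_test[OF s]) (use le in auto)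
  qed
qed

lemma wt_square_summable: "(\<lambda>j. (wt j)\<^sup>2) summable_on UNIV"
  by (rule summable_on_comparison_test[OF kappa_summable]) (auto simp: mult_le_cancel_left1)

lemma infsum_wt_square_le: "(\<Sum>\<^sub>\<infinity>j. (wt j)\<^sup>2) \<le> kappa"
  unfolding kappa_def
  by (rule infsum_mono[OF wt_square_summable kappa_summable]) (auto simp: mult_le_cancel_left1)

end

context conformal_annulus_map
begin

definition del :: real where "del = sqrt (1 - ratio)"

lemma del: "0 < del" "del \<le> 1" "del\<^sup>2 = 1 - ratio"
  using ratio by (auto simp: del_def)

definition hat :: "(bool \<times> int \<Rightarrow> complex) \<Rightarrow> bool \<times> int \<Rightarrow> complex" where
  "hat y = (\<lambda>(\<beta>, m). if \<beta> then y (True, m) + y (False, m) else of_real del * (y (True, m) - y (False, m)))"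

definition unhat :: "(bool \<times> int \<Rightarrow> complex) \<Rightarrow> bool \<times> int \<Rightarrow> complex" where
  "unhat z = (\<lambda>(\<beta>, m). (z (True, m) + of_real (if \<beta> then 1 else - 1) * z (False, m) / of_real del) / 2)"

lemma unhat_hat: "unhat (hat y) = y"
proof
  fix j :: "bool \<times> int"
  obtain \<beta> m where j: "j = (\<beta>, m)" by force
  show "unhat (hat y) j = y j" using del(1) by (cases \<beta>) (simp_all add: j unhat_def hat_def field_simps)
qed

lemma hat_unhat: "hat (unhat z) = z"
proof
  fix j :: "bool \<times> int"
  obtain \<beta> m where j: "j = (\<beta>, m)" by force
  show "hat (unhat z) j = z j" using del(1) by (cases \<beta>) (simp_all add: j unhat_def hat_def field_simps)
qed

lemma hat_linear: "hat (\<lambda>j. s * x j + t * y j) = (\<lambda>j. s * hat x j + t * hat y j)"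
  by (auto simp: hat_def fun_eq_iff algebra_simps)

lemma unhat_diff: "unhat (\<lambda>j. x j - y j) = (\<lambda>j. unhat x j - unhat y j)"
  by (auto simp: unhat_def fun_eq_iff diff_divide_distrib add_divide_distrib algebra_simps)

lemma l2_pair:
  assumes z: "l2 z" and q: "q \<ge> 0"
    and le: "\<And>\<beta> m. cmod (x (\<beta>, m)) \<le> q * (cmod (z (True, m)) + cmod (z (False, m)))"
  shows "l2 x" "l2norm x \<le> 2 * q * l2norm z"
proof -
  define flip where "flip = (\<lambda>(\<beta>, m). (\<not> \<beta>, m :: int))"
  have bij: "bij flip" by (rule o_bij[of flip]) (auto simp: flip_def)
  define u v where "u j = complex_of_real (cmod (z j))" and "v j = complex_of_real (cmod (z (flip j)))" for j
  have u: "l2 u" "l2norm u = l2norm z" using z by (simp_all add: u_def l2_def l2norm_def)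
  have v: "l2 v" "l2norm v = l2norm z"
    using z summable_on_reindex_bij_betw[OF bij, of "\<lambda>j. (cmod (z j))\<^sup>2"]
      infsum_reindex_bij_betw[OF bij, of "\<lambda>j. (cmod (z j))\<^sup>2"]
    by (simp_all add: v_def l2_def l2norm_def)
  have uv: "l2 (\<lambda>j. u j + v j)" by (intro l2_add u v)
  have bnd: "cmod (x j) \<le> cmod (of_real q * (u j + v j))" for j
  proof -
    obtain \<beta> m where j: "j = (\<beta>, m)" by force
    have "u j + v j = of_real (cmod (z (True, m)) + cmod (z (False, m)))"
      by (cases \<beta>) (simp_all add: j u_def v_def flip_def)
    then have "cmod (of_real q * (u j + v j)) = q * (cmod (z (True, m)) + cmod (z (False, m)))"
      using q by (simp only: norm_mult norm_of_real) simp
    then show ?thesis using le[of \<beta> m] by (simp add: j)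
  qed
  show "l2 x" by (rule l2_mono(1)[OF l2_cmult(1)[OF uv] bnd])
  have "l2norm x \<le> l2norm (\<lambda>j. of_real q * (u j + v j))" by (rule l2_mono(2)[OF l2_cmult(1)[OF uv] bnd])
  also have "\<dots> = q * l2norm (\<lambda>j. u j + v j)" using l2_cmult(2)[OF uv, of "of_real q"] q by simp
  also have "\<dots> \<le> q * (l2norm u + l2norm v)" by (intro mult_left_mono l2_add u v q)
  finally show "l2norm x \<le> 2 * q * l2norm z" by (simp add: u v)
qed

lemma l2_hat:
  assumes "l2 y" shows "l2 (hat y)" "l2norm (hat y) \<le> 2 * l2norm y"
proof -
  have "cmod (hat y (\<beta>, m)) \<le> 1 * (cmod (y (True, m)) + cmod (y (False, m)))" for \<beta> m
  proof (cases \<beta>)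
    case False
    have "cmod (hat y (\<beta>, m)) = del * cmod (y (True, m) - y (False, m))"
      using False del by (simp add: hat_def norm_mult)
    also have "\<dots> \<le> 1 * (cmod (y (True, m)) + cmod (y (False, m)))"
      using del by (intro mult_mono norm_triangle_ineq4) auto
    finally show ?thesis .
  qed (simp add: hat_def norm_triangle_ineq)
  from l2_pair[OF assms _ this] show "l2 (hat y)" "l2norm (hat y) \<le> 2 * l2norm y" by auto
qed

text \<open>The constant blows up as the radii merge. This is harmless: the coordinates only have to
  be equivalent for each fixed \<open>r\<^sub>e\<close>, and the quantitative estimates are made
  after the change.\<close>

lemma l2_unhat:
  assumes "l2 z" shows "l2 (unhat z)" "l2norm (unhat z) \<le> 2 * (1 / del) * l2norm z"
proof -
  have "cmod (unhat z (\<beta>, m)) \<le> (1 / del) * (cmod (z (True, m)) + cmod (z (False, m)))" for \<beta> m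
  proof -
    have "cmod (unhat z (\<beta>, m)) \<le> cmod (z (True, m)) + cmod (z (False, m)) / del"
    proof -
      have "cmod (z (True, m) + of_real (if \<beta> then 1 else - 1) * z (False, m) / of_real del)
         \<le> cmod (z (True, m)) + cmod (z (False, m)) / del"
        using del(1) by (intro norm_triangle_le add_mono) (auto simp: norm_divide)
      then show ?thesis using norm_ge_zero[of "z (True, m) + of_real (if \<beta> then 1 else - 1) * z (False, m) / of_real del"]
        unfolding unhat_def prod.case norm_divide norm_numeral by linarith
    qed
    also have "cmod (z (True, m)) \<le> cmod (z (True, m)) / del"
      using del by (simp add: le_divide_eq mult_left_le)
    finally show ?thesis by (simp add: add_divide_distrib)
  qed
  from l2_pair[OF assms _ this] show "l2 (unhat z)" "l2norm (unhat z) \<le> 2 * (1 / del) * l2norm z"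
    using del(1) by auto
qed

abbreviation pw :: "int \<Rightarrow> real" where "pw \<equiv> int_power (1 / r\<^sub>i)"
abbreviation qw :: "int \<Rightarrow> real" where "qw \<equiv> int_power (1 / r\<^sub>e)"

lemma pw_qw: "qw m = pw m * int_power ratio m" "pw m > 0" "qw m > 0" "qw m \<le> pw m"
    "pw m - qw m \<le> pw m * (real_of_int \<bar>m\<bar> * del\<^sup>2)"
    "int_power b m * pw m = int_power decay m"
proof -
  have e: "1 / r\<^sub>e = (1 / r\<^sub>i) * ratio" using radii_pos by (simp add: ratio_def)
  show q: "qw m = pw m * int_power ratio m" unfolding e int_power_mult ..
  show p: "pw m > 0" "qw m > 0" using radii_pos re by (auto intro!: int_power_pos)
  show "qw m \<le> pw m" using q p int_power_le_one[of ratio m] ratio by (simp add: mult_left_le)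
  have "1 - int_power ratio m \<le> real_of_int \<bar>m\<bar> * (1 - ratio)"
    using one_minus_power_le[of ratio "nat \<bar>m\<bar>"] ratio by (simp add: int_power_def)
  then have "pw m * (1 - int_power ratio m) \<le> pw m * (real_of_int \<bar>m\<bar> * (1 - ratio))"
    using p by (intro mult_left_mono) auto
  then show "pw m - qw m \<le> pw m * (real_of_int \<bar>m\<bar> * del\<^sup>2)" unfolding q del(3) by (simp add: algebra_simps)
  show "int_power b m * pw m = int_power decay m"
    by (simp add: decay_def flip: int_power_mult)
qed

text \<open>The exchange of the two curves has eigenvalue 1 on sums (\<open>True\<close>) and -1 on
  differences (\<open>False\<close>).\<close>

definition Dg :: "bool \<times> int \<Rightarrow> complex" where
  "Dg j = of_real ((if fst j then 1 else - 1) * (int_power ratio (snd j) / 2))"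

text \<open>For each output frequency the regular part reads both components through this one
  number; the two curves receive it multiplied by \<open>- pw m\<close> and
  \<open>qw m\<close>.\<close>

definition G :: "(bool \<times> int \<Rightarrow> complex) \<Rightarrow> int \<Rightarrow> complex" where
  "G y m = (\<Sum>\<^sub>\<infinity>n. C m n * (of_real (pw n) * y (True, n) + of_real (qw n) * y (False, n)))"

text \<open>The outputs \<open>- pw m\<close> and \<open>qw m\<close> times \<open>G\<close> in new
  coordinates: their sum, and \<open>del\<close> times their difference. The first is small by
  cancellation, the second by the factor \<open>del\<close>.\<close>

definition Pop :: "(bool \<times> int \<Rightarrow> complex) \<Rightarrow> bool \<times> int \<Rightarrow> complex" where
  "Pop z = (\<lambda>(\<beta>, m). of_real (if \<beta> then qw m - pw m else - (del * (pw m + qw m))) * G (unhat z) m)"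

text \<open>\<open>1 / 2 + B\<close> is the constant of \<open>C_bound\<close>, and the 2 comes from
  \<open>pw m + qw m \<le> 2 * pw m\<close>.\<close>

definition eta :: real where "eta = 2 * (1 / 2 + B) * del"

text \<open>\<open>unhat\<close> divides the difference coordinate by \<open>del\<close>, but that
  coordinate enters only with the factor \<open>pw n - qw n\<close>, which is
  O(\<open>del\<^sup>2\<close>) at the price of a factor of order \<open>\<bar>n\<bar>\<close>;
  hence the weight.\<close>

lemma G_summand_le:
  "cmod (C m n * (of_real (pw n) * unhat z (True, n) + of_real (qw n) * unhat z (False, n)))
    \<le> (1 / 2 + B) * int_power b m * (wt (True, n) * cmod (z (True, n)) + wt (False, n) * cmod (z (False, n)))"
proof -
  define W where "W = wt (True, n) * cmod (z (True, n)) + wt (False, n) * cmod (z (False, n))"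
  have nn: "int_power b n \<ge> 0" "int_power b m \<ge> 0" using radii_pos by (auto intro: int_power_nonneg less_imp_le)
  have "of_real (pw n) * unhat z (True, n) + of_real (qw n) * unhat z (False, n)
     = of_real ((pw n + qw n) / 2) * z (True, n) + of_real ((pw n - qw n) / (2 * del)) * z (False, n)"
    using del(1) by (simp add: unhat_def field_simps)
  also have "cmod \<dots> \<le> (pw n + qw n) / 2 * cmod (z (True, n)) + (pw n - qw n) / (2 * del) * cmod (z (False, n))"
  proof -
    have "0 \<le> (pw n + qw n) / 2" "0 \<le> (pw n - qw n) / (2 * del)"
      using pw_qw(2-4)[of n] del(1) by auto
    then show ?thesis
      by (intro norm_triangle_le add_mono) (simp_all only: norm_mult norm_of_real abs_of_nonneg order_refl)
  qed
  also have "\<dots> \<le> pw n * ((1 + real_of_int \<bar>n\<bar>) * cmod (z (True, n))) + pw n * ((1 + real_of_int \<bar>n\<bar>) * cmod (z (False, n)))"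
  proof (intro add_mono)
    have "0 \<le> pw n * real_of_int \<bar>n\<bar>" using pw_qw(2)[of n] by simp
    moreover have "(pw n + qw n) / 2 \<le> pw n" using pw_qw(4)[of n] by simp
    ultimately have "(pw n + qw n) / 2 \<le> pw n + pw n * real_of_int \<bar>n\<bar>"
      by (rule add_increasing2)
    then have "(pw n + qw n) / 2 \<le> pw n * (1 + real_of_int \<bar>n\<bar>)"
      by (simp add: distrib_left)
    from mult_right_mono[OF this norm_ge_zero[of "z (True, n)"]]
    show "(pw n + qw n) / 2 * cmod (z (True, n)) \<le> pw n * ((1 + real_of_int \<bar>n\<bar>) * cmod (z (True, n)))"
      by (simp only: mult.assoc)
    have "(pw n - qw n) / (2 * del) \<le> pw n * (real_of_int \<bar>n\<bar> * del\<^sup>2) / (2 * del)"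
      using pw_qw(5)[of n] del(1) by (intro divide_right_mono) auto
    also have "\<dots> = pw n * real_of_int \<bar>n\<bar> * (del / 2)" using del(1) by (simp add: power2_eq_square)
    also have "\<dots> \<le> pw n * real_of_int \<bar>n\<bar> * 1"
      using pw_qw(2)[of n] del by (intro mult_left_mono) auto
    also have "\<dots> \<le> pw n * (1 + real_of_int \<bar>n\<bar>)" using pw_qw(2)[of n] by simp
    finally have "(pw n - qw n) / (2 * del) \<le> pw n * (1 + real_of_int \<bar>n\<bar>)" .
    from mult_right_mono[OF this norm_ge_zero[of "z (False, n)"]]
    show "(pw n - qw n) / (2 * del) * cmod (z (False, n)) \<le> pw n * ((1 + real_of_int \<bar>n\<bar>) * cmod (z (False, n)))"
      by (simp only: mult.assoc)
  qed
  finally have *: "cmod (of_real (pw n) * unhat z (True, n) + of_real (qw n) * unhat z (False, n)) \<le>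
     pw n * ((1 + real_of_int \<bar>n\<bar>) * cmod (z (True, n))) + pw n * ((1 + real_of_int \<bar>n\<bar>) * cmod (z (False, n)))" .
  have "cmod (C m n * (of_real (pw n) * unhat z (True, n) + of_real (qw n) * unhat z (False, n)))
    \<le> ((1 / 2 + B) * int_power b m * int_power b n) *
      (pw n * ((1 + real_of_int \<bar>n\<bar>) * cmod (z (True, n))) + pw n * ((1 + real_of_int \<bar>n\<bar>) * cmod (z (False, n))))"
    unfolding norm_mult[of "C m n"] using B nn by (intro mult_mono C_bound *) auto
  also have "\<dots> = (1 / 2 + B) * int_power b m * W"
    unfolding W_def wt_def snd_conv pw_qw(6)[symmetric] by (simp add: algebra_simps)
  finally show ?thesis unfolding W_def .
qed

lemma wt_sum_components:
  assumes z: "(\<lambda>j. wt j * cmod (z j)) summable_on UNIV"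
  shows "((\<lambda>n. wt (True, n) * cmod (z (True, n)) + wt (False, n) * cmod (z (False, n)))
    has_sum (\<Sum>\<^sub>\<infinity>j. wt j * cmod (z j))) UNIV"
  unfolding infsum_bool_prod[OF z]
  using z[unfolded summable_on_bool_prod] by (intro has_sum_add has_sum_infsum) auto

lemma G_has_sum:
  assumes z: "(\<lambda>j. wt j * cmod (z j)) summable_on UNIV"
  shows "((\<lambda>n. C m n * (of_real (pw n) * unhat z (True, n) + of_real (qw n) * unhat z (False, n))) has_sum G (unhat z) m) UNIV"
    "cmod (G (unhat z) m) \<le> (1 / 2 + B) * int_power b m * (\<Sum>\<^sub>\<infinity>j. wt j * cmod (z j))"
proof -
  note W = has_sum_cmult_right[OF wt_sum_components[OF z], of "(1 / 2 + B) * int_power b m"]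
  have "(\<lambda>n. cmod (C m n * (of_real (pw n) * unhat z (True, n) + of_real (qw n) * unhat z (False, n)))) summable_on UNIV"
    by (rule summable_on_comparison_test[OF has_sum_imp_summable[OF W]]) (use G_summand_le in auto)
  from has_sum_infsum[OF abs_summable_summable[OF this]]
  show 1: "((\<lambda>n. C m n * (of_real (pw n) * unhat z (True, n) + of_real (qw n) * unhat z (False, n))) has_sum G (unhat z) m) UNIV"
    by (simp add: G_def)
  show "cmod (G (unhat z) m) \<le> (1 / 2 + B) * int_power b m * (\<Sum>\<^sub>\<infinity>j. wt j * cmod (z j))"
    by (rule has_sum_norm_le[OF 1 W]) (rule G_summand_le)
qed

lemma weighted_perturbation_Pop: "weighted_perturbation wt Pop eta"
proof
  show "eta \<ge> 0" using B del by (simp add: eta_def)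
  show "wt j > 0" for j by (rule wt_pos)
  show "(\<lambda>j. (wt j)\<^sup>2) summable_on UNIV" by (rule wt_square_summable)
next
  fix y y' :: "bool \<times> int \<Rightarrow> complex"
  assume s: "(\<lambda>j. wt j * cmod (y j)) summable_on UNIV" "(\<lambda>j. wt j * cmod (y' j)) summable_on UNIV"
  have "G (unhat (\<lambda>j. y j - y' j)) m = G (unhat y) m - G (unhat y') m" for m
  proof -
    have "((\<lambda>n. C m n * (of_real (pw n) * unhat y (True, n) + of_real (qw n) * unhat y (False, n))
        + (- 1) * (C m n * (of_real (pw n) * unhat y' (True, n) + of_real (qw n) * unhat y' (False, n)))) has_sum
        (G (unhat y) m + (- 1) * G (unhat y') m)) UNIV"
      by (intro has_sum_add has_sum_cmult_right G_has_sum s)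
    then show ?thesis unfolding unhat_diff G_def[of "\<lambda>j. unhat y j - unhat y' j"]
      by (intro infsumI) (simp add: algebra_simps)
  qed
  then show "Pop (\<lambda>j. y j - y' j) = (\<lambda>j. Pop y j - Pop y' j)"
    by (auto simp: Pop_def fun_eq_iff right_diff_distrib)
next
  fix y :: "bool \<times> int \<Rightarrow> complex" and j :: "bool \<times> int" assume s: "(\<lambda>j. wt j * cmod (y j)) summable_on UNIV"
  obtain \<beta> m where j: "j = (\<beta>, m)" by force
  define S where "S = (\<Sum>\<^sub>\<infinity>j. wt j * cmod (y j))"
  have S: "S \<ge> 0" unfolding S_def by (intro infsum_nonneg) (simp add: less_imp_le[OF wt_pos])
  have coefle: "\<bar>if \<beta> then qw m - pw m else - (del * (pw m + qw m))\<bar> \<le> 2 * del * (pw m * (1 + real_of_int \<bar>m\<bar>))"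
  proof (cases \<beta>)
    case True
    have "pw m - qw m \<le> pw m * real_of_int \<bar>m\<bar> * del * del" using pw_qw(5)[of m] by (simp add: power2_eq_square mult_ac)
    also have "\<dots> \<le> pw m * real_of_int \<bar>m\<bar> * del * 1"
      using pw_qw(2)[of m] del by (intro mult_left_mono) auto
    also have "\<dots> \<le> 2 * del * (pw m * (1 + real_of_int \<bar>m\<bar>))"
      using pw_qw(2)[of m] del by (simp add: algebra_simps)
    finally show ?thesis using True pw_qw(4)[of m] by simp
  next
    case False
    have "del * (pw m + qw m) \<le> del * (2 * pw m)" using pw_qw(4)[of m] del by (intro mult_left_mono) auto
    also have "\<dots> \<le> 2 * del * (pw m * (1 + real_of_int \<bar>m\<bar>))"
      using pw_qw(2)[of m] del by (simp add: algebra_simps)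
    finally show ?thesis using False pw_qw(2,3)[of m] del by simp
  qed
  have "cmod (Pop y j) = \<bar>if \<beta> then qw m - pw m else - (del * (pw m + qw m))\<bar> * cmod (G (unhat y) m)"
    unfolding j Pop_def prod.case norm_mult norm_of_real ..
  also have "\<dots> \<le> (2 * del * (pw m * (1 + real_of_int \<bar>m\<bar>))) * ((1 / 2 + B) * int_power b m * S)"
    unfolding S_def using coefle del pw_qw(2)[of m] by (intro mult_mono G_has_sum s) auto
  also have "\<dots> = eta * wt j * S"
    unfolding j wt_def snd_conv eta_def pw_qw(6)[symmetric] by (simp add: algebra_simps)
  finally show "cmod (Pop y j) \<le> eta * wt j * (\<Sum>\<^sub>\<infinity>k. wt k * cmod (y k))" unfolding S_def .
qed

lemma Mop_G:
  assumes y: "l2 y"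
  shows "Mop y (True, m) = of_real (int_power ratio m / 2) * y (False, m) - of_real (pw m) * G y m"
    "Mop y (False, m) = of_real (int_power ratio m / 2) * y (True, m) + of_real (qw m) * G y m"
proof -
  note sy = Mop_summable(1)[where y=y, OF norm_le_l2norm[OF y]]
  define radp where "radp \<beta> n = int_power (1 / rad \<beta>) n" for \<beta> n
  have rp: "radp \<beta> n \<noteq> 0" for \<beta> n using int_power_pos[of "1 / rad \<beta>" n] rad[of \<beta>] by (simp add: radp_def)
  define T where "T \<beta> = (\<Sum>\<^sub>\<infinity>n. C m n * of_real (radp \<beta> n) * y (\<beta>, n))" for \<beta>
  have T: "((\<lambda>n. C m n * of_real (radp \<beta> n) * y (\<beta>, n)) has_sum T \<beta>) UNIV" for \<beta>
  proof -
    \<comment> \<open>The row of \<open>C\<close> is read off from the block with equal curves,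
      which contains no multiplier, after division by its nonzero row factor.\<close>
    have "(\<lambda>n. (1 / (of_real (sg \<beta>) * of_real (radp \<beta> m))) * (Mat \<beta> \<beta> m n * y (\<beta>, n))) summable_on UNIV"
      by (intro summable_on_cmult_right sy)
    moreover have "(1 / (of_real (sg \<beta>) * of_real (radp \<beta> m))) * (Mat \<beta> \<beta> m n * y (\<beta>, n)) = C m n * of_real (radp \<beta> n) * y (\<beta>, n)" for n
      using rp[of \<beta> m] by (simp add: Mat_def sg_def flip: radp_def)
    ultimately show ?thesis unfolding T_def by (simp add: has_sum_infsum)
  qed
  have M: "(\<Sum>\<^sub>\<infinity>n. Mat \<sigma> \<beta> m n * y (\<beta>, n)) = of_real (sg \<sigma> * radp \<sigma> m) * T \<beta> + (if \<sigma> \<noteq> \<beta> then of_real (int_power ratio m / 2) * y (\<beta>, m) else 0)" for \<sigma> \<beta>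
  proof -
    have d: "((\<lambda>n. if n = m then (if \<sigma> \<noteq> \<beta> then of_real (int_power ratio m / 2) * y (\<beta>, m) else 0) else 0) has_sum
       (if \<sigma> \<noteq> \<beta> then of_real (int_power ratio m / 2) * y (\<beta>, m) else 0)) UNIV"
      by (rule has_sum_finite_neutralI[of "{m}"]) auto
    have "((\<lambda>n. of_real (sg \<sigma> * radp \<sigma> m) * (C m n * of_real (radp \<beta> n) * y (\<beta>, n)) +
        (if n = m then (if \<sigma> \<noteq> \<beta> then of_real (int_power ratio m / 2) * y (\<beta>, m) else 0) else 0)) has_sum
       (of_real (sg \<sigma> * radp \<sigma> m) * T \<beta> + (if \<sigma> \<noteq> \<beta> then of_real (int_power ratio m / 2) * y (\<beta>, m) else 0))) UNIV"
      by (intro has_sum_add has_sum_cmult_right T d)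
    also have "(\<lambda>n. of_real (sg \<sigma> * radp \<sigma> m) * (C m n * of_real (radp \<beta> n) * y (\<beta>, n)) +
        (if n = m then (if \<sigma> \<noteq> \<beta> then of_real (int_power ratio m / 2) * y (\<beta>, m) else 0) else 0)) = (\<lambda>n. Mat \<sigma> \<beta> m n * y (\<beta>, n))"
      by (auto simp: fun_eq_iff Mat_def algebra_simps simp flip: radp_def)
    finally show ?thesis by (rule infsumI)
  qed
  have r: "radp True n = pw n" "radp False n = qw n" for n by (simp_all add: radp_def rad_def)
  have "((\<lambda>n. C m n * of_real (pw n) * y (True, n) + C m n * of_real (qw n) * y (False, n)) has_sum (T True + T False)) UNIV"
    using has_sum_add[OF T[of True] T[of False]] by (simp add: r)
  then have G: "G y m = T True + T False" unfolding G_def by (intro infsumI) (simp add: algebra_simps)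
  show "Mop y (True, m) = of_real (int_power ratio m / 2) * y (False, m) - of_real (pw m) * G y m"
    "Mop y (False, m) = of_real (int_power ratio m / 2) * y (True, m) + of_real (qw m) * G y m"
    unfolding Mop_def prod.case M G by (simp_all add: r sg_def algebra_simps)
qed

lemma hat_Mop:
  assumes "l2 y"
  shows "hat (Mop y) j = Dg j * hat y j + Pop (hat y) j"
proof -
  obtain \<beta> m where j: "j = (\<beta>, m)" by force
  have P: "Pop (hat y) (\<beta>, m) = of_real (if \<beta> then qw m - pw m else - (del * (pw m + qw m))) * G y m"
    by (simp add: Pop_def unhat_hat)
  show ?thesis
    unfolding j P unfolding hat_def Dg_def prod.case Mop_G[OF assms]
    by (cases \<beta>) (simp_all add: field_simps)
qed

lemma hat_equation:
  assumes y: "l2 y" and eq: "\<And>j. l * y j - Mop y j = x j"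
  shows "(l - Dg j) * hat y j = hat x j + Pop (hat y) j"
proof -
  have "x = (\<lambda>j. l * y j + (- 1) * Mop y j)" using eq by (auto simp: fun_eq_iff)
  then have "hat x j = l * hat y j + (- 1) * hat (Mop y) j" by (simp only: hat_linear)
  then show ?thesis by (simp add: hat_Mop[OF y] algebra_simps)
qed

lemma unhat_equation:
  assumes z: "l2 z" and eq: "\<And>j. (l - Dg j) * z j = hat x j + Pop z j"
  shows "l * unhat z j - Mop (unhat z) j = x j"
proof -
  have "hat (\<lambda>j. l * unhat z j + (- 1) * Mop (unhat z) j) = hat x"
    unfolding hat_linear hat_unhat using eq hat_Mop[OF l2_unhat(1)[OF z]]
    by (simp add: hat_unhat fun_eq_iff algebra_simps)
  then have "(\<lambda>j. l * unhat z j + (- 1) * Mop (unhat z) j) = x" by (metis unhat_hat)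
  from fun_cong[OF this, of j] show ?thesis by simp
qed

lemma Dg_range: "\<exists>t\<in>{- 1 / 2..1 / 2}. Dg j = complex_of_real t"
  unfolding Dg_def using int_power_nonneg[of ratio "snd j"] int_power_le_one[of ratio "snd j"] ratio
  by (intro bexI[where x="(if fst j then 1 else - 1) * (int_power ratio (snd j) / 2)"]) auto

section \<open>Location of the spectrum\<close>

lemma spectrum_near_interval:
  assumes l: "l \<in> NP_spectrum \<Psi> r\<^sub>i r\<^sub>e" and e: "e > 0" "eta * kappa \<le> e / 2"
  shows "\<exists>t\<in>{- 1 / 2..1 / 2}. cmod (l - complex_of_real t) \<le> e"
proof (rule ccontr)
  assume "\<not> ?thesis"
  then have far: "cmod (l - complex_of_real t) > e" if "t \<in> {- 1 / 2..1 / 2}" for t using that by force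
  interpret weighted_perturbation wt Pop eta by (rule weighted_perturbation_Pop)
  interpret perturbed_resolvent wt Pop eta Dg l e
  proof
    show "e > 0" by fact
    show "e \<le> cmod (l - Dg j)" for j using Dg_range[of j] far by force
  qed
  have loss: "loss \<le> 1 / 2"
  proof -
    have "loss \<le> eta * (\<Sum>\<^sub>\<infinity>j. (wt j)\<^sup>2) / e" by (rule loss_le)
    also have "\<dots> \<le> eta * kappa / e"
      using e eta_nonneg infsum_wt_square_le by (intro divide_right_mono mult_left_mono) auto
    also have "\<dots> \<le> (e / 2) / e" using e by (intro divide_right_mono) auto
    finally show ?thesis using e by simp
  qed
  have ws: "wsummable z" if "l2 z" for z by (rule wsum_l2(1)) (use that in \<open>simp add: l2_def\<close>)
  define w where "w j = complex_of_real (wt j)" for j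
  have w: "l2 w" using wt_square_summable by (simp add: l2_def w_def)
  \<comment> \<open>Entrywise \<open>z\<close> is at most
    \<open>(cmod (hat x j) + eta * wt j * wsum z) / e\<close>; the bound
    \<open>wsum z \<le> 2 * l2norm w * l2norm (hat x) / e\<close> turns this into the l2 bound with
    constant \<open>L\<close>.\<close>
  define L where "L = 1 / e + 2 * eta * (l2norm w / e)\<^sup>2"
  have "l \<notin> NP_spectrum \<Psi> r\<^sub>i r\<^sub>e"
  proof (rule not_in_NP_spectrum[where L="2 * (1 / del) * (L * 2)"])
    show "l \<noteq> 0" using far[of 0] e by auto
  next
    fix x assume x: "l2 x"
    obtain z where z: "\<And>j. (l - Dg j) * z j = hat x j + Pop z j" "wsummable z"
      using resolvent_exists[OF ws[OF l2_hat(1)[OF x]] loss] by blast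
    have "wsum z \<le> 2 * wsum (hat x) / e"
      by (rule resolvent_bound[OF z ws[OF l2_hat(1)[OF x]] loss])
    also have "wsum (hat x) \<le> l2norm w * l2norm (hat x)"
      using wsum_l2(2)[of "hat x"] l2_hat(1)[OF x] wt_pos by (simp add: l2_def l2norm_def w_def)
    finally have wz: "wsum z \<le> 2 * (l2norm w * l2norm (hat x)) / e" using e by (simp add: divide_right_mono)
    define u v where "u j = of_real (1 / e) * complex_of_real (cmod (hat x j))" and "v j = of_real (eta * wsum z / e) * w j" for j
    have u: "l2 u" "l2norm u = (1 / e) * l2norm (hat x)"
      using l2_cmult[of "\<lambda>j. complex_of_real (cmod (hat x j))" "of_real (1 / e)"] l2_hat(1)[OF x] e
      unfolding u_def by (auto simp: l2_def l2norm_def norm_divide)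
    have v: "l2 v" "l2norm v = (eta * wsum z / e) * l2norm w"
      using l2_cmult[OF w, of "of_real (eta * wsum z / e)"] e eta_nonneg wsum_nonneg[of z] unfolding v_def by (auto simp: norm_mult norm_divide)
    have bnd: "cmod (z j) \<le> cmod (u j + v j)" for j
    proof -
      have "cmod (z j) = cmod (hat x j + Pop z j) / cmod (l - Dg j)"
        using z(1)[of j] gap_pos[of j] by (metis norm_mult nonzero_mult_div_cancel_left less_irrefl)
      also have "\<dots> \<le> cmod (hat x j + Pop z j) / e"
        using gap[of j] e by (intro divide_left_mono) (auto intro: mult_pos_pos gap_pos)
      also have "\<dots> \<le> (cmod (hat x j) + eta * wt j * wsum z) / e"
        using e by (intro divide_right_mono norm_triangle_le add_mono P_wbound z) auto
      also have "\<dots> = cmod (u j + v j)"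
      proof -
        have "u j + v j = of_real ((cmod (hat x j) + eta * wt j * wsum z) / e)"
          using e by (simp add: u_def v_def w_def add_divide_distrib)
        moreover have "(cmod (hat x j) + eta * wt j * wsum z) / e \<ge> 0"
          using e eta_nonneg wsum_nonneg[of z] by (intro divide_nonneg_nonneg add_nonneg_nonneg mult_nonneg_nonneg) auto
        ultimately show ?thesis by (simp only: norm_of_real abs_of_nonneg)
      qed
      finally show ?thesis .
    qed
    have zl2: "l2 z" by (rule l2_mono(1)[OF l2_add(1)[OF u(1) v(1)] bnd])
    have "l2norm z \<le> l2norm u + l2norm v"
      by (rule order_trans[OF l2_mono(2)[OF l2_add(1)[OF u(1) v(1)] bnd] l2_add(2)[OF u(1) v(1)]])
    also have "\<dots> \<le> (1 / e) * l2norm (hat x) + (eta * (2 * (l2norm w * l2norm (hat x)) / e) / e) * l2norm w"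
      unfolding u v using e eta_nonneg wz by (intro add_mono mult_right_mono divide_right_mono mult_left_mono) auto
    also have "\<dots> = L * l2norm (hat x)" using e by (simp add: L_def field_simps power2_eq_square)
    also have "\<dots> \<le> L * (2 * l2norm x)" using e eta_nonneg by (intro mult_left_mono l2_hat x) (auto simp: L_def)
    finally have "l2norm z \<le> L * 2 * l2norm x" by simp
    then have "2 * (1 / del) * l2norm z \<le> 2 * (1 / del) * (L * 2 * l2norm x)"
      using del(1) by (intro mult_left_mono) auto
    then have "l2norm (unhat z) \<le> 2 * (1 / del) * (L * 2) * l2norm x"
      using l2_unhat(2)[OF zl2] by (simp add: mult.assoc)
    then show "\<exists>y. l2 y \<and> (\<forall>j. l * y j - Mop y j = x j) \<and> l2norm y \<le> 2 * (1 / del) * (L * 2) * l2norm x"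
      using l2_unhat(1)[OF zl2] unhat_equation[OF zl2 z(1)] by blast
  next
    fix y assume y: "l2 y" "\<And>j. l * y j - Mop y j = 0"
    have "(l - Dg j) * hat y j = hat (\<lambda>_. 0) j + Pop (hat y) j" for j
      using hat_equation[OF y(1), of l "\<lambda>_. 0"] y(2) by simp
    moreover have "hat (\<lambda>_. 0) = (\<lambda>_. 0)" by (auto simp: hat_def fun_eq_iff)
    moreover have "Pop (\<lambda>_. 0) = (\<lambda>_. 0)" by (auto simp: Pop_def G_def unhat_def fun_eq_iff)
    ultimately have "hat y = (\<lambda>_. 0)"
      by (intro resolvent_unique[where x="\<lambda>_. 0", OF _ _ ws[OF l2_hat(1)[OF y(1)]] _ loss]) (auto simp: wsummable_def)
    then have "y = unhat (\<lambda>_. 0)" using unhat_hat[of y] by simp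
    then show "y = (\<lambda>_. 0)" by (auto simp: unhat_def fun_eq_iff)
  qed
  then show False using l by blast
qed

lemma spectrum_meets_disc:
  assumes s: "s > 0" and gap: "\<And>l j. cmod (l - Dg k) = s \<Longrightarrow> s \<le> cmod (l - Dg j)"
    and loss: "\<And>l. cmod (l - Dg k) = s \<Longrightarrow> eta * (\<Sum>\<^sub>\<infinity>j. (wt j)\<^sup>2 / cmod (l - Dg j)) \<le> 1 / 4"
  shows "\<exists>l\<in>NP_spectrum \<Psi> r\<^sub>i r\<^sub>e. cmod (l - Dg k) \<le> s"
proof (rule ccontr)
  assume "\<not> ?thesis"
  then have dj: "cball (Dg k) s \<inter> NP_spectrum \<Psi> r\<^sub>i r\<^sub>e = {}"
    by (auto simp: dist_norm norm_minus_commute)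
  \<comment> \<open>In the original coordinates the unit vector at \<open>k\<close> has at most two
    nonzero entries, so it is the coefficient sequence of a density.\<close>
  define x where "x = unhat (\<lambda>j. if j = k then 1 else 0)"
  have "(\<lambda>j. cmod (x j)) summable_on UNIV"
    unfolding summable_on_bool_prod_all
  proof
    fix \<beta>
    have "((\<lambda>n. cmod (x (\<beta>, n))) has_sum (\<Sum>n\<in>{snd k}. cmod (x (\<beta>, n)))) UNIV"
      by (rule has_sum_finite_neutralI[of "{snd k}"]) (auto simp: x_def unhat_def split: if_splits)
    then show "(\<lambda>n. cmod (x (\<beta>, n))) summable_on UNIV" by (rule has_sum_imp_summable)
  qed
  then have xX: "x \<in> X" by (rule X_summable)
  obtain y where y: "\<And>l. l \<in> cball (Dg k) s \<Longrightarrow> y l \<in> X" "\<And>l j. l \<in> cball (Dg k) s \<Longrightarrow> l * y l j - Mop (y l) j = x j"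
    "\<And>j. (\<lambda>l. y l j) holomorphic_on cball (Dg k) s"
    using resolvent_holomorphic[OF dj xX] by blast
  define f where "f l = (l - Dg k) * hat (y l) k - 1" for l
  have hol: "f holomorphic_on cball (Dg k) s"
    unfolding f_def hat_def case_prod_unfold
    by (cases "fst k") (auto intro!: holomorphic_intros y(3))
  have "cmod (f (Dg k)) \<le> 1 / 2"
  proof (rule maximum_modulus_frontier[where S="cball (Dg k) s" and f=f])
    show "f holomorphic_on interior (cball (Dg k) s)" using hol by (rule holomorphic_on_subset) (rule interior_subset)
    show "continuous_on (closure (cball (Dg k) s)) f" using hol by (simp add: holomorphic_on_imp_continuous_on)
    fix l assume "l \<in> frontier (cball (Dg k) s)"
    then have ls: "cmod (l - Dg k) = s" using s by (simp add: dist_norm norm_minus_commute)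
    then have l: "l \<in> cball (Dg k) s" by (simp add: dist_norm norm_minus_commute)
    interpret weighted_perturbation wt Pop eta by (rule weighted_perturbation_Pop)
    interpret perturbed_resolvent wt Pop eta Dg l s
      by unfold_locales (use s gap[OF ls] in auto)
    have yl: "l2 (y l)" by (intro X_l2 y l)
    show "cmod (f l) \<le> 1 / 2"
      unfolding f_def
    proof (rule resolvent_pole)
      show "(l - Dg j) * hat (y l) j = (if j = k then 1 else 0) + Pop (hat (y l)) j" for j
        using hat_equation[OF yl y(2)[OF l], of j] by (simp add: x_def hat_unhat)
      show "wsummable (hat (y l))" by (rule wsum_l2(1)) (use l2_hat(1)[OF yl] in \<open>simp add: l2_def\<close>)
      show "loss \<le> 1 / 4" unfolding loss_def by (rule loss[OF ls])
    qed
  qed (use s in auto)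
  \<comment> \<open>At the centre the factor \<open>l - Dg k\<close> vanishes and \<open>f\<close>
    equals -1.\<close>
  then show False by (simp add: f_def)
qed

end

section \<open>Density of the spectrum\<close>

text \<open>The nearest other power of \<open>r\<close> is the next one; all larger powers are at
  least as far away.\<close>

lemma geometric_gap:
  fixes r :: real
  assumes r: "0 < r" "r < 1" and "k \<noteq> n"
  shows "r ^ n * (1 - r) \<le> \<bar>r ^ k - r ^ n\<bar>"
proof (cases "k < n")
  case True
  then obtain i where n: "n = k + Suc i" by (metis add_Suc_right less_imp_Suc_add)
  have "r ^ k * (1 - r) \<le> r ^ k * (1 - r ^ Suc i)"
    using r power_decreasing[of 1 "Suc i" r] by (intro mult_left_mono) auto
  moreover have "r ^ n * (1 - r) \<le> r ^ k * (1 - r)"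
    using r True by (intro mult_right_mono power_decreasing) auto
  moreover have "r ^ k * (1 - r ^ Suc i) = r ^ k - r ^ n" unfolding n power_add by (simp add: algebra_simps)
  ultimately show ?thesis by linarith
next
  case False
  then obtain i where k: "k = n + Suc i" using assms(3) by (metis add_Suc_right less_imp_Suc_add linorder_neqE_nat)
  have "r ^ n * (1 - r) \<le> r ^ n * (1 - r ^ Suc i)"
    using r power_decreasing[of 1 "Suc i" r] by (intro mult_left_mono) auto
  moreover have "r ^ n * (1 - r ^ Suc i) = r ^ n - r ^ k" unfolding k power_add by (simp add: algebra_simps)
  ultimately show ?thesis by linarith
qed

text \<open>Used with \<open>a = r ^ \<bar>m\<bar>\<close> and \<open>2 * d = r ^ n\<close>, where
  \<open>\<bar>m\<bar> \<le> n / 2\<close> gives \<open>2 * d \<le> a\<^sup>2\<close>. So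
  \<open>a\<close> is at least the square root of \<open>2 * d\<close>, which exceeds
  \<open>2 * d\<close> definitely because \<open>2 * d\<close> stays away from 0 and 1.\<close>

lemma low_frequency_gap:
  fixes e a d :: real
  assumes e: "0 < e" "e \<le> 1 / 4" and d: "e / 2 \<le> d" "d \<le> 1 / 2 - e" and a: "0 \<le> a" "2 * d \<le> a\<^sup>2"
  shows "e\<^sup>2 / 2 \<le> a / 2 - d"
proof (rule ccontr)
  assume "\<not> ?thesis"
  then have "a < 2 * d + e\<^sup>2" by simp
  then have "a\<^sup>2 < (2 * d + e\<^sup>2)\<^sup>2" using a by (intro power_strict_mono) auto
  also have "\<dots> = 2 * d * (2 * d) + 2 * d * (2 * e\<^sup>2) + e\<^sup>2 * e * e" by (simp add: power2_eq_square algebra_simps)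
  also have "\<dots> \<le> 2 * d * (1 - 2 * e) + 2 * d * (2 * e\<^sup>2) + e\<^sup>2 * e * (2 * d)"
    using d e by (intro add_mono mult_left_mono) auto
  also have "\<dots> = 2 * d * (1 - e * (2 - 2 * e - e * e))" by (simp add: power2_eq_square algebra_simps)
  also have "\<dots> \<le> 2 * d * 1"
  proof (intro mult_left_mono)
    have "e * e \<le> 1 * 1" using e by (intro mult_mono) auto
    then have "0 \<le> e * (2 - 2 * e - e * e)" using e by (intro mult_nonneg_nonneg) auto
    then show "1 - e * (2 - 2 * e - e * e) \<le> 1" by simp
  qed (use d e in auto)
  finally show False using a by simp
qed

context conformal_annulus_map
begin

text \<open>
  With \<open>d = r ^ n / 2\<close> the circle has radius \<open>s = d (1 - r) / 2\<close>, of order \<open>1 / n\<close>. Entries of index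
  \<open>\<bar>m\<bar> \<le> n / 2\<close> are at a distance of order \<open>e\<^sup>2\<close>, and for the others \<open>1 / s\<close> is of order \<open>n \<le> 2 \<bar>m\<bar>\<close>; so the
  inverse distances are \<open>O(1 + \<bar>m\<bar>)\<close>, which the weights in \<open>kappa\<close> absorb.
\<close>

lemma spectrum_dense_interval:
  assumes e: "0 < e" "e \<le> 1 / 4" and rat: "1 - ratio \<le> e\<^sup>2" and eta: "eta * kappa \<le> e\<^sup>2 / 16"
    and t: "t \<in> {- 1 / 2..1 / 2}"
  shows "\<exists>l\<in>NP_spectrum \<Psi> r\<^sub>i r\<^sub>e. cmod (l - complex_of_real t) \<le> 3 * e"
proof -
  \<comment> \<open>The target is moved by at most \<open>e\<close> to keep away from 0 and from
    1/2: near 0 the product \<open>s * n\<close> would lose its lower bound, and near 1/2 low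
    frequencies would crowd the circle.\<close>
  define a where "a = max e (min \<bar>t\<bar> (1 / 2 - e))"
  define \<sigma> where "\<sigma> = (if t \<ge> 0 then 1 else - 1 :: real)"
  have ee: "e\<^sup>2 \<le> e / 4" using e by (simp add: power2_eq_square)
  have a: "e \<le> a" "a \<le> 1 / 2 - e" "\<bar>\<sigma> * a - t\<bar> \<le> e"
    using e t by (auto simp: a_def \<sigma>_def max_def min_def abs_if)
  have ex: "\<exists>n. ratio ^ n / 2 \<le> a"
  proof -
    obtain n where "ratio ^ n < a" using real_arch_pow_inv[of a ratio] a e ratio by auto
    moreover have "ratio ^ n > 0" using ratio by simp
    ultimately have "ratio ^ n / 2 \<le> a" by linarith
    then show ?thesis ..
  qed
  \<comment> \<open>With the least \<open>n\<close> the preceding power is still above the target,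
    so \<open>d\<close> misses \<open>a\<close> by at most \<open>a * (1 - ratio)\<close>.\<close>
  define n where "n = (LEAST n. ratio ^ n / 2 \<le> a)"
  define d where "d = ratio ^ n / 2"
  have da: "d \<le> a" unfolding d_def n_def by (rule LeastI_ex[OF ex])
  have n0: "n \<noteq> 0"
  proof
    assume "n = 0"
    then show False using da a e by (simp add: d_def)
  qed
  then obtain n' where n': "n = Suc n'" using not0_implies_Suc by blast
  have "\<not> ratio ^ n' / 2 \<le> a" 
    by (rule not_less_Least) (unfold n_def[symmetric] n', rule lessI)
  then have "a * ratio \<le> d" using ratio by (simp add: d_def n')
  moreover have "a * (1 - ratio) \<le> 1 * e\<^sup>2"
    using rat a e ratio by (intro mult_mono) auto
  ultimately have ad: "a - d \<le> e\<^sup>2" by (simp add: algebra_simps)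
  have d: "e / 2 \<le> d" "d \<le> 1 / 2 - e" "d > 0" using ad da a ee e by auto
  \<comment> \<open>Half of the lower bound \<open>ratio ^ n * (1 - ratio) / 2\<close> for the
    distance to other entries of the same sign, so each of these stays at distance at least
    \<open>s\<close> from the circle.\<close>
  define s where "s = d * (1 - ratio) / 2"
  have s: "s > 0" using d ratio by (simp add: s_def)
  have s_le: "s \<le> e\<^sup>2 / 4"
  proof -
    have "d * (1 - ratio) \<le> (1 / 2) * e\<^sup>2" using rat d e ratio by (intro mult_mono) auto
    then show ?thesis by (simp add: s_def)
  qed
  \<comment> \<open>Bernoulli gives \<open>1 - 2 * d \<le> n * (1 - ratio)\<close>, and the left
    side is at least \<open>2 * e\<close>: reaching \<open>d\<close> by powers of
    \<open>ratio\<close> near 1 takes many steps.\<close>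
  have sn: "e\<^sup>2 / 2 \<le> s * real n"
  proof -
    have "1 - 2 * d \<le> real n * (1 - ratio)"
      using one_minus_power_le[of ratio n] ratio by (simp add: d_def)
    then have "2 * e \<le> real n * (1 - ratio)" using d by linarith
    then have "(e / 2) * (2 * e) \<le> d * (real n * (1 - ratio))"
      by (rule mult_mono[OF d(1)]) (use d e in auto)
    then show ?thesis by (simp add: s_def power2_eq_square mult_ac)
  qed
  define k where "k = (t \<ge> 0, int n)"
  have Dk: "Dg k = complex_of_real (\<sigma> * d)"
    by (simp add: Dg_def k_def \<sigma>_def d_def int_power_def)
  have dist_le: "cmod (Dg j - Dg k) - s \<le> cmod (l - Dg j)" if "cmod (l - Dg k) = s" for l j
    using norm_triangle_ineq2[of "Dg j - Dg k" "l - Dg k"] that norm_minus_commute[of "Dg j" l] by (simp add: algebra_simps)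
  have main: "s \<le> cmod (l - Dg j)" "e\<^sup>2 / (4 * (1 + real_of_int \<bar>snd j\<bar>)) \<le> cmod (l - Dg j)"
    if l: "cmod (l - Dg k) = s" for l j
  proof -
    obtain \<beta> m where j: "j = (\<beta>, m)" by force
    define x where "x = ratio ^ nat \<bar>m\<bar>"
    have x: "x > 0" using ratio by (simp add: x_def)
    have Dj: "Dg j = complex_of_real ((if \<beta> then 1 else - 1) * (x / 2))"
      by (simp add: Dg_def j x_def int_power_def)
    have low: "e\<^sup>2 / (4 * (1 + real_of_int \<bar>snd j\<bar>)) \<le> e\<^sup>2 / 4"
      using e by (intro divide_left_mono) auto
    have "s \<le> cmod (l - Dg j) \<and> e\<^sup>2 / (4 * (1 + real_of_int \<bar>snd j\<bar>)) \<le> cmod (l - Dg j)"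
    proof (cases "\<beta> = (t \<ge> 0)")
      case False
      have "cmod (Dg j - Dg k) = x / 2 + d"
        using False x d unfolding Dj Dk of_real_diff[symmetric] norm_of_real by (auto simp: \<sigma>_def)
      then have "d - s \<le> cmod (l - Dg j)" using dist_le[OF l, of j] x by simp
      then have "e\<^sup>2 / 4 \<le> cmod (l - Dg j)" using d s_le ee e by linarith
      then show ?thesis using low s_le by linarith
    next
      case True
      have diff: "cmod (Dg j - Dg k) = \<bar>x / 2 - d\<bar>"
        using True unfolding Dj Dk of_real_diff[symmetric] norm_of_real by (auto simp: \<sigma>_def)
      have gap: "s \<le> cmod (l - Dg j)"
      \<comment> \<open>The indices \<open>n\<close> and \<open>- n\<close> share one diagonal
        value, the centre of the circle; both are then at distance exactly \<open>s\<close>.\<close>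
      proof (cases "nat \<bar>m\<bar> = n")
        case True
        then have "Dg j = Dg k" using \<open>\<beta> = (t \<ge> 0)\<close> by (simp add: Dj Dk \<sigma>_def x_def d_def)
        then show ?thesis using l by simp
      next
        case False
        have "2 * s \<le> \<bar>x / 2 - d\<bar>"
        proof -
          have "2 * s = ratio ^ n * (1 - ratio) / 2" by (simp add: s_def d_def)
          moreover have "x / 2 - d = (ratio ^ nat \<bar>m\<bar> - ratio ^ n) / 2"
            by (simp add: x_def d_def diff_divide_distrib)
          ultimately show ?thesis using geometric_gap[OF ratio False] by (simp add: abs_divide)
        qed
        then show ?thesis using dist_le[OF l, of j] diff by linarith
      qed
      show ?thesis
      proof (cases "2 * nat \<bar>m\<bar> \<le> n")
        case True
        have "ratio ^ n \<le> ratio ^ (2 * nat \<bar>m\<bar>)" using True ratio by (intro power_decreasing) auto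
        then have "2 * d \<le> x\<^sup>2" by (simp add: d_def x_def power_mult mult.commute)
        then have "e\<^sup>2 / 2 \<le> x / 2 - d" using e d x by (intro low_frequency_gap) auto
        then have "e\<^sup>2 / 4 \<le> cmod (l - Dg j)" using dist_le[OF l, of j] diff s_le by linarith
        then show ?thesis using gap low by linarith
      next
        case False
        have "e\<^sup>2 / 2 \<le> s * real n" by (rule sn)
        also have "\<dots> \<le> s * (2 * (1 + real_of_int \<bar>m\<bar>))" using False s by (intro mult_left_mono) auto
        finally have "e\<^sup>2 / (4 * (1 + real_of_int \<bar>m\<bar>)) \<le> s" by (simp add: divide_le_eq algebra_simps)
        then show ?thesis using gap by (simp add: j)
      qed
    qed
    then show "s \<le> cmod (l - Dg j)" "e\<^sup>2 / (4 * (1 + real_of_int \<bar>snd j\<bar>)) \<le> cmod (l - Dg j)" by auto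
  qed
  have "\<exists>l\<in>NP_spectrum \<Psi> r\<^sub>i r\<^sub>e. cmod (l - Dg k) \<le> s"
  proof (rule spectrum_meets_disc[OF s main(1)])
    fix l assume l: "cmod (l - Dg k) = s"
    have le: "(wt j)\<^sup>2 / cmod (l - Dg j) \<le> (4 / e\<^sup>2) * ((wt j)\<^sup>2 * (1 + real_of_int \<bar>snd j\<bar>))" for j
    proof -
      define c where "c = 1 + real_of_int \<bar>snd j\<bar>"
      have c: "c > 0" by (simp add: c_def)
      have "(wt j)\<^sup>2 / cmod (l - Dg j) \<le> (wt j)\<^sup>2 / (e\<^sup>2 / (4 * c))"
        using main(2)[OF l, of j] e c s main(1)[OF l, of j]
        by (intro divide_left_mono mult_pos_pos) (auto simp: c_def)
      also have "\<dots> = (4 / e\<^sup>2) * ((wt j)\<^sup>2 * c)" using c e by simp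
      finally show ?thesis by (simp add: c_def)
    qed
    have sm: "(\<lambda>j. (4 / e\<^sup>2) * ((wt j)\<^sup>2 * (1 + real_of_int \<bar>snd j\<bar>))) summable_on UNIV"
      by (intro summable_on_cmult_right kappa_summable)
    have "(\<Sum>\<^sub>\<infinity>j. (wt j)\<^sup>2 / cmod (l - Dg j)) \<le> (\<Sum>\<^sub>\<infinity>j. (4 / e\<^sup>2) * ((wt j)\<^sup>2 * (1 + real_of_int \<bar>snd j\<bar>)))"
      by (rule infsum_mono[OF summable_on_comparison_test[OF sm] sm]) (use le in auto)
    also have "\<dots> = (4 / e\<^sup>2) * kappa"
      unfolding kappa_def by (rule infsum_cmult_right) (use kappa_summable in auto)
    finally have "eta * (\<Sum>\<^sub>\<infinity>j. (wt j)\<^sup>2 / cmod (l - Dg j)) \<le> eta * ((4 / e\<^sup>2) * kappa)"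
      using B del by (intro mult_left_mono) (auto simp: eta_def)
    also have "\<dots> = (4 / e\<^sup>2) * (eta * kappa)" by simp
    \<comment> \<open>The threshold \<open>e\<^sup>2 / 16\<close> is what makes \<open>loss\<close>
      at most 1/4 here.\<close>
    also have "\<dots> \<le> (4 / e\<^sup>2) * (e\<^sup>2 / 16)" using eta by (intro mult_left_mono) auto
    also have "\<dots> = 1 / 4" using e by simp
    finally show "eta * (\<Sum>\<^sub>\<infinity>j. (wt j)\<^sup>2 / cmod (l - Dg j)) \<le> 1 / 4" .
  qed
  then obtain l where l: "l \<in> NP_spectrum \<Psi> r\<^sub>i r\<^sub>e" "cmod (l - Dg k) \<le> s" by blast
  have "cmod (Dg k - complex_of_real t) = \<bar>\<sigma> * d - t\<bar>"
    unfolding Dk of_real_diff[symmetric] norm_of_real ..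
  also have "\<dots> \<le> \<bar>\<sigma> * a - t\<bar> + (a - d)" using da by (auto simp: \<sigma>_def)
  finally have "cmod (Dg k - complex_of_real t) \<le> e + e\<^sup>2" using a(3) ad by linarith
  then have "cmod (l - complex_of_real t) \<le> 3 * e"
    using norm_triangle_ineq[of "l - Dg k" "Dg k - complex_of_real t"] l(2) s_le ee e by simp
  then show ?thesis using l(1) by blast
qed

lemma hausdorff_distance_le:
  assumes \<epsilon>: "\<epsilon> > 0" and e: "e \<le> 1 / 4" "3 * e \<le> \<epsilon>" "e > 0"
    and "1 - ratio \<le> e\<^sup>2" "eta * kappa \<le> e\<^sup>2 / 16"
  shows "hausdorff_distance (NP_spectrum \<Psi> r\<^sub>i r\<^sub>e) (complex_of_real ` {- 1 / 2..1 / 2}) \<le> ennreal \<epsilon>"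
proof -
  have "e\<^sup>2 \<le> e" using e by (simp add: power2_eq_square)
  then have half: "eta * kappa \<le> \<epsilon> / 2" using assms by linarith
  show ?thesis
    unfolding hausdorff_distance_def
  proof (intro max.boundedI SUP_least)
    fix l assume "l \<in> NP_spectrum \<Psi> r\<^sub>i r\<^sub>e"
    then obtain t where t: "t \<in> {- 1 / 2..1 / 2}" "cmod (l - complex_of_real t) \<le> \<epsilon>"
      using spectrum_near_interval[OF _ \<epsilon> half] by blast
    show "(INF t\<in>complex_of_real ` {- 1 / 2..1 / 2}. ennreal (dist l t)) \<le> ennreal \<epsilon>"
      by (rule INF_lower2[of "complex_of_real t"]) (use t in \<open>auto simp: dist_norm intro: ennreal_leI\<close>)
  next
    fix z assume "z \<in> complex_of_real ` {- 1 / 2..1 / 2}"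
    then obtain t where t: "t \<in> {- 1 / 2..1 / 2}" "z = complex_of_real t" by blast
    obtain l where l: "l \<in> NP_spectrum \<Psi> r\<^sub>i r\<^sub>e" "cmod (l - z) \<le> 3 * e"
      using spectrum_dense_interval[OF e(3,1) assms(5,6) t(1)] t(2) by blast
    show "(INF s\<in>NP_spectrum \<Psi> r\<^sub>i r\<^sub>e. ennreal (dist s z)) \<le> ennreal \<epsilon>"
      by (rule INF_lower2[OF l(1)]) (use l(2) e in \<open>auto simp: dist_norm intro: ennreal_leI\<close>)
  qed
qed

end

text \<open>\<open>B\<close> and \<open>kappa\<close> are fixed before \<open>r\<^sub>e\<close>, so
  both smallness conditions reduce to \<open>1 - r\<^sub>i / r\<^sub>e\<close> tending to 0.\<close>

theorem (in expanded_exterior_map) hausdorff_distance_tendsto: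
  "((\<lambda>r\<^sub>e. hausdorff_distance (NP_spectrum \<Psi> r\<^sub>i r\<^sub>e) (complex_of_real ` {- 1 / 2..1 / 2})) \<longlongrightarrow> 0) (at_right r\<^sub>i)"
proof (rule order_tendstoI)
  fix u :: ennreal assume "0 < u"
  then obtain \<epsilon> where \<epsilon>: "\<epsilon> > 0" "ennreal \<epsilon> < u" by (rule ennreal_pos_real)
  define e where "e = min (1 / 4) (\<epsilon> / 3)"
  have e: "e \<le> 1 / 4" "3 * e \<le> \<epsilon>" "e > 0" using \<epsilon> by (auto simp: e_def)
  have l1: "((\<lambda>r\<^sub>e. 1 - r\<^sub>i / r\<^sub>e) \<longlongrightarrow> 1 - r\<^sub>i / r\<^sub>i) (at_right r\<^sub>i)"
    using radii_pos by (intro tendsto_intros) auto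
  have l2: "((\<lambda>r\<^sub>e. 2 * (1 / 2 + B) * sqrt (1 - r\<^sub>i / r\<^sub>e) * kappa) \<longlongrightarrow> 2 * (1 / 2 + B) * sqrt (1 - r\<^sub>i / r\<^sub>i) * kappa) (at_right r\<^sub>i)"
    by (intro tendsto_intros l1)
  have "\<forall>\<^sub>F r\<^sub>e in at_right r\<^sub>i. 1 - r\<^sub>i / r\<^sub>e < e\<^sup>2"
    by (rule order_tendstoD(2)[OF l1]) (use radii_pos e in auto)
  moreover have "\<forall>\<^sub>F r\<^sub>e in at_right r\<^sub>i. 2 * (1 / 2 + B) * sqrt (1 - r\<^sub>i / r\<^sub>e) * kappa < e\<^sup>2 / 16"
    by (rule order_tendstoD(2)[OF l2]) (use radii_pos e in auto)
  ultimately show "\<forall>\<^sub>F r\<^sub>e in at_right r\<^sub>i. hausdorff_distance (NP_spectrum \<Psi> r\<^sub>i r\<^sub>e) (complex_of_real ` {- 1 / 2..1 / 2}) < u"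
    using eventually_at_right_less[of r\<^sub>i]
  proof eventually_elim
    case (elim r\<^sub>e)
    interpret conformal_annulus_map \<Psi> \<alpha> \<gamma> r\<^sub>i B b c r\<^sub>e by unfold_locales (rule elim(3))
    have "hausdorff_distance (NP_spectrum \<Psi> r\<^sub>i r\<^sub>e) (complex_of_real ` {- 1 / 2..1 / 2}) \<le> ennreal \<epsilon>"
      using elim(1,2) by (intro hausdorff_distance_le[OF \<epsilon>(1) e]) (auto simp: ratio_def eta_def del_def)
    then show ?case using \<epsilon>(2) by (rule le_less_trans)
  qed
qed auto

theorem theorem4p7:
  fixes \<Omega> :: "complex set" and \<gamma> r\<^sub>i :: real
    and \<Psi> :: "complex \<Rightarrow> complex" and a :: "nat \<Rightarrow> complex"
  assumes "open \<Omega>" and "connected \<Omega>" and "\<Omega> \<noteq> {}" and "simply_connected \<Omega>" and "bounded \<Omega>"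
    and "\<gamma> > 0"
    and "\<Psi> holomorphic_on {w. \<gamma> < norm w}"
    and "bij_betw \<Psi> {w. \<gamma> < norm w} (- closure \<Omega>)"
    and "\<And>w. \<gamma> < norm w \<Longrightarrow> (\<lambda>n. a n / w ^ n) sums (\<Psi> w - w)"
    and "\<gamma> < r\<^sub>i"
  shows "((\<lambda>r\<^sub>e. hausdorff_distance (NP_spectrum \<Psi> r\<^sub>i r\<^sub>e) (complex_of_real ` {-1/2..1/2}))
           \<longlongrightarrow> 0) (at_right r\<^sub>i)"
proof -
  have "inj_on \<Psi> {w. \<gamma> < norm w}" using assms(8) by (rule bij_betw_imp_inj_on)
  then interpret exterior_map \<Psi> a \<gamma>
    by (rule exterior_map.intro[OF assms(6,7) _ assms(9)])
  show ?thesis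
  proof (rule kernel_double_series[OF assms(10)])
    fix c :: "nat \<Rightarrow> nat \<Rightarrow> complex" and B b :: real
    assume c: "\<gamma> < b" "b < r\<^sub>i" "B \<ge> 0" "\<And>m n. cmod (c m n) \<le> B * b ^ m * b ^ n"
      "\<And>w \<zeta>. \<lbrakk>r\<^sub>i \<le> norm w; r\<^sub>i \<le> norm \<zeta>; w \<noteq> \<zeta>\<rbrakk> \<Longrightarrow>
         ((\<lambda>(m, n). c m n * (1 / w) ^ m * (1 / \<zeta>) ^ n) has_sum
           (w * deriv \<Psi> w / (\<Psi> w - \<Psi> \<zeta>) - w / (w - \<zeta>))) UNIV"
    interpret expanded_exterior_map \<Psi> a \<gamma> r\<^sub>i B b c
      by (rule expanded_exterior_map.intro[OF exterior_map_axioms expanded_exterior_map_axioms.intro[OF c]])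
    show ?thesis by (rule hausdorff_distance_tendsto)
  qed
qed

end
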